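(* There is a distance labeling scheme for the family of permutation graphs that assigns to the vertices of every permutation graph with $n$ vertices labels of size $3\log n+\mathcal{O}(\log\log n)$ bits. The decoder of this scheme, computing the distance between two vertices from their two labels, has constant time complexity, and the labels can be constructed in polynomial time.
   Context: A graph $G=(V,E)$ with $V=\{1,\dots,n\}$ is a permutation graph if there is a permutation $\pi$ of $\{1,\dots,n\}$ such that $u$ and $v$ with $u<v$ are adjacent exactly when $\pi(u)>\pi(v)$ (graphs are unweighted and undirected, and the notion is up to isomorphism). Permutation graphs are not assumed connected; the distance between vertices in different connected components is $\infty$. A distance labeling scheme for a family $\mathcal{G}$ of graphs consists of an encoder and a decoder. The encoder takes a graph $G\in\mathcal{G}$ and assigns a binary string (label) $\ell(u)$ to every vertex $u$ of $G$. The decoder receives two labels $\ell(u),\ell(w)$ of vertices $u\neq w$ of the same graph $G\in\mathcal{G}$ and must output the exact distance $d(u,w)$ in $G$. The decoder is one fixed procedure for the whole family: it has no knowledge of $G$ other than that $G\in\mathcal{G}$, and has no input besides the two labels. The size of the scheme on $n$-vertex graphs is the maximum length of a label assigned by the encoder to any vertex of any $n$-vertex graph in $\mathcal{G}$. Logarithms are base $2$. Constant time is understood in the standard word RAM model with words of $\Theta(\log n)$ bits. *)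

theory Defs
  imports Complex_Main "HOL-Library.Extended_Nat" "HOL-Library.Landau_Symbols"
    "HOL-Combinatorics.Permutations"
begin

section \<open>Graphs and permutation graphs\<close>

text \<open>A graph with vertex set \<open>{1..n}\<close> is given by \<open>n\<close> and its symmetric edge relation.\<close>

definition graph :: "nat \<Rightarrow> (nat \<times> nat) set \<Rightarrow> bool" where
  "graph n E \<longleftrightarrow> E \<subseteq> {1..n} \<times> {1..n} \<and> sym E \<and> irrefl E"

definition inversion_graph :: "nat \<Rightarrow> (nat \<Rightarrow> nat) \<Rightarrow> (nat \<times> nat) set" where
  "inversion_graph n p =
     {(u, v) \<in> {1..n} \<times> {1..n}. u < v \<and> p u > p v \<or> v < u \<and> p v > p u}"

definition graph_isomorphic :: "nat \<Rightarrow> (nat \<times> nat) set \<Rightarrow> (nat \<times> nat) set \<Rightarrow> bool" where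
  "graph_isomorphic n E F \<longleftrightarrow>
     (\<exists>h. bij_betw h {1..n} {1..n} \<and>
       (\<forall>u\<in>{1..n}. \<forall>v\<in>{1..n}. (u, v) \<in> E \<longleftrightarrow> (h u, h v) \<in> F))"

definition permutation_graph :: "nat \<Rightarrow> (nat \<times> nat) set \<Rightarrow> bool" where
  "permutation_graph n E \<longleftrightarrow>
     graph n E \<and> (\<exists>p. p permutes {1..n} \<and> graph_isomorphic n E (inversion_graph n p))"

text \<open>The infimum is over the lengths of all walks; it is \<open>\<infinity>\<close> if there is none.\<close>

definition graph_dist :: "(nat \<times> nat) set \<Rightarrow> nat \<Rightarrow> nat \<Rightarrow> enat" where
  "graph_dist E u v = (INF k\<in>{k. (u, v) \<in> E ^^ k}. enat k)"

section \<open>Distance labeling schemes\<close>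

type_synonym label = "bool list"
type_synonym family = "nat \<Rightarrow> (nat \<times> nat) set \<Rightarrow> bool"
type_synonym encoder = "nat \<Rightarrow> (nat \<times> nat) set \<Rightarrow> nat \<Rightarrow> label"
type_synonym decoder = "label \<Rightarrow> label \<Rightarrow> enat"

definition distance_labeling_scheme :: "family \<Rightarrow> encoder \<Rightarrow> decoder \<Rightarrow> bool" where
  "distance_labeling_scheme \<G> enc dec \<longleftrightarrow>
     (\<forall>n E. \<G> n E \<longrightarrow> (\<forall>u\<in>{1..n}. \<forall>v\<in>{1..n}. u \<noteq> v \<longrightarrow>
        dec (enc n E u) (enc n E v) = graph_dist E u v))"

definition scheme_size :: "family \<Rightarrow> encoder \<Rightarrow> nat \<Rightarrow> nat" where
  "scheme_size \<G> enc n = Max {length (enc n E u) | E u. \<G> n E \<and> u \<in> {1..n}}"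

section \<open>The word RAM\<close>

text \<open>
  Programs are structured; they use constantly many registers and a word-addressed memory.
  A word of \<open>w\<close> bits is a natural number below \<open>2 ^ w\<close>. The word size \<open>w\<close> is a parameter of
  the semantics, so that a single program can be run for every word size.
\<close>

datatype binop = Add | Sub | Mul | Div | Mod | And | Or | Xor | Shl | Shr | Less | Equal

fun binop_val :: "nat \<Rightarrow> binop \<Rightarrow> nat \<Rightarrow> nat \<Rightarrow> nat" where
  "binop_val w Add x y = (x + y) mod 2 ^ w"
| "binop_val w Sub x y = (x + 2 ^ w - y) mod 2 ^ w"
| "binop_val w Mul x y = (x * y) mod 2 ^ w"
| "binop_val w Div x y = x div y"
| "binop_val w Mod x y = x mod y"
| "binop_val w And x y = Bit_Operations.and x y"
| "binop_val w Or x y = Bit_Operations.or x y"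
| "binop_val w Xor x y = Bit_Operations.xor x y"
| "binop_val w Shl x y = (x * 2 ^ y) mod 2 ^ w"
| "binop_val w Shr x y = x div 2 ^ y"
| "binop_val w Less x y = of_bool (x < y)"
| "binop_val w Equal x y = of_bool (x = y)"

datatype program =
    Skip
  | Const nat nat             \<comment> \<open>register \<open>:=\<close> constant\<close>
  | Op nat binop nat nat      \<comment> \<open>target register first\<close>
  | Load nat nat              \<comment> \<open>target register, register holding the address\<close>
  | Store nat nat             \<comment> \<open>register holding the address, source register\<close>
  | Seq program program
  | Cond nat program program  \<comment> \<open>tests whether the register is nonzero\<close>
  | While nat program

record state =
  reg :: "nat \<Rightarrow> nat"
  mem :: "nat \<Rightarrow> nat"

text \<open>
  \<open>runs w P s t s'\<close>: with word size \<open>w\<close>, program \<open>P\<close> started in \<open>s\<close> halts in \<open>s'\<close> after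
  exactly \<open>t\<close> steps. Every instruction and every test takes one step.
\<close>

inductive runs :: "nat \<Rightarrow> program \<Rightarrow> state \<Rightarrow> nat \<Rightarrow> state \<Rightarrow> bool" for w where
  Skip: "runs w Skip s 1 s"
| Const: "runs w (Const r c) s 1 (s\<lparr>reg := (reg s)(r := c mod 2 ^ w)\<rparr>)"
| Op: "runs w (Op r f x y) s 1
         (s\<lparr>reg := (reg s)(r := binop_val w f (reg s x) (reg s y))\<rparr>)"
| Load: "runs w (Load r x) s 1 (s\<lparr>reg := (reg s)(r := mem s (reg s x))\<rparr>)"
| Store: "runs w (Store x y) s 1 (s\<lparr>mem := (mem s)(reg s x := reg s y)\<rparr>)"
| Seq: "runs w P s t s' \<Longrightarrow> runs w Q s' t' s'' \<Longrightarrow> runs w (Seq P Q) s (t + t') s''"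
| Cond_True: "reg s x \<noteq> 0 \<Longrightarrow> runs w P s t s' \<Longrightarrow> runs w (Cond x P Q) s (Suc t) s'"
| Cond_False: "reg s x = 0 \<Longrightarrow> runs w Q s t s' \<Longrightarrow> runs w (Cond x P Q) s (Suc t) s'"
| While_False: "reg s x = 0 \<Longrightarrow> runs w (While x P) s 1 s"
| While_True: "reg s x \<noteq> 0 \<Longrightarrow> runs w P s t s' \<Longrightarrow> runs w (While x P) s' t' s'' \<Longrightarrow>
         runs w (While x P) s (Suc (t + t')) s''"

definition init_state :: "nat \<Rightarrow> nat list \<Rightarrow> nat list \<Rightarrow> state" where
  "init_state w rs ms =
     \<lparr>reg = (\<lambda>i. if i < length rs then rs ! i mod 2 ^ w else 0),
      mem = (\<lambda>i. if i < length ms then ms ! i mod 2 ^ w else 0)\<rparr>"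

text \<open>Bit strings are packed into words, \<open>w\<close> bits per word, the first bit least significant.\<close>

definition pack :: "nat \<Rightarrow> bool list \<Rightarrow> nat list" where
  "pack w l = map (\<lambda>i. horner_sum of_bool 2 (take w (drop (i * w) l)))
                  [0..<(length l + w - 1) div w]"

text \<open>
  Words have \<open>\<Theta>(log n)\<close> bits, with constants \<open>a\<close> and \<open>b\<close>; the summand \<open>1\<close> only serves to
  make the bounds positive for \<open>n = 1\<close>.
\<close>

definition word_size :: "real \<Rightarrow> real \<Rightarrow> nat \<Rightarrow> nat \<Rightarrow> bool" where
  "word_size a b n w \<longleftrightarrow> a * (1 + log 2 (real n)) \<le> real w \<and> real w \<le> b * (1 + log 2 (real n))"

section \<open>Complexity of decoder and encoder\<close>

text \<open>
  The decoder receives each label as its length in bits and the address of its packed bits.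
  It answers in register 0 whether the distance is finite, and if so, gives it in register 1.
\<close>

definition decoder_input :: "nat \<Rightarrow> label \<Rightarrow> label \<Rightarrow> state" where
  "decoder_input w l l' =
     init_state w [length l, 0, length l', length (pack w l)] (pack w l @ pack w l')"

definition decoder_output :: "state \<Rightarrow> enat \<Rightarrow> bool" where
  "decoder_output s d \<longleftrightarrow>
     (case d of enat k \<Rightarrow> reg s 0 = 1 \<and> reg s 1 = k | \<infinity> \<Rightarrow> reg s 0 = 0)"

text \<open>
  One program serves all graphs and all word sizes with a sufficiently large constant \<open>a\<close>;
  the bound on the running time may depend on the constants in \<open>\<Theta>(log n)\<close> only.
\<close>

definition constant_time_decoder :: "family \<Rightarrow> encoder \<Rightarrow> decoder \<Rightarrow> bool" where
  "constant_time_decoder \<G> enc dec \<longleftrightarrow>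
     (\<exists>P. \<exists>a>0. \<forall>b. \<exists>T. \<forall>n E w. \<G> n E \<and> word_size a b n w \<longrightarrow>
        (\<forall>u\<in>{1..n}. \<forall>v\<in>{1..n}. u \<noteq> v \<longrightarrow>
          (\<exists>t\<le>T. \<exists>s. runs w P (decoder_input w (enc n E u) (enc n E v)) t s \<and>
             decoder_output s (dec (enc n E u) (enc n E v)))))"

text \<open>
  The encoder receives \<open>n\<close> in register 0 and the adjacency matrix, row by row and one entry
  per word, from address 0 on. When it halts, register 0 points to a table with two words per
  vertex: the length of its label in bits and the address of its packed label.
\<close>

definition encoder_input :: "nat \<Rightarrow> nat \<Rightarrow> (nat \<times> nat) set \<Rightarrow> state" where
  "encoder_input w n E =
     init_state w [n] [of_bool ((u, v) \<in> E). u \<leftarrow> [1..<Suc n], v \<leftarrow> [1..<Suc n]]"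

definition encoder_output :: "nat \<Rightarrow> nat \<Rightarrow> state \<Rightarrow> (nat \<Rightarrow> label) \<Rightarrow> bool" where
  "encoder_output w n s lab \<longleftrightarrow>
     (\<forall>u\<in>{1..n}. let e = reg s 0 + 2 * (u - 1) in
        mem s e = length (lab u) \<and>
        (\<forall>i<length (pack w (lab u)). mem s (mem s (e + 1) + i) = pack w (lab u) ! i))"

definition polynomial_time_encoder :: "family \<Rightarrow> encoder \<Rightarrow> bool" where
  "polynomial_time_encoder \<G> enc \<longleftrightarrow>
     (\<exists>P. \<exists>a>0. \<forall>b. \<exists>c k. \<forall>n\<ge>1. \<forall>E w. \<G> n E \<and> word_size a b n w \<longrightarrow>
        (\<exists>t\<le>c * n ^ k. \<exists>s. runs w P (encoder_input w n E) t s \<and>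
           encoder_output w n s (enc n E)))"

end

theory Submission
  imports Defs
begin

text \<open>
  A vertex of a permutation graph is a segment between two parallel lines, and adjacent vertices are
  crossing segments. From a segment, always moving on to the segment that crosses the current one and
  has the furthest end gives shortest paths. The greedy chain from the leftmost position of a component
  cuts the lines into levels, and moves from different positions of a level stay interleaved. So the
  number of moves between two positions is their difference in level, up to a correction that a single
  linear order on the positions of the component decides. A label therefore needs the ranks of the two
  ends of its segment in that order and one level; the level of the other end differs from it by at
  most a constant. Vertices of different components must be told apart without further bits: ranks and levels
  in a component with about \<open>2 ^ k\<close> vertices need about \<open>k\<close> bits, so the leading bit of a rank field can reveal
  \<open>k\<close>, and the bits of the level field above the lowest \<open>k\<close> are free to hold the position of the component.
  This gives \<open>3 * log 2 n + 18\<close> bits.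

  The segments are computed by transitively orienting the graph and its complement together: the unoriented
  pairs are split into implication classes, each of which can be oriented either way without destroying the
  existence of a diagram. The machine programs come from a language of bounded loops, whose cost is
  visibly a polynomial in \<open>n\<close>, and is constant for the loop-free decoder.
\<close>

section \<open>Bounded iteration\<close>

text \<open>The correction is 0 or 2 because levels on one line have one parity. A single linear
  order decides it because moves preserve the order of positions on a line: three positions beating
  each other cyclically would, pushed by further moves to one level, compare a position strictly
  with itself. Counting the beaten positions turns the relation into a rank of logarithmic length.
  For the diagram, the obstacle is that orienting one class must leave the others orientable. Two
  certificates are carried along: no triangle has three colours, and some vertex order, never
  computed, is compatible with the colouring. The vertices touched by a class look alike from
  outside, so that order can gather them into one block, and then it tolerates a separate colour for
  the class. In the end the directions of all pairs give the order along one line, and reversing the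
  edges gives the other. The 18 is 3 * 5 + 3: each of three fields has as its range the least power
  of two that is at least 16 * n, and the difference in level of the two ends of a segment takes 3
  bits.\<close>

text \<open>The counter runs downwards, from \<open>n\<close> to \<open>1\<close>.\<close>

primrec iter :: "(nat \<Rightarrow> 'a \<Rightarrow> 'a) \<Rightarrow> nat \<Rightarrow> 'a \<Rightarrow> 'a" where
  "iter f 0 a = a"
| "iter f (Suc k) a = iter f k (f (Suc k) a)"

lemma iter_invariant:
  assumes "I a" "\<And>k a. k \<in> {1..n} \<Longrightarrow> I a \<Longrightarrow> I (f k a)"
  shows "I (iter f n a)"
  using assms by (induction n arbitrary: a) auto

lemma iter_rel:
  assumes "R a b" "\<And>k a b. k \<in> {1..n} \<Longrightarrow> R a b \<Longrightarrow> R (f k a) (g k b)"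
  shows "R (iter f n a) (iter g n b)"
  using assms by (induction n arbitrary: a b) auto

lemma iter_cong:
  assumes "\<And>k a. k \<in> {1..n} \<Longrightarrow> f k a = g k a"
  shows "iter f n a = iter g n a"
  by (rule iter_rel[where R="(=)"]) (use assms in auto)

text \<open>Each round settles its own index and disturbs nothing that is settled. The induction is
  over the rest of a loop: an index is still to come or settled already. This serves the nested
  loops that must treat every pair or write every cell.\<close>

lemma iter_covers:
  assumes "I a" and step: "\<And>k a. k \<in> {1..n} \<Longrightarrow> I a \<Longrightarrow> I (f k a)"
    and fin: "\<And>k a. k \<in> {1..n} \<Longrightarrow> I a \<Longrightarrow> D k (f k a)"
    and keep: "\<And>j k a. k \<in> {1..n} \<Longrightarrow> I a \<Longrightarrow> D j a \<Longrightarrow> D j (f k a)"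
    and k: "k \<in> {1..n}"
  shows "D k (iter f n a)"
proof -
  have "D k (iter f m a)" if "m \<le> n" "I a" "k \<le> m \<or> D k a" for m a
    using that
  proof (induction m arbitrary: a)
    case (Suc m)
    have m: "Suc m \<in> {1..n}" using Suc.prems by simp
    have "k \<le> m \<or> D k (f (Suc m) a)"
      using fin[OF m Suc.prems(2)] keep[OF m Suc.prems(2), of k] Suc.prems(3) by (auto simp: le_Suc_eq)
    then show ?case using Suc.IH[OF _ step[OF m Suc.prems(2)]] Suc.prems(1) by simp
  qed (use k in simp)
  then show ?thesis using assms(1) k by simp
qed

lemma iter_funpow: "iter (\<lambda>_. f) n a = (f ^^ n) a"
  by (induction n arbitrary: a) (simp_all add: funpow_Suc_right del: funpow.simps(2))

text \<open>The counter falls, so the guard discards the first \<open>n - t\<close> rounds and the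
  last \<open>t\<close> rounds run unguarded. A loop with a fixed bound can thus make a number of
  moves known only at run time.\<close>

lemma iter_funpow_le:
  assumes "t \<le> n"
  shows "iter (\<lambda>k a. if k \<le> t then f a else a) n a = (f ^^ t) a"
proof -
  let ?g = "\<lambda>k a. if k \<le> t then f a else a"
  have "iter ?g (t + d) a = iter ?g t a" for d
    by (induction d) simp_all
  from this[of "n - t"] have "iter ?g n a = iter ?g t a" using assms by simp
  also have "\<dots> = iter (\<lambda>_. f) t a" by (rule iter_cong) simp
  also have "\<dots> = (f ^^ t) a" by (rule iter_funpow)
  finally show ?thesis .
qed

lemma iter_count:
  "iter (\<lambda>k a. if Q k then a + 1 else a) n a = a + card {k \<in> {1..n}. Q k}"
proof (induction n arbitrary: a)
  case (Suc n)
  have "{k \<in> {1..Suc n}. Q k} = (if Q (Suc n) then insert (Suc n) {k \<in> {1..n}. Q k} else {k \<in> {1..n}. Q k})"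
    by (auto simp: le_Suc_eq)
  then show ?case using Suc by auto
qed simp

lemma iter_max:
  fixes g :: "nat \<Rightarrow> nat" and Q :: "nat \<Rightarrow> bool"
  defines "r \<equiv> iter (\<lambda>k a. if Q k then max a (g k) else a)"
  shows "a \<le> r n a" "k \<in> {1..n} \<Longrightarrow> Q k \<Longrightarrow> g k \<le> r n a"
    "r n a = a \<or> (\<exists>k\<in>{1..n}. Q k \<and> r n a = g k)"
proof -
  have *: "a \<le> r n a" for n a
  proof (unfold r_def, induction n arbitrary: a)
    case (Suc n)
    have "a \<le> (if Q (Suc n) then max a (g (Suc n)) else a)" by simp
    also have "\<dots> \<le> iter (\<lambda>k a. if Q k then max a (g k) else a) n \<dots>" by (rule Suc)
    finally show ?case by simp
  qed simp
  show "a \<le> r n a" by (rule *)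
  show "g k \<le> r n a" if "k \<in> {1..n}" "Q k"
    using that
  proof (induction n arbitrary: a)
    case (Suc n)
    show ?case
    proof (cases "k = Suc n")
      case True
      then have "r (Suc n) a = r n (max a (g k))" using Suc.prems by (simp add: r_def)
      then show ?thesis using *[of "max a (g k)" n] by linarith
    next
      case False
      then show ?thesis using Suc by (simp add: r_def)
    qed
  qed simp
  show "r n a = a \<or> (\<exists>k\<in>{1..n}. Q k \<and> r n a = g k)"
  proof (induction n arbitrary: a)
    case (Suc n)
    have "r (Suc n) a = r n (if Q (Suc n) then max a (g (Suc n)) else a)" by (simp add: r_def)
    with Suc[of "if Q (Suc n) then max a (g (Suc n)) else a"] show ?case
      by (force simp: max_def split: if_splits)
  qed (simp add: r_def)
qed

section \<open>Permutation diagrams\<close>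

text \<open>
  The two ends of the segment of a vertex are coded by numbers of different parity, the parity
  telling the line: \<open>c False u = 2 * x u\<close> and \<open>c True u = 2 * y u + 1\<close>. One greedy step \<open>hop\<close> goes
  from a position on one line to the furthest end on the other line of a segment that starts
  before the position; the bound \<open>z + 1\<close> only matters between connected components.
\<close>

definition hop :: "nat \<Rightarrow> (bool \<Rightarrow> nat \<Rightarrow> nat) \<Rightarrow> nat \<Rightarrow> nat" where
  "hop n c z = iter (\<lambda>v a. if c (odd z) v \<le> z then max a (c (even z) v) else a) n (z + 1)"

text \<open>The places between connected components: nothing crosses where both lines have the same
  segments to the left.\<close>

definition cut :: "nat \<Rightarrow> (bool \<Rightarrow> nat \<Rightarrow> nat) \<Rightarrow> nat \<Rightarrow> bool" where
  "cut n c k \<longleftrightarrow> (\<forall>v\<in>{1..n}. c False v < 2 * k \<longleftrightarrow> c True v < 2 * k)"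

text \<open>A component is named by the last cut at or before it. The initial value 0 needs no test,
  as 0 is always a cut.\<close>

definition comp_start :: "nat \<Rightarrow> (bool \<Rightarrow> nat \<Rightarrow> nat) \<Rightarrow> nat \<Rightarrow> nat" where
  "comp_start n c u = iter (\<lambda>k a. if 2 * k \<le> c False u \<and> cut n c k then max a k else a) n 0"

text \<open>\<open>c\<close> is a parameter tied to \<open>x\<close> and \<open>y\<close> by
  \<open>code\<close>, so that all results apply directly to \<open>seg_code n E\<close>, the
  function that the machine tabulates.\<close>

locale diagram =
  fixes n :: nat and E :: "(nat \<times> nat) set" and x y :: "nat \<Rightarrow> nat" and c :: "bool \<Rightarrow> nat \<Rightarrow> nat"
  assumes bij_x: "bij_betw x {1..n} {..<n}" and bij_y: "bij_betw y {1..n} {..<n}"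
    and edge_iff: "(u, v) \<in> E \<longleftrightarrow> u \<in> {1..n} \<and> v \<in> {1..n} \<and> (x u < x v) \<noteq> (y u < y v)"
    and code: "c b u = (if b then 2 * y u + 1 else 2 * x u)"
begin

abbreviation "H \<equiv> hop n c"

lemma code_parity: "even (c b u) \<longleftrightarrow> \<not> b"
  by (cases b) (simp_all add: code)

lemma code_inj: "u \<in> {1..n} \<Longrightarrow> v \<in> {1..n} \<Longrightarrow> c b u = c b v \<longleftrightarrow> u = v"
  using inj_on_eq_iff[OF bij_betw_imp_inj_on[OF bij_x], of u v]
    inj_on_eq_iff[OF bij_betw_imp_inj_on[OF bij_y], of u v] by (simp add: code)

lemma x_less: "u \<in> {1..n} \<Longrightarrow> x u < n" and y_less: "u \<in> {1..n} \<Longrightarrow> y u < n"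
  using bij_betwE[OF bij_x] bij_betwE[OF bij_y] by auto

lemma code_less: "u \<in> {1..n} \<Longrightarrow> c b u < 2 * n"
  using x_less[of u] y_less[of u] by (auto simp: code)

lemma edge_code:
  "(u, v) \<in> E \<longleftrightarrow> u \<in> {1..n} \<and> v \<in> {1..n} \<and> (\<exists>b. c b u < c b v \<and> c (\<not> b) v < c (\<not> b) u)"
proof -
  have "(x u < x v) \<noteq> (y u < y v) \<longleftrightarrow> (\<exists>b. c b u < c b v \<and> c (\<not> b) v < c (\<not> b) u)"
    if "u \<in> {1..n}" "v \<in> {1..n}"
    using code_inj[OF that, of False] code_inj[OF that, of True]
    by (auto simp: code ex_bool_eq not_less le_less)
  then show ?thesis using edge_iff by blast
qed

lemma edgeI: "u \<in> {1..n} \<Longrightarrow> v \<in> {1..n} \<Longrightarrow> c b u < c b v \<Longrightarrow> c (\<not> b) v < c (\<not> b) u \<Longrightarrow> (u, v) \<in> E"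
  by (auto simp: edge_code)

lemma edgeD:
  assumes "(u, v) \<in> E"
  shows "c b u < c b v \<and> c (\<not> b) v < c (\<not> b) u \<or> c b v < c b u \<and> c (\<not> b) u < c (\<not> b) v"
proof -
  obtain b' where "c b' u < c b' v" "c (\<not> b') v < c (\<not> b') u" using assms edge_code by blast
  then show ?thesis by (cases "b' = b") auto
qed

section \<open>Parity and monotonicity of greedy moves\<close>

lemma hop_ge: "z + 1 \<le> H z"
  and hop_code: "v \<in> {1..n} \<Longrightarrow> c b v \<le> z \<Longrightarrow> odd z = b \<Longrightarrow> c (\<not> b) v \<le> H z"
  and hop_attained: "H z = z + 1 \<or> (\<exists>v\<in>{1..n}. c (odd z) v \<le> z \<and> H z = c (even z) v)"
proof -
  note * = iter_max[where n=n and Q="\<lambda>v. c (odd z) v \<le> z" and g="c (even z)" and a="z + 1", folded hop_def]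
  show "z + 1 \<le> H z" by (rule *(1))
  show "c (\<not> b) v \<le> H z" if "v \<in> {1..n}" "c b v \<le> z" "odd z = b"
    using *(2)[of v] that by auto
  show "H z = z + 1 \<or> (\<exists>v\<in>{1..n}. c (odd z) v \<le> z \<and> H z = c (even z) v)" by (rule *(3))
qed

lemma hop_parity: "even (H z) \<longleftrightarrow> odd z"
  using hop_attained[of z] by (auto simp: code_parity)

lemma hop_mono:
  assumes "z \<le> z'" "odd z = odd z'"
  shows "H z \<le> H z'"
  using hop_attained[of z]
proof
  assume "H z = z + 1"
  then show ?thesis using hop_ge[of z'] assms by linarith
next
  assume "\<exists>v\<in>{1..n}. c (odd z) v \<le> z \<and> H z = c (even z) v"
  then obtain v where v: "v \<in> {1..n}" "c (odd z) v \<le> z" "H z = c (even z) v" by blast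
  have "c (\<not> odd z') v \<le> H z'" using hop_code[of v "odd z'" z'] v assms by auto
  then show ?thesis using v assms by simp
qed

lemma hops_parity: "even ((H ^^ k) z) \<longleftrightarrow> even (z + k)"
  by (induction k) (auto simp: hop_parity)

lemma hops_mono: "z \<le> z' \<Longrightarrow> odd z = odd z' \<Longrightarrow> (H ^^ k) z \<le> (H ^^ k) z'"
  by (induction k) (auto intro!: hop_mono simp: hops_parity)

lemma hops_ge: "z + k \<le> (H ^^ k) z"
proof (induction k)
  case (Suc k)
  then show ?case using hop_ge[of "(H ^^ k) z"] by simp
qed simp

lemma card_x: "card {v \<in> {1..n}. x v < k} = min k n"
  and card_y: "card {v \<in> {1..n}. y v < k} = min k n"
proof -
  have *: "card {v \<in> {1..n}. f v < k} = min k n" if f: "bij_betw f {1..n} {..<n}" for f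
  proof -
    let ?S = "{v \<in> {1..n}. f v < k}"
    have "f ` ?S = {..<min k n}"
    proof (intro equalityI subsetI)
      fix i assume "i \<in> f ` ?S"
      then show "i \<in> {..<min k n}" using bij_betwE[OF f] by auto
    next
      fix i assume i: "i \<in> {..<min k n}"
      then have "i \<in> f ` {1..n}" using bij_betw_imp_surj_on[OF f] by simp
      then obtain v where "v \<in> {1..n}" "i = f v" by (rule imageE)
      then show "i \<in> f ` ?S" using i by simp
    qed
    moreover have "inj_on f ?S"
      by (rule inj_on_subset[OF bij_betw_imp_inj_on[OF f] Collect_restrict])
    then have "card (f ` ?S) = card ?S" by (rule card_image)
    ultimately show ?thesis by (simp only: card_lessThan)
  qed
  show "card {v \<in> {1..n}. x v < k} = min k n" "card {v \<in> {1..n}. y v < k} = min k n"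
    using *[OF bij_x] *[OF bij_y] by blast+
qed

text \<open>Counting shows that the bound \<open>z + 1\<close> is only needed for going from the second line to the first.\<close>

lemma hop_attained_or_cut:
  assumes "z < 2 * n"
  shows "(\<exists>v\<in>{1..n}. c (odd z) v \<le> z \<and> H z = c (even z) v) \<or> odd z \<and> H z = z + 1 \<and> cut n c ((z + 1) div 2)"
proof (cases "odd z")
  case False
  then obtain a where a: "z = 2 * a" by blast
  \<comment> \<open>Pigeonhole: \<open>a + 1\<close> segments have index at most \<open>a\<close> on
    the first line, but only \<open>a\<close> have an index below \<open>a\<close> on the
    second.\<close>
  have "\<exists>v\<in>{1..n}. x v \<le> a \<and> a \<le> y v"
  proof (rule ccontr)
    assume "\<not> ?thesis"
    then have "y v < a" if "v \<in> {1..n}" "x v < Suc a" for v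
      using that by (meson less_Suc_eq_le not_le)
    then have "{v \<in> {1..n}. x v < Suc a} \<subseteq> {v \<in> {1..n}. y v < a}" by blast
    then have "card {v \<in> {1..n}. x v < Suc a} \<le> card {v \<in> {1..n}. y v < a}"
      by (intro card_mono) auto
    then show False using assms a unfolding card_x card_y by auto
  qed
  then obtain v where v: "v \<in> {1..n}" "x v \<le> a" "a \<le> y v" by blast
  then have "c True v \<le> H z" using hop_code[of v False z] False a by (simp add: code)
  then have "z + 1 \<le> c True v \<and> c True v \<le> H z" using v a by (simp add: code)
  moreover have "c False v \<le> z" using v a by (simp add: code)
  moreover have "H z = z + 1 \<or> (\<exists>v\<in>{1..n}. c False v \<le> z \<and> H z = c True v)"
    using hop_attained[of z] False by simp
  ultimately have "\<exists>v\<in>{1..n}. c False v \<le> z \<and> H z = c True v" using v(1) by (metis order_antisym)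
  then show ?thesis using False by simp
next
  case True
  then obtain a where a: "z = 2 * a + 1" by (blast elim: oddE)
  show ?thesis
  proof (cases "\<exists>v\<in>{1..n}. c (odd z) v \<le> z \<and> H z = c (even z) v")
    case False
    then have Hz: "H z = z + 1" using hop_attained by blast
    have le: "x v < Suc a" if "v \<in> {1..n}" "y v < Suc a" for v
    proof -
      have "c False v \<le> H z" using hop_code[of v True z] that a by (simp add: code)
      moreover have "c False v \<noteq> H z" 
      proof
        assume "c False v = H z"
        then have "c (odd z) v \<le> z \<and> H z = c (even z) v" using that a True by (simp add: code)
        then show False using False that(1) by blast
      qed
      ultimately show ?thesis using Hz a by (simp add: code)
    qed
    \<comment> \<open>In this direction both prefixes have \<open>a + 1\<close> elements, so an
      unattained bound is no contradiction; it forces the prefixes to coincide, which is a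
      cut.\<close>
    then have "{v \<in> {1..n}. y v < Suc a} \<subseteq> {v \<in> {1..n}. x v < Suc a}" by auto
    then have "{v \<in> {1..n}. y v < Suc a} = {v \<in> {1..n}. x v < Suc a}"
      using card_subset_eq[of "{v \<in> {1..n}. x v < Suc a}" "{v \<in> {1..n}. y v < Suc a}"] card_x card_y by simp
    then have eq: "x v < Suc a \<longleftrightarrow> y v < Suc a" if "v \<in> {1..n}" for v using that by blast
    have "c False v < 2 * Suc a \<longleftrightarrow> c True v < 2 * Suc a" if "v \<in> {1..n}" for v
      using eq[OF that] unfolding code by (simp only: if_True if_False) presburger
    then have "cut n c (Suc a)" unfolding cut_def by blast
    then show ?thesis using Hz True a by simp
  qed simp
qed

subsection \<open>Connected components\<close>

abbreviation "o\<^sub>c \<equiv> comp_start n c"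

lemma comp_start_le: "2 * o\<^sub>c u \<le> c False u"
  and comp_start_cut: "cut n c (o\<^sub>c u)"
  and comp_start_max: "u \<in> {1..n} \<Longrightarrow> cut n c k \<Longrightarrow> 2 * k \<le> c False u \<Longrightarrow> k \<le> o\<^sub>c u"
proof -
  note * = iter_max[where n=n and Q="\<lambda>k. 2 * k \<le> c False u \<and> cut n c k" and g="\<lambda>k. k" and a=0,
      folded comp_start_def]
  have "cut n c 0" by (simp add: cut_def)
  then have "2 * o\<^sub>c u \<le> c False u \<and> cut n c (o\<^sub>c u)" using *(3) by (metis bot_nat_0.extremum mult_0_right)
  then show "2 * o\<^sub>c u \<le> c False u" "cut n c (o\<^sub>c u)" by simp_all
  assume u: "u \<in> {1..n}" "cut n c k" "2 * k \<le> c False u"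
  then have "k \<le> n" using code_less[of u False] by simp
  then show "k \<le> o\<^sub>c u" using *(2)[of k] u by (cases "k = 0") simp_all
qed

text \<open>The last cut before a segment determines its side of every cut. No cut separates the two
  ends of a segment, so the lines \<open>b\<close> and \<open>b'\<close> are arbitrary.\<close>

lemma comp_start_eqD:
  assumes "u \<in> {1..n}" "w \<in> {1..n}" "o\<^sub>c u = o\<^sub>c w" "cut n c k"
  shows "c b u < 2 * k \<longleftrightarrow> c b' w < 2 * k"
proof -
  have "2 * k \<le> c False v \<longleftrightarrow> k \<le> o\<^sub>c v" if "v \<in> {1..n}" for v
    using comp_start_max[OF that assms(4)] comp_start_le[of v] by auto
  then have "c False u < 2 * k \<longleftrightarrow> c False w < 2 * k" using assms by (metis not_le)
  moreover have "c b v < 2 * k \<longleftrightarrow> c False v < 2 * k" if "v \<in> {1..n}" for b v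
    using assms(4) that by (cases b) (auto simp: cut_def)
  ultimately show ?thesis using assms by blast
qed

lemma comp_start_cong:
  assumes "u \<in> {1..n}" "w \<in> {1..n}" "\<And>k. cut n c k \<Longrightarrow> c False u < 2 * k \<longleftrightarrow> c False w < 2 * k"
  shows "o\<^sub>c u = o\<^sub>c w"
proof (rule antisym)
  show "o\<^sub>c u \<le> o\<^sub>c w"
    using comp_start_max[OF assms(2) comp_start_cut[of u]] assms(3)[OF comp_start_cut[of u]] comp_start_le[of u] by auto
  show "o\<^sub>c w \<le> o\<^sub>c u"
    using comp_start_max[OF assms(1) comp_start_cut[of w]] assms(3)[OF comp_start_cut[of w]] comp_start_le[of w] by auto
qed

text \<open>Segments on different sides of a cut come in the same order on both lines, so they
  cannot cross.\<close>

lemma comp_start_edge: "(u, v) \<in> E \<Longrightarrow> o\<^sub>c u = o\<^sub>c v"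
proof (rule comp_start_cong)
  fix k assume e: "(u, v) \<in> E" and k: "cut n c k"
  then obtain b where b: "u \<in> {1..n}" "v \<in> {1..n}" "c b u < c b v" "c (\<not> b) v < c (\<not> b) u"
    by (auto simp: edge_code)
  have "c b u < 2 * k \<longleftrightarrow> c b' u < 2 * k" "c b v < 2 * k \<longleftrightarrow> c b' v < 2 * k" for b b'
    using b k by (cases b; cases b'; auto simp: cut_def)+
  then show "c False u < 2 * k \<longleftrightarrow> c False v < 2 * k"
    using b by (meson less_trans)
qed (auto simp: edge_iff)

lemma comp_start_path: "(u, v) \<in> E ^^ k \<Longrightarrow> o\<^sub>c u = o\<^sub>c v"
  by (induction k arbitrary: v) (auto dest: comp_start_edge)

subsection \<open>Greedy paths\<close>

text \<open>Every hop changes the line. The starting end is chosen by the parity of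
  \<open>k\<close>, so that \<open>b\<close> names the line of arrival.\<close>

definition reach :: "nat \<Rightarrow> nat \<Rightarrow> bool \<Rightarrow> nat" where
  "reach u k b = (H ^^ k) (c (b \<noteq> odd k) u)"

lemma reach_0: "reach u 0 b = c b u"
  by (simp add: reach_def)

lemma reach_Suc: "reach u (Suc k) b = H (reach u k (\<not> b))"
  by (simp add: reach_def)

lemma reach_parity: "even (reach u k b) \<longleftrightarrow> \<not> b"
  by (cases b) (simp_all add: reach_def hops_parity code_parity)

lemma reach_mono_Suc:
  assumes "u \<in> {1..n}"
  shows "reach u k b \<le> reach u (Suc k) b"
proof (induction k arbitrary: b)
  case 0
  show ?case using hop_code[OF assms, of "\<not> b" "c (\<not> b) u"] by (simp add: reach_0 reach_Suc code_parity)
next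
  case (Suc k)
  show ?case unfolding reach_Suc[of u k b] reach_Suc[of u "Suc k" b]
    by (rule hop_mono[OF Suc]) (simp add: reach_parity)
qed

lemma reach_mono: "u \<in> {1..n} \<Longrightarrow> j \<le> k \<Longrightarrow> reach u j b \<le> reach u k b"
  by (rule lift_Suc_mono_le[of "\<lambda>k. reach u k b"]) (use reach_mono_Suc in auto)

text \<open>The last step of a walk either moves back on line \<open>b\<close>, and monotonicity in
  \<open>k\<close> suffices, or it moves back on the other line, and then the next hop takes the new
  segment into account.\<close>

lemma walk_le_reach:
  assumes "u \<in> {1..n}" "(u, v) \<in> E ^^ k"
  shows "c b v \<le> reach u k b"
  using assms(2)
proof (induction k arbitrary: v b)
  case (Suc k)
  then obtain v' where v': "(u, v') \<in> E ^^ k" "(v', v) \<in> E" by auto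
  then have v: "v \<in> {1..n}" by (simp add: edge_iff)
  show ?case
  proof (cases "c b v < c b v'")
    case True
    then show ?thesis using Suc.IH[OF v'(1), of b] reach_mono_Suc[OF assms(1), of k b] by simp
  next
    case False
    then have "c (\<not> b) v < c (\<not> b) v'"
      using edgeD[OF v'(2), of b] by auto
    then have "c (\<not> b) v \<le> reach u k (\<not> b)" using Suc.IH[OF v'(1), of "\<not> b"] by simp
    from hop_code[OF v this] show ?thesis by (simp add: reach_Suc reach_parity)
  qed
qed (simp add: reach_0)

text \<open>The predecessor of \<open>w\<close> on the walk crosses \<open>w\<close> and so lies
  beyond it on some line; hence one move fewer already passes \<open>w\<close>.\<close>

lemma near_imp_reach:
  assumes "u \<in> {1..n}" "u \<noteq> w" "j \<le> Suc k" "(u, w) \<in> E ^^ j"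
  shows "\<exists>b. c b w < reach u k b"
proof -
  obtain i where i: "j = Suc i" using assms by (cases j) auto
  then obtain v where v: "(u, v) \<in> E ^^ i" "(v, w) \<in> E" using assms by auto
  then obtain b where "c b w < c b v" by (auto simp: edge_code)
  then have "c b w < reach u k b"
    using walk_le_reach[OF assms(1) v(1), of b] reach_mono[OF assms(1), of i k b] assms(3) i by simp
  then show ?thesis by blast
qed

text \<open>The invariant: unless \<open>w\<close> is within distance \<open>k + 1\<close>, both
  greedy positions after \<open>k\<close> moves are ends of vertices within distance
  \<open>k\<close>, and neither has passed \<open>w\<close>.\<close>

lemma reach_imp_near:
  assumes u: "u \<in> {1..n}" and w: "w \<in> {1..n}" and comp: "o\<^sub>c u = o\<^sub>c w" and less: "\<And>b. c b u < c b w"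
    and "c b w < reach u k b"
  shows "\<exists>j\<le>Suc k. (u, w) \<in> E ^^ j"
proof -
  define near where "near k v \<longleftrightarrow> (\<exists>j\<le>k. (u, v) \<in> E ^^ j)" for k v
  have near_Suc: "near k v \<Longrightarrow> near (Suc k) v" for k v
    unfolding near_def using le_Suc_eq by blast
  have near_edge: "near k v \<Longrightarrow> (v, v') \<in> E \<Longrightarrow> near (Suc k) v'" for k v v'
    unfolding near_def by (meson Suc_le_mono relpow_Suc_I)
  have "near (Suc k) w \<or> (\<forall>b. reach u k b \<le> c b w \<and> (\<exists>v\<in>{1..n}. near k v \<and> c b v = reach u k b))" for k
  proof (induction k)
    case 0
    have "near 0 u" by (simp add: near_def)
    then show ?case using u less by (auto simp: reach_0 less_imp_le)
  next
    case (Suc k)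
    show ?case
    proof (cases "near (Suc (Suc k)) w")
      case False
      then have IH: "\<And>b. reach u k b \<le> c b w" "\<And>b. \<exists>v\<in>{1..n}. near k v \<and> c b v = reach u k b"
        using Suc near_Suc by blast+
      have "reach u (Suc k) b \<le> c b w \<and> (\<exists>v\<in>{1..n}. near (Suc k) v \<and> c b v = reach u (Suc k) b)" for b
      proof -
        let ?z = "reach u k (\<not> b)"
        obtain v where v: "v \<in> {1..n}" "near k v" "c (\<not> b) v = ?z" using IH(2) by blast
        have z: "?z < 2 * n" using v code_less by metis
        have par: "odd ?z \<longleftrightarrow> \<not> b" using reach_parity[of u k "\<not> b"] by simp
        from hop_attained_or_cut[OF z] have "\<exists>v\<in>{1..n}. c (\<not> b) v \<le> ?z \<and> H ?z = c b v"
        proof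
          assume "\<exists>v\<in>{1..n}. c (odd ?z) v \<le> ?z \<and> H ?z = c (even ?z) v"
          then show ?thesis using par by simp
        next
          \<comment> \<open>The bound \<open>?z + 1\<close> is a cut behind \<open>u\<close>, hence
            behind \<open>w\<close> as well. As \<open>?z\<close> has not passed \<open>w\<close>,
            only \<open>w = v\<close> remains.\<close>
          assume *: "odd ?z \<and> H ?z = ?z + 1 \<and> cut n c ((?z + 1) div 2)"
          then have b: "\<not> b" using par by simp
          have two: "2 * ((?z + 1) div 2) = ?z + 1" using * by auto
          have "reach u 0 (\<not> b) \<le> ?z" using reach_mono[OF u] by blast
          then have "c (\<not> b) u < 2 * ((?z + 1) div 2)" using two by (simp add: reach_0)
          then have "c (\<not> b) w < 2 * ((?z + 1) div 2)"
            using comp_start_eqD[OF u w comp] * by blast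
          then have "c (\<not> b) w = c (\<not> b) v" using two IH(1)[of "\<not> b"] v by simp
          then have "w = v" using code_inj[OF w v(1)] by blast
          then have "near (Suc (Suc k)) w" using v near_Suc by blast
          then show ?thesis using False by blast
        qed
        then obtain v' where v': "v' \<in> {1..n}" "c (\<not> b) v' \<le> ?z" "H ?z = c b v'" by blast
        \<comment> \<open>\<open>v'\<close> starts no later than \<open>v\<close> and ends no
          earlier, so the two segments are equal or cross.\<close>
        have near': "near (Suc k) v'"
        proof (cases "v' = v")
          case False
          have "c b v \<le> H ?z" using hop_code[OF v(1), of "\<not> b" ?z] v(3) par by simp
          then have "(v, v') \<in> E"
            using False v v' code_inj[OF v(1) v'(1)] unfolding edge_code
            by (metis le_neq_implies_less)
          then show ?thesis using near_edge v(2) by blast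
        qed (use v near_Suc in simp)
        \<comment> \<open>Otherwise \<open>v'\<close> would cross \<open>w\<close> and bring it
          within reach.\<close>
        have "\<not> c b w < c b v'"
        proof
          assume lt: "c b w < c b v'"
          then have "c (\<not> b) v' < c (\<not> b) w"
            using v'(2) IH(1)[of "\<not> b"] code_inj[OF v'(1) w, of "\<not> b"] by (metis le_neq_implies_less le_trans less_irrefl)
          then have "(v', w) \<in> E" using edgeI[OF v'(1) w, of "\<not> b"] lt by simp
          then show False using near_edge[OF near'] False by blast
        qed
        then show ?thesis using v' near' by (auto simp: reach_Suc)
      qed
      then show ?thesis by blast
    qed simp
  qed
  then show ?thesis using assms(5) unfolding near_def by (metis not_le)
qed

section \<open>Distances as thresholds for greedy moves\<close>

lemma graph_dist_le_iff: "graph_dist E u w \<le> enat k \<longleftrightarrow> (\<exists>j\<le>k. (u, w) \<in> E ^^ j)"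
proof
  assume *: "graph_dist E u w \<le> enat k"
  let ?K = "{k. (u, w) \<in> E ^^ k}"
  have "?K \<noteq> {}"
  proof
    assume "?K = {}"
    then have "graph_dist E u w = \<infinity>" by (simp add: graph_dist_def top_enat_def)
    then show False using * by simp
  qed
  then obtain i where "enat i \<in> enat ` ?K" by blast
  then have "Inf (enat ` ?K) \<in> enat ` ?K" by (rule wellorder_InfI)
  then obtain j where "j \<in> ?K" "graph_dist E u w = enat j" by (auto simp: graph_dist_def)
  then show "\<exists>j\<le>k. (u, w) \<in> E ^^ j" using * by auto
next
  assume "\<exists>j\<le>k. (u, w) \<in> E ^^ j"
  then obtain j where "j \<le> k" "(u, w) \<in> E ^^ j" by blast
  then show "graph_dist E u w \<le> enat k"
    unfolding graph_dist_def by (meson INF_lower2 enat_ord_simps(1) mem_Collect_eq)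
qed

lemma graph_dist_infinite: "o\<^sub>c u \<noteq> o\<^sub>c w \<Longrightarrow> graph_dist E u w = \<infinity>"
  using comp_start_path unfolding graph_dist_def
  by (metis (mono_tags, lifting) Collect_empty_eq INF_empty top_enat_def)

text \<open>\<open>k\<close> is the first number of moves that passes \<open>w\<close>; the
  successor counts the edge from the passing segment back to \<open>w\<close>.\<close>

lemma graph_dist_eqI:
  assumes u: "u \<in> {1..n}" and w: "w \<in> {1..n}" and "o\<^sub>c u = o\<^sub>c w" and less: "\<And>b. c b u < c b w"
    and "\<exists>b. c b w < reach u k b" "\<And>j b. j < k \<Longrightarrow> \<not> c b w < reach u j b"
  shows "graph_dist E u w = enat (Suc k)"
proof -
  have "\<not> graph_dist E u w \<le> enat k"
  proof
    assume "graph_dist E u w \<le> enat k"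
    then obtain j where j: "j \<le> k" "(u, w) \<in> E ^^ j" by (auto simp: graph_dist_le_iff)
    have "u \<noteq> w" using less by blast
    then have "j \<noteq> 0" using j by (cases j) auto
    then have "\<exists>b. c b w < reach u (j - 1) b" using near_imp_reach[OF u \<open>u \<noteq> w\<close> _ j(2), of "j - 1"] by simp
    then show False using assms(6)[of "j - 1"] j \<open>j \<noteq> 0\<close> by auto
  qed
  moreover have "graph_dist E u w \<le> enat (Suc k)"
    unfolding graph_dist_le_iff using reach_imp_near[OF u w assms(3) less] assms(5) by blast
  ultimately show ?thesis
    by (metis eSuc_enat ileI1 not_le order_antisym)
qed

lemma graph_dist_adjacent: "(u, w) \<in> E \<Longrightarrow> graph_dist E u w = 1"
proof -
  assume e: "(u, w) \<in> E"
  then have "u \<noteq> w" by (auto simp: edge_iff)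
  then have "\<not> graph_dist E u w \<le> enat 0" unfolding graph_dist_le_iff by auto
  moreover have "graph_dist E u w \<le> enat (Suc 0)"
    unfolding graph_dist_le_iff using e by (metis le_refl relpow_1 One_nat_def)
  ultimately show ?thesis by (metis eSuc_enat ileI1 not_le one_enat_def One_nat_def order_antisym)
qed

lemma sym_E: "sym E"
  by (auto simp: sym_def edge_code)

lemma graph_dist_commute: "graph_dist E u w = graph_dist E w u"
proof -
  have "(w, u) \<in> E ^^ k" if "(u, w) \<in> E ^^ k" for u w k
    using that
  proof (induction k arbitrary: w)
    case (Suc k)
    then obtain v where "(u, v) \<in> E ^^ k" "(v, w) \<in> E" by auto
    then show ?case using Suc.IH sym_E by (metis relpow_Suc_I2 symD)
  qed auto
  then have "{k. (u, w) \<in> E ^^ k} = {k. (w, u) \<in> E ^^ k}" by blast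
  then show ?thesis by (simp add: graph_dist_def)
qed

end

section \<open>Reconstructing a diagram from the graph\<close>

text \<open>
  A colouring of the pairs of vertices is refined until every colour is a single implication
  class. An order is \<open>admissible\<close> if in every triangle with exactly two colours the vertex
  between the two sides of equal colour is not between the other two vertices; for the
  colouring into edges and non-edges, these are the orders of the segments along one line.
\<close>

definition gallai :: "nat \<Rightarrow> (nat \<Rightarrow> nat \<Rightarrow> nat) \<Rightarrow> bool" where
  "gallai n \<kappa> \<longleftrightarrow> (\<forall>u\<in>{1..n}. \<forall>v\<in>{1..n}. \<kappa> u v = \<kappa> v u) \<and>
     (\<forall>a\<in>{1..n}. \<forall>b\<in>{1..n}. \<forall>c\<in>{1..n}. a \<noteq> b \<longrightarrow> b \<noteq> c \<longrightarrow> a \<noteq> c \<longrightarrow>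
        \<kappa> a b = \<kappa> b c \<or> \<kappa> a b = \<kappa> a c \<or> \<kappa> b c = \<kappa> a c)"

definition admissible :: "nat \<Rightarrow> (nat \<Rightarrow> nat \<Rightarrow> nat) \<Rightarrow> (nat \<Rightarrow> nat) \<Rightarrow> bool" where
  "admissible n \<kappa> r \<longleftrightarrow> inj_on r {1..n} \<and>
     (\<forall>a\<in>{1..n}. \<forall>b\<in>{1..n}. \<forall>c\<in>{1..n}. a \<noteq> b \<longrightarrow> b \<noteq> c \<longrightarrow> a \<noteq> c \<longrightarrow>
        \<kappa> a b = \<kappa> b c \<longrightarrow> \<kappa> a b \<noteq> \<kappa> a c \<longrightarrow> (r a < r b \<longleftrightarrow> r c < r b))"

text \<open>Gallai's forcing relation for several colours: in a triangle, two sides of equal colour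
  whose third side has another colour must both point to their common vertex or both away from
  it.\<close>

definition gamma_step :: "nat \<Rightarrow> (nat \<Rightarrow> nat \<Rightarrow> nat) \<Rightarrow> (nat \<times> nat) set \<Rightarrow> (nat \<times> nat) set" where
  "gamma_step n \<kappa> A = A \<union> {(u, v) \<in> {1..n} \<times> {1..n}. \<exists>z\<in>{1..n}.
     (z, v) \<in> A \<and> \<kappa> z v = \<kappa> u v \<and> \<kappa> z u \<noteq> \<kappa> u v \<or>
     (u, z) \<in> A \<and> \<kappa> u z = \<kappa> u v \<and> \<kappa> z v \<noteq> \<kappa> u v}"

text \<open>Colours below \<open>2\<close> are the original ones; a pair of another colour has been oriented already.\<close>

definition gamma_class :: "nat \<Rightarrow> (nat \<Rightarrow> nat \<Rightarrow> nat) \<Rightarrow> nat \<Rightarrow> nat \<Rightarrow> (nat \<times> nat) set" where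
  "gamma_class n \<kappa> p q = (gamma_step n \<kappa> ^^ (n * n)) {(u, v). u = p \<and> v = q \<and> p \<noteq> q \<and> \<kappa> p q < 2}"

section \<open>Implication classes as fixed points\<close>

lemma gamma_class_induct:
  assumes "(u, v) \<in> gamma_class n \<kappa> p q" "p \<noteq> q \<Longrightarrow> \<kappa> p q < 2 \<Longrightarrow> P p q"
    and "\<And>u v z. z \<in> {1..n} \<Longrightarrow> u \<in> {1..n} \<Longrightarrow> v \<in> {1..n} \<Longrightarrow> P z v \<Longrightarrow> \<kappa> z v = \<kappa> u v \<Longrightarrow> \<kappa> z u \<noteq> \<kappa> u v \<Longrightarrow> P u v"
    and "\<And>u v z. z \<in> {1..n} \<Longrightarrow> u \<in> {1..n} \<Longrightarrow> v \<in> {1..n} \<Longrightarrow> P u z \<Longrightarrow> \<kappa> u z = \<kappa> u v \<Longrightarrow> \<kappa> z v \<noteq> \<kappa> u v \<Longrightarrow> P u v"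
  shows "P u v"
proof -
  have "(gamma_step n \<kappa> ^^ k) {(u, v). u = p \<and> v = q \<and> p \<noteq> q \<and> \<kappa> p q < 2} \<subseteq> {(u, v). P u v}" for k
  proof (induction k)
    case 0
    then show ?case using assms(2) by auto
  next
    case (Suc k)
    let ?S = "(gamma_step n \<kappa> ^^ k) {(u, v). u = p \<and> v = q \<and> p \<noteq> q \<and> \<kappa> p q < 2}"
    have S: "P a b" if "(a, b) \<in> ?S" for a b using Suc that by blast
    have "P a b" if "(a, b) \<in> gamma_step n \<kappa> ?S" for a b
      using that S assms(3,4)[of _ a b] unfolding gamma_step_def by blast
    then show ?case by auto
  qed
  then show ?thesis using assms(1) unfolding gamma_class_def by blast
qed

lemma gamma_class_subset:
  assumes "p \<in> {1..n}" "q \<in> {1..n}"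
  shows "gamma_class n \<kappa> p q \<subseteq> {1..n} \<times> {1..n}"
proof
  fix e assume "e \<in> gamma_class n \<kappa> p q"
  then have "(fst e, snd e) \<in> gamma_class n \<kappa> p q" by simp
  then have "fst e \<in> {1..n} \<and> snd e \<in> {1..n}"
    by (rule gamma_class_induct) (use assms in auto)
  then show "e \<in> {1..n} \<times> {1..n}" by (simp add: mem_Times_iff)
qed

text \<open>Until the fixed point is met, each step adds an element; after \<open>card U\<close>
  steps it is met or the set is all of \<open>U\<close>.\<close>

lemma funpow_saturates:
  assumes ext: "\<And>A. A \<subseteq> f A" and bound: "\<And>A. A \<subseteq> U \<Longrightarrow> f A \<subseteq> U" and U: "finite U" "S \<subseteq> U"
  shows "f ((f ^^ card U) S) = (f ^^ card U) S"
proof -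
  have sub: "(f ^^ k) S \<subseteq> U" for k
    by (induction k) (simp_all add: U bound)
  have "f ((f ^^ k) S) = (f ^^ k) S \<or> k \<le> card ((f ^^ k) S)" for k
  proof (induction k)
    case (Suc k)
    define B where "B = (f ^^ k) S"
    have B: "(f ^^ Suc k) S = f B" by (simp add: B_def)
    show ?case
    proof (cases "f B = B")
      case True
      then show ?thesis unfolding B by simp
    next
      case False
      then have "B \<subset> f B" using ext by blast
      moreover have "finite (f B)" using sub[of "Suc k"] U finite_subset unfolding B by blast
      ultimately have "card B < card (f B)" by (rule psubset_card_mono[rotated])
      then show ?thesis using Suc False unfolding B B_def[symmetric] by simp
    qed
  qed simp
  then consider "f ((f ^^ card U) S) = (f ^^ card U) S" | "card U \<le> card ((f ^^ card U) S)" by blast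
  then show ?thesis
  proof cases
    case 2
    then have "(f ^^ card U) S = U" using card_seteq[OF U(1) sub] by blast
    then show ?thesis using ext[of U] bound[of U] by simp
  qed
qed

lemma gamma_class_closed:
  assumes p: "p \<in> {1..n}" and q: "q \<in> {1..n}"
  shows "gamma_step n \<kappa> (gamma_class n \<kappa> p q) = gamma_class n \<kappa> p q"
proof -
  have "gamma_step n \<kappa> A \<subseteq> {1..n} \<times> {1..n}" if "A \<subseteq> {1..n} \<times> {1..n}" for A
    unfolding gamma_step_def using that by blast
  moreover have "A \<subseteq> gamma_step n \<kappa> A" for A unfolding gamma_step_def by blast
  moreover have "{(u, v). u = p \<and> v = q \<and> p \<noteq> q \<and> \<kappa> p q < 2} \<subseteq> {1..n} \<times> {1..n}" using p q by auto
  moreover have "card ({1..n} \<times> {1..n}) = n * n" by simp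
  ultimately show ?thesis
    unfolding gamma_class_def using funpow_saturates[of "gamma_step n \<kappa>" "{1..n} \<times> {1..n}"] by fastforce
qed

lemma gamma_class_empty: "p = q \<or> 2 \<le> \<kappa> p q \<Longrightarrow> gamma_class n \<kappa> p q = {}"
proof -
  assume *: "p = q \<or> 2 \<le> \<kappa> p q"
  have False if "(u, v) \<in> gamma_class n \<kappa> p q" for u v
    by (rule gamma_class_induct[OF that]) (use * in auto)
  then show ?thesis by auto
qed

subsection \<open>Splitting off an implication class\<close>

text \<open>The order \<open>r\<close> certifies that the class can be oriented consistently. Only
  its existence is carried along, as the algorithm has no such order at hand.\<close>

locale implication_class =
  fixes n :: nat and \<kappa> :: "nat \<Rightarrow> nat \<Rightarrow> nat" and r :: "nat \<Rightarrow> nat" and p q :: nat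
  assumes gallai: "gallai n \<kappa>" and adm: "admissible n \<kappa> r"
    and pq: "p \<in> {1..n}" "q \<in> {1..n}" "p \<noteq> q" "\<kappa> p q < 2"
begin

abbreviation "A \<equiv> gamma_class n \<kappa> p q"
abbreviation "K \<equiv> \<kappa> p q"

definition hat :: "nat \<Rightarrow> nat \<Rightarrow> bool" where
  "hat u v \<longleftrightarrow> (u, v) \<in> A \<or> (v, u) \<in> A"

definition M :: "nat set" where
  "M = {u. \<exists>v. hat u v}"

lemma color_sym: "u \<in> {1..n} \<Longrightarrow> v \<in> {1..n} \<Longrightarrow> \<kappa> u v = \<kappa> v u"
  using gallai unfolding gallai_def by blast

lemma no_rainbow:
  "a \<in> {1..n} \<Longrightarrow> b \<in> {1..n} \<Longrightarrow> c \<in> {1..n} \<Longrightarrow> a \<noteq> b \<Longrightarrow> b \<noteq> c \<Longrightarrow> a \<noteq> c \<Longrightarrow>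
    \<kappa> a b = \<kappa> b c \<or> \<kappa> a b = \<kappa> a c \<or> \<kappa> b c = \<kappa> a c"
  using gallai unfolding gallai_def by blast

lemma r_inj: "u \<in> {1..n} \<Longrightarrow> v \<in> {1..n} \<Longrightarrow> r u = r v \<longleftrightarrow> u = v"
  using adm unfolding admissible_def inj_on_def by blast

lemma r_special:
  "a \<in> {1..n} \<Longrightarrow> b \<in> {1..n} \<Longrightarrow> c \<in> {1..n} \<Longrightarrow> a \<noteq> b \<Longrightarrow> b \<noteq> c \<Longrightarrow> a \<noteq> c \<Longrightarrow>
    \<kappa> a b = \<kappa> b c \<Longrightarrow> \<kappa> a b \<noteq> \<kappa> a c \<Longrightarrow> r a < r b \<longleftrightarrow> r c < r b"
  using adm unfolding admissible_def by blast

lemma A_vertex: "(u, v) \<in> A \<Longrightarrow> u \<in> {1..n} \<and> v \<in> {1..n}"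
  using gamma_class_subset[OF pq(1,2)] by blast

lemma A_color: "(u, v) \<in> A \<Longrightarrow> \<kappa> u v = K"
  by (erule gamma_class_induct) auto

lemma pq_in_A: "(p, q) \<in> A"
proof -
  have "(p, q) \<in> (gamma_step n \<kappa> ^^ k) {(u, v). u = p \<and> v = q \<and> p \<noteq> q \<and> \<kappa> p q < 2}" for k
  proof (induction k)
    case (Suc k)
    have "X \<subseteq> gamma_step n \<kappa> X" for X unfolding gamma_step_def by blast
    then show ?case using Suc by auto
  qed (use pq in simp)
  then show ?thesis by (simp add: gamma_class_def)
qed

lemma A_closed_left: "(z, v) \<in> A \<Longrightarrow> u \<in> {1..n} \<Longrightarrow> \<kappa> u v = K \<Longrightarrow> \<kappa> z u \<noteq> K \<Longrightarrow> (u, v) \<in> A"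
  and A_closed_right: "(u, z) \<in> A \<Longrightarrow> v \<in> {1..n} \<Longrightarrow> \<kappa> u v = K \<Longrightarrow> \<kappa> z v \<noteq> K \<Longrightarrow> (u, v) \<in> A"
proof -
  show "(u, v) \<in> A" if "(z, v) \<in> A" "u \<in> {1..n}" "\<kappa> u v = K" "\<kappa> z u \<noteq> K"
    using that A_vertex[OF that(1)] A_color[OF that(1)]
    by (subst gamma_class_closed[OF pq(1,2), symmetric], unfold gamma_step_def) auto
  show "(u, v) \<in> A" if "(u, z) \<in> A" "v \<in> {1..n}" "\<kappa> u v = K" "\<kappa> z v \<noteq> K"
    using that A_vertex[OF that(1)] A_color[OF that(1)]
    by (subst gamma_class_closed[OF pq(1,2), symmetric], unfold gamma_step_def) auto
qed

lemma A_irrefl: "(u, v) \<in> A \<Longrightarrow> u \<noteq> v"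
proof (erule gamma_class_induct)
  show "p \<noteq> q" by (rule pq)
qed (use color_sym in metis)+

text \<open>Forcing steps are reversible, so a property that survives each of them holds for all
  pairs of the class or for none.\<close>

lemma A_connected:
  assumes "\<And>u v z. (u, v) \<in> A \<Longrightarrow> (z, v) \<in> A \<Longrightarrow> \<kappa> u z \<noteq> K \<Longrightarrow> P u v \<Longrightarrow> P z v"
    and "\<And>u v z. (u, v) \<in> A \<Longrightarrow> (u, z) \<in> A \<Longrightarrow> \<kappa> v z \<noteq> K \<Longrightarrow> P u v \<Longrightarrow> P u z"
    and "(a, b) \<in> A" "P a b" "(u, v) \<in> A"
  shows "P u v"
proof -
  have Q: "(u, v) \<in> A \<and> (P u v \<longleftrightarrow> P p q)" if "(u, v) \<in> A" for u v
    using that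
  proof (rule gamma_class_induct)
    show "(p, q) \<in> A \<and> (P p q \<longleftrightarrow> P p q)" using pq_in_A by simp
  next
    fix u v z
    assume *: "z \<in> {1..n}" "u \<in> {1..n}" "v \<in> {1..n}" "(z, v) \<in> A \<and> (P z v \<longleftrightarrow> P p q)"
      "\<kappa> z v = \<kappa> u v" "\<kappa> z u \<noteq> \<kappa> u v"
    then have K: "\<kappa> u v = K" using A_color[of z v] by simp
    then have "(u, v) \<in> A" using A_closed_left[of z v u] * by simp
    then show "(u, v) \<in> A \<and> (P u v \<longleftrightarrow> P p q)"
      using assms(1)[of u v z] assms(1)[of z v u] * K color_sym[of u z] by auto
  next
    fix u v z
    assume *: "z \<in> {1..n}" "u \<in> {1..n}" "v \<in> {1..n}" "(u, z) \<in> A \<and> (P u z \<longleftrightarrow> P p q)"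
      "\<kappa> u z = \<kappa> u v" "\<kappa> z v \<noteq> \<kappa> u v"
    then have K: "\<kappa> u v = K" using A_color[of u z] by simp
    then have "(u, v) \<in> A" using A_closed_right[of u z v] * by simp
    then show "(u, v) \<in> A \<and> (P u v \<longleftrightarrow> P p q)"
      using assms(2)[of u v z] assms(2)[of u z v] * K color_sym[of v z] by auto
  qed
  then show ?thesis using assms(3-5) by blast
qed

text \<open>In a forcing triangle the common vertex is not between the other two with respect to
  \<open>r\<close>. So \<open>r\<close> follows the class on all pairs or opposes it on all pairs,
  and no pair can occur in both directions.\<close>

lemma A_r: "(u, v) \<in> A \<Longrightarrow> r u < r v \<longleftrightarrow> r p < r q"
proof (rule A_connected[of "\<lambda>u v. r u < r v \<longleftrightarrow> r p < r q" p q])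
  fix u v z assume *: "(u, v) \<in> A" "(z, v) \<in> A" "\<kappa> u z \<noteq> K" "r u < r v \<longleftrightarrow> r p < r q"
  then have "u \<noteq> v" "z \<noteq> v" "\<kappa> u v = K" "\<kappa> z v = K" "u \<in> {1..n}" "v \<in> {1..n}" "z \<in> {1..n}"
    using A_irrefl A_color A_vertex by blast+
  moreover have "\<kappa> v z = K" using calculation color_sym by metis
  ultimately show "r z < r v \<longleftrightarrow> r p < r q" using r_special[of u v z] * by (cases "u = z") auto
next
  fix u v z assume *: "(u, v) \<in> A" "(u, z) \<in> A" "\<kappa> v z \<noteq> K" "r u < r v \<longleftrightarrow> r p < r q"
  then have h: "u \<noteq> v" "u \<noteq> z" "\<kappa> u v = K" "\<kappa> u z = K" "u \<in> {1..n}" "v \<in> {1..n}" "z \<in> {1..n}"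
    using A_irrefl A_color A_vertex by blast+
  moreover have "\<kappa> v u = K" using calculation color_sym by metis
  moreover have "r u \<noteq> r v" "r u \<noteq> r z" using r_inj h by blast+
  ultimately show "r u < r z \<longleftrightarrow> r p < r q" using r_special[of v u z] * by (cases "v = z") auto
qed (use pq_in_A in auto)

lemma A_antisym: "(u, v) \<in> A \<Longrightarrow> (v, u) \<notin> A"
proof
  assume *: "(u, v) \<in> A" "(v, u) \<in> A"
  then have "r u \<noteq> r v" using A_irrefl A_vertex r_inj by metis
  then show False using A_r[OF *(1)] A_r[OF *(2)] by auto
qed

lemma hat_vertex: "hat u v \<Longrightarrow> u \<in> {1..n} \<and> v \<in> {1..n}"
  using A_vertex by (auto simp: hat_def)

lemma hat_color: "hat u v \<Longrightarrow> \<kappa> u v = K"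
  using A_color color_sym A_vertex unfolding hat_def by metis

lemma hat_sym: "hat u v \<longleftrightarrow> hat v u"
  by (auto simp: hat_def)

lemma hat_closed: "hat z v \<Longrightarrow> u \<in> {1..n} \<Longrightarrow> \<kappa> u v = K \<Longrightarrow> \<kappa> z u \<noteq> K \<Longrightarrow> hat u v"
  using A_closed_left[of z v u] A_closed_right[of v z u] color_sym[of v u] A_vertex unfolding hat_def by metis

text \<open>A form of the triangle lemma for implication classes. The vertex \<open>a\<close> sees
  both ends of a class pair in colour \<open>K\<close>, but by sides outside the class; forcing
  steps pass this situation on to all class pairs, and an end of a class pair cannot be in
  it.\<close>

lemma triangle_outside:
  assumes a: "a \<in> {1..n}" and bc: "(b, c) \<in> A" and "\<kappa> a b = K" "\<kappa> a c = K" "\<not> hat a b" "\<not> hat a c"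
    and uv: "(u, v) \<in> A"
  shows "a \<noteq> u \<and> a \<noteq> v"
proof -
  have "\<kappa> a u = K \<and> \<kappa> a v = K \<and> \<not> hat a u \<and> \<not> hat a v"
  proof (rule A_connected[of "\<lambda>u v. \<kappa> a u = K \<and> \<kappa> a v = K \<and> \<not> hat a u \<and> \<not> hat a v", OF _ _ bc _ uv])
    fix u v z assume *: "(u, v) \<in> A" "(z, v) \<in> A" "\<kappa> u z \<noteq> K" "\<kappa> a u = K \<and> \<kappa> a v = K \<and> \<not> hat a u \<and> \<not> hat a v"
    have V: "u \<in> {1..n}" "v \<in> {1..n}" "z \<in> {1..n}" using A_vertex * by blast+
    have "\<kappa> z a = K" using hat_closed[of z v a] * a by (auto simp: hat_def)
    then have "\<kappa> a z = K" using color_sym[OF a V(3)] by simp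
    moreover have "\<not> hat a z"
    proof
      assume "hat a z"
      then have "hat u a" using hat_closed[of z a u] hat_sym * V color_sym[of u z] color_sym[of a u] a by auto
      then show False using * hat_sym by blast
    qed
    ultimately show "\<kappa> a z = K \<and> \<kappa> a v = K \<and> \<not> hat a z \<and> \<not> hat a v" using * by simp
  next
    fix u v z assume *: "(u, v) \<in> A" "(u, z) \<in> A" "\<kappa> v z \<noteq> K" "\<kappa> a u = K \<and> \<kappa> a v = K \<and> \<not> hat a u \<and> \<not> hat a v"
    have V: "u \<in> {1..n}" "v \<in> {1..n}" "z \<in> {1..n}" using A_vertex * by blast+
    have "\<kappa> z a = K" using hat_closed[of z u a] * a by (auto simp: hat_def)
    then have "\<kappa> a z = K" using color_sym[OF a V(3)] by simp
    moreover have "\<not> hat a z"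
    proof
      assume "hat a z"
      then have "hat v a" using hat_closed[of z a v] hat_sym * V color_sym[of v z] color_sym[of a v] a by auto
      then show False using * hat_sym by blast
    qed
    ultimately show "\<kappa> a u = K \<and> \<kappa> a z = K \<and> \<not> hat a u \<and> \<not> hat a z" using * by simp
  qed (use assms in auto)
  then show ?thesis using uv unfolding hat_def by blast
qed

text \<open>If \<open>a\<close> and \<open>c\<close> were not joined by the class, the situation
  \<open>?P\<close> would spread from \<open>(b, c)\<close> to all class pairs, and at
  \<open>(a, b)\<close> it says \<open>(a, a) \<in> A\<close>. The direction is then right because
  \<open>r\<close> has no cycles.\<close>

lemma A_transitive:
  assumes ab: "(a, b) \<in> A" and bc: "(b, c) \<in> A" and ac: "\<kappa> a c = K"
  shows "(a, c) \<in> A"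
proof -
  have "hat a c"
  proof (rule ccontr)
    assume no: "\<not> hat a c"
    have a: "a \<in> {1..n}" using A_vertex ab by blast
    let ?P = "\<lambda>u v. (a, u) \<in> A \<and> \<kappa> a v = K \<and> \<not> hat a v"
    have "?P a b"
    proof (rule A_connected[of ?P, OF _ _ bc _ ab])
      fix u v z assume *: "(u, v) \<in> A" "(z, v) \<in> A" "\<kappa> u z \<noteq> K" "?P u v"
      have V: "u \<in> {1..n}" "v \<in> {1..n}" "z \<in> {1..n}" using A_vertex * by blast+
      have "\<kappa> z a = K" using hat_closed[of z v a] * a by (auto simp: hat_def)
      then have "\<kappa> a z = K" using color_sym[OF a V(3)] by simp
      then show "?P z v" using A_closed_right[of a u z] * V by blast
    next
      fix u v z assume *: "(u, v) \<in> A" "(u, z) \<in> A" "\<kappa> v z \<noteq> K" "?P u v"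
      have V: "u \<in> {1..n}" "v \<in> {1..n}" "z \<in> {1..n}" using A_vertex * by blast+
      have zu: "\<kappa> z u = K" using A_color[OF *(2)] color_sym V by metis
      have az: "\<kappa> a z = K"
      proof (rule ccontr)
        assume "\<kappa> a z \<noteq> K"
        then have "(z, u) \<in> A" using A_closed_left[of a u z] * V zu by blast
        then show False using A_antisym * by blast
      qed
      moreover have "\<not> hat a z"
      proof
        assume "hat a z"
        then have "hat v a" using hat_closed[of z a v] hat_sym * V color_sym[of v z] color_sym[of a v] a by auto
        then show False using * hat_sym by blast
      qed
      ultimately show "?P u z" using * by blast
    qed (use ab ac no in auto)
    then show False using A_irrefl by blast
  qed
  moreover have "(c, a) \<notin> A"
  proof
    assume "(c, a) \<in> A"
    then have "r c < r a \<longleftrightarrow> r p < r q" by (rule A_r)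
    moreover have "r a < r b \<longleftrightarrow> r p < r q" "r b < r c \<longleftrightarrow> r p < r q" using A_r ab bc by blast+
    moreover have "r a \<noteq> r b" "r b \<noteq> r c" "r c \<noteq> r a"
      using r_inj A_vertex A_irrefl ab bc \<open>(c, a) \<in> A\<close> by metis+
    ultimately show False by linarith
  qed
  ultimately show ?thesis by (simp add: hat_def)
qed

text \<open>An outside vertex that sees the ends of a class pair in different colours would see one
  of them in colour \<open>K\<close>, since no triangle has three colours, and forcing would then
  draw it into the class.\<close>

lemma M_module:
  assumes z: "z \<in> {1..n}" "z \<notin> M" and m: "m \<in> M" "m' \<in> M"
  shows "\<kappa> z m = \<kappa> z m'"
proof -
  have eq: "\<kappa> z u = \<kappa> z v" if "(u, v) \<in> A" for u v
  proof (rule ccontr)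
    assume ne: "\<kappa> z u \<noteq> \<kappa> z v"
    have V: "u \<in> {1..n}" "v \<in> {1..n}" using A_vertex that by blast+
    have uv: "\<kappa> u v = K" "hat u v" "hat v u" using A_color that by (auto simp: hat_def)
    have zM: "\<not> hat z w" for w using z by (auto simp: M_def)
    have "z \<noteq> u" "z \<noteq> v" "u \<noteq> v" using uv zM A_irrefl that by blast+
    then have "\<kappa> z u = K \<or> \<kappa> z v = K" using no_rainbow[of z u v] z V uv(1) ne by auto
    then show False
    proof
      assume "\<kappa> z u = K"
      then show False using hat_closed[of v u z] uv z zM ne color_sym[of v z] V by auto
    next
      assume "\<kappa> z v = K"
      then show False using hat_closed[of u v z] uv z zM ne color_sym[of u z] V by auto
    qed
  qed
  have all: "\<kappa> z u = \<kappa> z p \<and> \<kappa> z v = \<kappa> z p" if "(u, v) \<in> A" for u v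
  proof (rule A_connected[of "\<lambda>u v. \<kappa> z u = \<kappa> z p \<and> \<kappa> z v = \<kappa> z p", OF _ _ pq_in_A _ that])
    show "\<kappa> z p = \<kappa> z p \<and> \<kappa> z q = \<kappa> z p" using eq[OF pq_in_A] by simp
  qed (use eq in metis)+
  have "\<kappa> z w = \<kappa> z p" if "w \<in> M" for w
    using that all unfolding M_def hat_def by blast
  then show ?thesis using m by metis
qed

text \<open>Moving \<open>M\<close> to one place makes the order admissible after the class gets a colour of its own.\<close>

definition block_rank :: "nat \<Rightarrow> nat" where
  "block_rank u = (if u \<in> M then r p * Suc (Max (r ` {1..n})) + r u else r u * Suc (Max (r ` {1..n})))"

lemma block_rank_less:
  assumes u: "u \<in> {1..n}" and v: "v \<in> {1..n}" and uv: "u \<noteq> v"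
  shows "block_rank u < block_rank v \<longleftrightarrow>
    (if u \<in> M \<and> v \<in> M then r u < r v else r (if u \<in> M then p else u) < r (if v \<in> M then p else v))"
proof -
  let ?N = "Suc (Max (r ` {1..n}))"
  have le: "r w < ?N" if "w \<in> {1..n}" for w using that by (simp add: less_Suc_eq_le)
  have *: "i * ?N + x < j * ?N + y" if "i < j" "x < ?N" for i j x y
  proof -
    have "i * ?N + x < Suc i * ?N" using that by simp
    also have "\<dots> \<le> j * ?N" using that by (intro mult_le_mono1) simp
    finally show ?thesis by simp
  qed
  have pM: "p \<in> M" using pq_in_A by (auto simp: M_def hat_def)
  have ne: "r w \<noteq> r p" if "w \<in> {1..n}" "w \<notin> M" for w using r_inj[OF that(1) pq(1)] that pM by auto
  show ?thesis
  proof (cases "u \<in> M"; cases "v \<in> M")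
    assume "u \<in> M" "v \<in> M" then show ?thesis by (simp add: block_rank_def)
  next
    assume h: "u \<in> M" "v \<notin> M"
    then show ?thesis
      using *[of "r p" "r v" "r u" 0] *[of "r v" "r p" 0 "r u"] ne[OF v] le[OF u]
      by (cases "r p" "r v" rule: linorder_cases) (auto simp: block_rank_def)
  next
    assume h: "u \<notin> M" "v \<in> M"
    then show ?thesis
      using *[of "r p" "r u" "r v" 0] *[of "r u" "r p" 0 "r v"] ne[OF u] le[OF v]
      by (cases "r p" "r u" rule: linorder_cases) (auto simp: block_rank_def)
  next
    assume "u \<notin> M" "v \<notin> M" then show ?thesis by (simp add: block_rank_def del: mult_Suc_right)
  qed
qed

text \<open>In a triangle with exactly two vertices in \<open>M\<close>, the outside vertex sees
  them in one colour, so only it can be the common vertex of the equal sides, and the block lies on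
  one side of it. Triangles with three representatives inherit the property from
  \<open>r\<close>.\<close>

lemma block_rank_admissible: "admissible n \<kappa> block_rank"
proof -
  have pM: "p \<in> M" using pq_in_A by (auto simp: M_def hat_def)
  define f where "f u = (if u \<in> M then p else u)" for u
  have fV: "f u \<in> {1..n}" if "u \<in> {1..n}" for u using that pq by (simp add: f_def)
  have less: "block_rank u < block_rank v \<longleftrightarrow> (if f u = f v then r u < r v else r (f u) < r (f v))"
    if "u \<in> {1..n}" "v \<in> {1..n}" "u \<noteq> v" for u v
    using block_rank_less[OF that] that pM by (auto simp: f_def)
  have col: "\<kappa> (f u) (f v) = \<kappa> u v" if "u \<in> {1..n}" "v \<in> {1..n}" "f u \<noteq> f v" for u v
    using that M_module[of v p u] M_module[of u p v] pM pq color_sym[of u v] color_sym[of v p]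
    by (auto simp: f_def split: if_splits)
  have fM: "f u = f v \<Longrightarrow> u \<noteq> v \<Longrightarrow> u \<in> M \<and> v \<in> M" for u v
    using pM by (auto simp: f_def split: if_splits)
  have "inj_on block_rank {1..n}"
  proof (rule inj_onI, rule ccontr)
    fix u v assume *: "u \<in> {1..n}" "v \<in> {1..n}" "block_rank u = block_rank v" "u \<noteq> v"
    then show False using less[of u v] less[of v u] r_inj[of u v] r_inj[OF fV fV, of u v]
      by (auto split: if_splits)
  qed
  moreover have "block_rank a < block_rank b \<longleftrightarrow> block_rank c < block_rank b"
    if V: "a \<in> {1..n}" "b \<in> {1..n}" "c \<in> {1..n}" and ne: "a \<noteq> b" "b \<noteq> c" "a \<noteq> c"
      and s: "\<kappa> a b = \<kappa> b c" "\<kappa> a b \<noteq> \<kappa> a c" for a b c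
  proof -
    note L = less[OF V(1,2) ne(1)] less[OF V(3,2) ne(2)[symmetric]]
    consider "f a = f b" "f b = f c" | "f a = f b" "f b \<noteq> f c" | "f b = f c" "f a \<noteq> f b"
      | "f a = f c" "f a \<noteq> f b" | "f a \<noteq> f b" "f b \<noteq> f c" "f a \<noteq> f c" by metis
    then show ?thesis
    proof cases
      case 1
      then show ?thesis using L r_special[OF V ne s] by simp
    next
      case 2
      then have "a \<in> M" "b \<in> M" using fM ne by blast+
      moreover have "c \<notin> M" using 2 \<open>b \<in> M\<close> by (auto simp: f_def)
      ultimately have "a \<in> M" "b \<in> M" "c \<notin> M" by blast+
      then have "\<kappa> c a = \<kappa> c b" using M_module V by blast
      then show ?thesis using s color_sym V by metis
    next
      case 3
      then have "c \<in> M" "b \<in> M" using fM ne by blast+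
      moreover have "a \<notin> M" using 3 \<open>b \<in> M\<close> by (auto simp: f_def)
      ultimately have "c \<in> M" "b \<in> M" "a \<notin> M" by blast+
      then have "\<kappa> a b = \<kappa> a c" using M_module V by blast
      then show ?thesis using s by simp
    next
      case 4
      then show ?thesis using L by simp
    next
      case 5
      have "r (f a) < r (f b) \<longleftrightarrow> r (f c) < r (f b)"
        using 5 s by (intro r_special) (use V fV col in auto)
      then show ?thesis using L 5 by simp
    qed
  qed
  ultimately show ?thesis unfolding admissible_def by blast
qed

text \<open>Only triangles that were monochromatic in \<open>K\<close> give new conditions. If
  exactly the two sides at \<open>b\<close> join the class, transitivity makes \<open>b\<close> a
  source or a sink; if only the side opposite to \<open>b\<close> joins,
  \<open>triangle_outside\<close> keeps \<open>b\<close> out of \<open>M\<close>, and the block is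
  on one side of \<open>b\<close>.\<close>

lemma split_admissible:
  assumes fresh: "\<And>u v. u \<in> {1..n} \<Longrightarrow> v \<in> {1..n} \<Longrightarrow> \<kappa> u v \<noteq> k"
  shows "admissible n (\<lambda>u v. if hat u v then k else \<kappa> u v) block_rank"
proof -
  note adm' = block_rank_admissible
  let ?\<kappa> = "\<lambda>u v. if hat u v then k else \<kappa> u v"
  have same: "block_rank u < block_rank v \<longleftrightarrow> r u < r v" if "hat u v" for u v
  proof -
    have "u \<in> M" "v \<in> M" "u \<noteq> v" "u \<in> {1..n}" "v \<in> {1..n}"
      using that hat_sym hat_vertex A_irrefl unfolding M_def hat_def by blast+
    then show ?thesis using block_rank_less[of u v] by simp
  qed
  have "block_rank a < block_rank b \<longleftrightarrow> block_rank c < block_rank b"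
    if V: "a \<in> {1..n}" "b \<in> {1..n}" "c \<in> {1..n}" and ne: "a \<noteq> b" "b \<noteq> c" "a \<noteq> c"
      and s: "?\<kappa> a b = ?\<kappa> b c" "?\<kappa> a b \<noteq> ?\<kappa> a c" for a b c
  proof (cases "\<kappa> a b = \<kappa> b c \<and> \<kappa> a b \<noteq> \<kappa> a c")
    case True
    then show ?thesis using adm' V ne unfolding admissible_def by blast
  next
    case False
    show ?thesis
    proof (cases "hat a b")
      case hab: True
      then have hbc: "hat b c" using s fresh[OF V(2,3)] by (auto split: if_splits)
      have hac: "\<not> hat a c" using s hab by (auto split: if_splits)
      have "\<kappa> a c = K" using False hat_color hab hbc by auto
      then have ac: "(a, b) \<in> A \<Longrightarrow> (b, c) \<notin> A" "(c, b) \<in> A \<Longrightarrow> (b, a) \<notin> A"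
        using A_transitive[of a b c] A_transitive[of c b a] hac color_sym[OF V(1,3)] by (auto simp: hat_def)
      have "r a \<noteq> r b" "r c \<noteq> r b" using r_inj V ne by metis+
      then have "r a < r b \<longleftrightarrow> r c < r b"
        using hab hbc ac A_r[of a b] A_r[of b a] A_r[of b c] A_r[of c b] unfolding hat_def by auto
      then show ?thesis using same[OF hab] same[of c b] hbc hat_sym by blast
    next
      case hab: False
      then have hbc: "\<not> hat b c" "\<kappa> a b = \<kappa> b c" using s fresh[OF V(1,2)] by (auto split: if_splits)
      then have hac: "hat a c" "\<kappa> a c = \<kappa> a b" using False s hab by (auto split: if_splits)
      then have K: "\<kappa> b a = K" "\<kappa> b c = K" using hat_color hbc color_sym[OF V(1,2)] by auto
      have "b \<notin> M"
      proof
        assume "b \<in> M"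
        then obtain w where "hat b w" by (auto simp: M_def)
        moreover have nb: "\<not> hat b a" using hab hat_sym by blast
        ultimately show False
          using hac(1) triangle_outside[OF V(2), of a c] triangle_outside[OF V(2), of c a] K nb hbc(1)
          unfolding hat_def by blast
      qed
      moreover have "a \<in> M" "c \<in> M" using hac(1) hat_sym unfolding M_def by blast+
      ultimately show ?thesis using block_rank_less V ne by simp
    qed
  qed
  then show ?thesis using adm' unfolding admissible_def by blast
qed

text \<open>If just one of two equally coloured sides joins the class, closure under forcing gives
  the third side the old colour \<open>K\<close>, so that only \<open>k\<close> and \<open>K\<close>
  can occur.\<close>

lemma split_gallai:
  assumes fresh: "\<And>u v. u \<in> {1..n} \<Longrightarrow> v \<in> {1..n} \<Longrightarrow> \<kappa> u v \<noteq> k"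
  shows "gallai n (\<lambda>u v. if hat u v then k else \<kappa> u v)"
proof -
  define \<kappa>' where "\<kappa>' u v = (if hat u v then k else \<kappa> u v)" for u v
  have s: "\<kappa>' u v = \<kappa>' v u" if "u \<in> {1..n}" "v \<in> {1..n}" for u v
    unfolding \<kappa>'_def using color_sym[OF that] hat_sym[of u v] by simp
  have aux: "\<kappa>' a b = \<kappa>' b c \<or> \<kappa>' a b = \<kappa>' a c \<or> \<kappa>' b c = \<kappa>' a c"
    if V: "a \<in> {1..n}" "b \<in> {1..n}" "c \<in> {1..n}" and eq: "\<kappa> a b = \<kappa> b c" for a b c
  proof -
    have "\<kappa> c b = K \<and> \<kappa> a c = K" if "hat a b" "\<not> hat b c"
      using hat_closed[OF that(1) V(3)] that hat_sym[of b c] hat_color[OF that(1)] eq color_sym[OF V(2,3)] by auto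
    moreover have "\<kappa> a b = K \<and> \<kappa> a c = K" if "hat b c" "\<not> hat a b"
      using hat_closed[of c b a] V that hat_sym[of b c] hat_sym[of a b] hat_color[OF that(1)] eq color_sym[OF V(1,3)] by auto
    ultimately show ?thesis unfolding \<kappa>'_def using eq color_sym[OF V(2,3)] by auto
  qed
  have "\<kappa>' a b = \<kappa>' b c \<or> \<kappa>' a b = \<kappa>' a c \<or> \<kappa>' b c = \<kappa>' a c"
    if V: "a \<in> {1..n}" "b \<in> {1..n}" "c \<in> {1..n}" and ne: "a \<noteq> b" "b \<noteq> c" "a \<noteq> c" for a b c
  proof -
    note cs = color_sym[OF V(1,2)] color_sym[OF V(2,3)] color_sym[OF V(1,3)]
    note ss = s[OF V(1,2)] s[OF V(2,3)] s[OF V(1,3)]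
    consider "\<kappa> a b = \<kappa> b c" | "\<kappa> b a = \<kappa> a c" | "\<kappa> a c = \<kappa> c b"
      using no_rainbow[OF V ne] cs by metis
    then show ?thesis
    proof cases
      case 1
      then show ?thesis by (rule aux[OF V])
    next
      case 2
      then show ?thesis using aux[OF V(2,1,3) 2] ss by metis
    next
      case 3
      then show ?thesis using aux[OF V(1,3,2) 3] ss by metis
    qed
  qed
  then have "gallai n \<kappa>'" unfolding gallai_def using s by blast
  then show ?thesis unfolding \<kappa>'_def .
qed

end

subsection \<open>Orienting all pairs\<close>

text \<open>The summand 2 avoids the original colours, and base \<open>Suc n\<close> separates pairs
  of vertices from 1 to \<open>n\<close>.\<close>

definition pair_code :: "nat \<Rightarrow> nat \<Rightarrow> nat \<Rightarrow> nat" where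
  "pair_code n p q = 2 + p * Suc n + q"

definition split_class ::
    "nat \<Rightarrow> nat \<Rightarrow> nat \<Rightarrow> (nat \<Rightarrow> nat \<Rightarrow> nat) \<times> (nat \<times> nat) set \<Rightarrow> (nat \<Rightarrow> nat \<Rightarrow> nat) \<times> (nat \<times> nat) set" where
  "split_class n p q S = (let A = gamma_class n (fst S) p q in
     (\<lambda>u v. if (u, v) \<in> A \<or> (v, u) \<in> A then pair_code n p q else fst S u v, snd S \<union> A))"

definition orient :: "nat \<Rightarrow> (nat \<Rightarrow> nat \<Rightarrow> nat) \<Rightarrow> (nat \<Rightarrow> nat \<Rightarrow> nat) \<times> (nat \<times> nat) set" where
  "orient n \<kappa> = iter (\<lambda>p. iter (\<lambda>q. split_class n p q) n) n (\<kappa>, {})"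

text \<open>
  Freshness of the new colours is kept by the clause on \<open>pair_code\<close>: a colour determines a pair of this colour.
\<close>

definition orient_inv :: "nat \<Rightarrow> (nat \<Rightarrow> nat \<Rightarrow> nat) \<Rightarrow> (nat \<Rightarrow> nat \<Rightarrow> nat) \<times> (nat \<times> nat) set \<Rightarrow> bool" where
  "orient_inv n \<kappa>\<^sub>0 = (\<lambda>(\<kappa>, R). gallai n \<kappa> \<and> (\<exists>r. admissible n \<kappa> r) \<and> R \<subseteq> {1..n} \<times> {1..n} \<and>
     (\<forall>u\<in>{1..n}. \<forall>v\<in>{1..n}. u \<noteq> v \<longrightarrow> 2 \<le> \<kappa> u v \<longrightarrow> ((u, v) \<in> R \<longleftrightarrow> (v, u) \<notin> R)) \<and>
     (\<forall>u v. (u, v) \<in> R \<longrightarrow> u \<noteq> v \<and> 2 \<le> \<kappa> u v) \<and>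
     (\<forall>a\<in>{1..n}. \<forall>b\<in>{1..n}. \<forall>c\<in>{1..n}. \<kappa> a b = \<kappa> b c \<longrightarrow> \<kappa> a b \<noteq> \<kappa> a c \<longrightarrow> 2 \<le> \<kappa> a b \<longrightarrow>
        (a, b) \<in> R \<longrightarrow> (c, b) \<in> R) \<and>
     (\<forall>a\<in>{1..n}. \<forall>b\<in>{1..n}. \<forall>c\<in>{1..n}. \<kappa> a b = \<kappa> b c \<longrightarrow> \<kappa> a b = \<kappa> a c \<longrightarrow>
        (a, b) \<in> R \<longrightarrow> (b, c) \<in> R \<longrightarrow> (a, c) \<in> R) \<and>
     (\<forall>u\<in>{1..n}. \<forall>v\<in>{1..n}. 2 \<le> \<kappa> u v \<longrightarrow>
        (\<exists>p\<in>{1..n}. \<exists>q\<in>{1..n}. \<kappa> u v = pair_code n p q \<and> \<kappa> p q = \<kappa> u v)) \<and>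
     (\<forall>a\<in>{1..n}. \<forall>b\<in>{1..n}. \<forall>c\<in>{1..n}. \<forall>d\<in>{1..n}. \<kappa> a b = \<kappa> c d \<longrightarrow> \<kappa>\<^sub>0 a b = \<kappa>\<^sub>0 c d))"

lemma pair_code_inj:
  assumes "pair_code n p q = pair_code n p' q'" "q \<in> {1..n}" "q' \<in> {1..n}"
  shows "p = p' \<and> q = q'"
proof -
  have *: "(p * Suc n + q) div Suc n = p \<and> (p * Suc n + q) mod Suc n = q" if "q \<in> {1..n}" for p q
    using that by (simp add: div_mult_self3 mod_mult_self3 del: mult_Suc_right)
  have "p * Suc n + q = p' * Suc n + q'" using assms(1) by (simp add: pair_code_def del: mult_Suc_right)
  then show ?thesis using *[OF assms(2), of p] *[OF assms(3), of p'] by metis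
qed

lemma orient_invD:
  assumes "orient_inv n \<kappa>\<^sub>0 (\<kappa>, R)"
  shows "gallai n \<kappa>" "\<exists>r. admissible n \<kappa> r" "R \<subseteq> {1..n} \<times> {1..n}"
    "\<And>u v. u \<in> {1..n} \<Longrightarrow> v \<in> {1..n} \<Longrightarrow> u \<noteq> v \<Longrightarrow> 2 \<le> \<kappa> u v \<Longrightarrow> (u, v) \<in> R \<longleftrightarrow> (v, u) \<notin> R"
    "\<And>u v. (u, v) \<in> R \<Longrightarrow> u \<noteq> v \<and> 2 \<le> \<kappa> u v"
    "\<And>a b c. a \<in> {1..n} \<Longrightarrow> b \<in> {1..n} \<Longrightarrow> c \<in> {1..n} \<Longrightarrow> \<kappa> a b = \<kappa> b c \<Longrightarrow> \<kappa> a b \<noteq> \<kappa> a c \<Longrightarrow>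
       (a, b) \<in> R \<Longrightarrow> (c, b) \<in> R"
    "\<And>a b c. a \<in> {1..n} \<Longrightarrow> b \<in> {1..n} \<Longrightarrow> c \<in> {1..n} \<Longrightarrow> \<kappa> a b = \<kappa> b c \<Longrightarrow> \<kappa> a b = \<kappa> a c \<Longrightarrow>
       (a, b) \<in> R \<Longrightarrow> (b, c) \<in> R \<Longrightarrow> (a, c) \<in> R"
    "\<And>u v. u \<in> {1..n} \<Longrightarrow> v \<in> {1..n} \<Longrightarrow> 2 \<le> \<kappa> u v \<Longrightarrow>
        \<exists>p\<in>{1..n}. \<exists>q\<in>{1..n}. \<kappa> u v = pair_code n p q \<and> \<kappa> p q = \<kappa> u v"
    "\<And>a b c d. a \<in> {1..n} \<Longrightarrow> b \<in> {1..n} \<Longrightarrow> c \<in> {1..n} \<Longrightarrow> d \<in> {1..n} \<Longrightarrow> \<kappa> a b = \<kappa> c d \<Longrightarrow> \<kappa>\<^sub>0 a b = \<kappa>\<^sub>0 c d"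
proof -
  note D = assms[unfolded orient_inv_def prod.case]
  note D2 = D[THEN conjunct2] note D3 = D2[THEN conjunct2] note D4 = D3[THEN conjunct2]
  note D5 = D4[THEN conjunct2] note D6 = D5[THEN conjunct2] note D7 = D6[THEN conjunct2]
  note D8 = D7[THEN conjunct2] note D9 = D8[THEN conjunct2]
  show "gallai n \<kappa>" "\<exists>r. admissible n \<kappa> r" "R \<subseteq> {1..n} \<times> {1..n}"
    by (fact D[THEN conjunct1] D2[THEN conjunct1] D3[THEN conjunct1])+
  show "\<And>u v. u \<in> {1..n} \<Longrightarrow> v \<in> {1..n} \<Longrightarrow> u \<noteq> v \<Longrightarrow> 2 \<le> \<kappa> u v \<Longrightarrow> (u, v) \<in> R \<longleftrightarrow> (v, u) \<notin> R"
    using D4[THEN conjunct1] by simp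
  show *: "\<And>u v. (u, v) \<in> R \<Longrightarrow> u \<noteq> v \<and> 2 \<le> \<kappa> u v" using D5[THEN conjunct1] by blast
  show "\<And>a b c. a \<in> {1..n} \<Longrightarrow> b \<in> {1..n} \<Longrightarrow> c \<in> {1..n} \<Longrightarrow> \<kappa> a b = \<kappa> b c \<Longrightarrow> \<kappa> a b \<noteq> \<kappa> a c \<Longrightarrow>
       (a, b) \<in> R \<Longrightarrow> (c, b) \<in> R" using D6[THEN conjunct1] * by blast
  show "\<And>a b c. a \<in> {1..n} \<Longrightarrow> b \<in> {1..n} \<Longrightarrow> c \<in> {1..n} \<Longrightarrow> \<kappa> a b = \<kappa> b c \<Longrightarrow> \<kappa> a b = \<kappa> a c \<Longrightarrow>
       (a, b) \<in> R \<Longrightarrow> (b, c) \<in> R \<Longrightarrow> (a, c) \<in> R" using D7[THEN conjunct1] by blast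
  show "\<And>u v. u \<in> {1..n} \<Longrightarrow> v \<in> {1..n} \<Longrightarrow> 2 \<le> \<kappa> u v \<Longrightarrow>
        \<exists>p\<in>{1..n}. \<exists>q\<in>{1..n}. \<kappa> u v = pair_code n p q \<and> \<kappa> p q = \<kappa> u v" using D8[THEN conjunct1] by blast
  show "\<And>a b c d. a \<in> {1..n} \<Longrightarrow> b \<in> {1..n} \<Longrightarrow> c \<in> {1..n} \<Longrightarrow> d \<in> {1..n} \<Longrightarrow> \<kappa> a b = \<kappa> c d \<Longrightarrow> \<kappa>\<^sub>0 a b = \<kappa>\<^sub>0 c d"
    using D9 by blast
qed

lemma split_class_inv:
  assumes inv: "orient_inv n \<kappa>\<^sub>0 S" and p: "p \<in> {1..n}" and q: "q \<in> {1..n}"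
  shows "orient_inv n \<kappa>\<^sub>0 (split_class n p q S)"
    and "p = q \<or> 2 \<le> fst (split_class n p q S) p q"
    and "2 \<le> fst S u v \<Longrightarrow> 2 \<le> fst (split_class n p q S) u v"
proof -
  obtain \<kappa> R where S: "S = (\<kappa>, R)" by fastforce
  note I = orient_invD[OF inv[unfolded S]]
  define A where "A = gamma_class n \<kappa> p q"
  define k where "k = pair_code n p q"
  define \<kappa>' where "\<kappa>' u v = (if (u, v) \<in> A \<or> (v, u) \<in> A then k else \<kappa> u v)" for u v
  have split: "split_class n p q S = (\<kappa>', R \<union> A)"
    unfolding split_class_def S Let_def fst_conv snd_conv A_def[symmetric] k_def[symmetric] \<kappa>'_def by simp
  have k2: "2 \<le> k" by (simp add: k_def pair_code_def)
  show "2 \<le> fst (split_class n p q S) u v" if "2 \<le> fst S u v" using that k2 unfolding split by (simp add: S \<kappa>'_def)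
  have "orient_inv n \<kappa>\<^sub>0 (\<kappa>', R \<union> A) \<and> (p = q \<or> 2 \<le> \<kappa>' p q)"
  proof (cases "p = q \<or> 2 \<le> \<kappa> p q")
    case True
    then have "A = {}" unfolding A_def by (rule gamma_class_empty)
    then have "\<kappa>' = \<kappa>" by (simp add: \<kappa>'_def fun_eq_iff)
    then show ?thesis using inv True \<open>A = {}\<close> by (simp add: S)
  next
    case False
    obtain r where r: "admissible n \<kappa> r" using I(2) by blast
    interpret implication_class n \<kappa> r p q
      by unfold_locales (use False I(1) r p q in auto)
    have AA: "gamma_class n \<kappa> p q = A" by (simp add: A_def)
    have hat: "hat u v \<longleftrightarrow> (u, v) \<in> A \<or> (v, u) \<in> A" for u v by (simp add: hat_def AA)
    have \<kappa>': "\<kappa>' = (\<lambda>u v. if hat u v then k else \<kappa> u v)" by (simp add: \<kappa>'_def hat fun_eq_iff)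
    \<comment> \<open>If \<open>k\<close> were in use, the clause on \<open>pair_code\<close> would
      make it the colour of \<open>p\<close> and \<open>q\<close>, which is still below 2.\<close>
    have fresh: "\<kappa> u v \<noteq> k" if uv: "u \<in> {1..n}" "v \<in> {1..n}" for u v
    proof
      assume e: "\<kappa> u v = k"
      then have "2 \<le> \<kappa> u v" using k2 by simp
      from I(8)[OF uv this] obtain p' q' where
        *: "p' \<in> {1..n}" "q' \<in> {1..n}" "\<kappa> u v = pair_code n p' q'" "\<kappa> p' q' = \<kappa> u v"
        by blast
      have "p' = p \<and> q' = q" using pair_code_inj[of n p' q' p q] e q k_def * by simp
      then show False using * e k2 False by simp
    qed
    have old: "\<kappa>' u v = \<kappa> u v \<and> \<not> hat u v" if "2 \<le> \<kappa>' u v" "\<kappa>' u v \<noteq> k" for u v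
      using that by (auto simp: \<kappa>' split: if_splits)
    have hat_k: "\<kappa>' u v = k" if "hat u v" for u v using that by (simp add: \<kappa>')
    have new: "hat u v" if "\<kappa>' u v = k" "u \<in> {1..n}" "v \<in> {1..n}" for u v
      using that fresh by (auto simp: \<kappa>' split: if_splits)
    have hatK: "\<kappa> u v < 2" if "hat u v" for u v using hat_color[OF that] False by simp
    have RA: "\<not> hat u v \<and> \<kappa>' u v = \<kappa> u v \<and> 2 \<le> \<kappa> u v \<and> \<kappa>' u v \<noteq> k" if "(u, v) \<in> R" for u v
    proof -
      have "2 \<le> \<kappa> u v" "u \<in> {1..n}" "v \<in> {1..n}" using I(3,5) that by blast+
      then show ?thesis using hatK[of u v] fresh[of u v] by (auto simp: \<kappa>')
    qed
    have Akey: "\<kappa>' u v = k \<and> u \<in> {1..n} \<and> v \<in> {1..n} \<and> (v, u) \<notin> R \<union> A \<and> u \<noteq> v \<and> (u, v) \<notin> R" if "(u, v) \<in> A" for u v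
    proof -
      have h: "hat u v" "hat v u" using that hat by blast+
      then show ?thesis using RA[of v u] RA[of u v] A_antisym[unfolded AA, OF that] A_irrefl[unfolded AA, OF that] hat_vertex
        by (auto simp: \<kappa>')
    qed
    have c3: "u \<noteq> v \<and> 2 \<le> \<kappa>' u v" if "(u, v) \<in> R \<union> A" for u v
      using that RA[of u v] I(5)[of u v] Akey[of u v] k2 by auto
    have c4: "(u, v) \<in> R \<union> A \<longleftrightarrow> (v, u) \<notin> R \<union> A"
      if uv: "u \<in> {1..n}" "v \<in> {1..n}" "u \<noteq> v" "2 \<le> \<kappa>' u v" for u v
    proof (cases "hat u v")
      case True
      then show ?thesis using Akey[of u v] Akey[of v u] k2 hat by (auto simp: \<kappa>')
    next
      case nh: False
      then have "(u, v) \<notin> A" "(v, u) \<notin> A" "\<kappa>' u v = \<kappa> u v" using hat by (auto simp: \<kappa>')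
      then show ?thesis using I(4)[OF uv(1-3)] uv(4) by auto
    qed
    have c5: "(c, b) \<in> R \<union> A"
      if V: "a \<in> {1..n}" "b \<in> {1..n}" "c \<in> {1..n}" and s: "\<kappa>' a b = \<kappa>' b c" "\<kappa>' a b \<noteq> \<kappa>' a c" and ab: "(a, b) \<in> R \<union> A" for a b c
    proof (cases "(a, b) \<in> A")
      case True
      then have ab_k: "\<kappa>' a b = k" using Akey by blast
      have h: "hat b c" "\<not> hat a c" using s ab_k new[OF _ V(2,3)] hat_k by metis+
      \<comment> \<open>Either the old triangle was monochromatic, and transitivity rules out
        \<open>(b, c)\<close>, or it was a forcing triangle.\<close>
      show ?thesis
      proof (cases "\<kappa> a c = K")
        case True
        then have "(b, c) \<notin> A" using A_transitive[of a b c] \<open>(a, b) \<in> A\<close> h(2) unfolding hat AA by blast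
        then show ?thesis using h hat by blast
      next
        case False
        have "\<kappa> c b = K" using h(1) hat_sym hat_color by blast
        then show ?thesis using A_closed_left[of a b c] True V False unfolding AA by blast
      qed
    next
      case False
      then have ab: "(a, b) \<in> R" using ab by blast
      then have k: "\<kappa>' a b = \<kappa> a b" "2 \<le> \<kappa> a b" "\<kappa>' a b \<noteq> k" using RA by blast+
      then have bc: "\<kappa>' b c = \<kappa> b c" using old[of b c] s by simp
      have "\<kappa> a b \<noteq> \<kappa> a c"
      proof
        assume e: "\<kappa> a b = \<kappa> a c"
        then have "\<not> hat a c" using hatK[of a c] k by auto
        then have "\<kappa>' a c = \<kappa> a c" by (simp add: \<kappa>')
        then show False using e s k by simp
      qed
      then have "(c, b) \<in> R" using I(6)[OF V] ab s k bc by simp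
      then show ?thesis by blast
    qed
    have c6: "(a, c) \<in> R \<union> A"
      if V: "a \<in> {1..n}" "b \<in> {1..n}" "c \<in> {1..n}" and s: "\<kappa>' a b = \<kappa>' b c" "\<kappa>' a b = \<kappa>' a c"
        and ab: "(a, b) \<in> R \<union> A" "(b, c) \<in> R \<union> A" for a b c
    proof (cases "\<kappa>' a b = k")
      case True
      then have "(a, b) \<in> A" "(b, c) \<in> A" using ab RA s by (metis Un_iff)+
      moreover have "hat a c" using True s new[OF _ V(1,3)] by metis
      ultimately have "(a, b) \<in> A" "(b, c) \<in> A" "hat a c" by blast+
      then show ?thesis using A_transitive[of a b c] hat_color[of a c] unfolding AA by blast
    next
      case False
      then have R: "(a, b) \<in> R" "(b, c) \<in> R" using ab Akey s by (metis Un_iff)+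
      then have e: "\<kappa>' a b = \<kappa> a b" "\<kappa>' b c = \<kappa> b c" "2 \<le> \<kappa> a b" using RA by blast+
      then have "\<kappa>' a c = \<kappa> a c" using old[of a c] s False by simp
      then have "(a, c) \<in> R" using I(7)[OF V _ _ R] s e by simp
      then show ?thesis by blast
    qed
    have pqA: "(p, q) \<in> A" using pq_in_A by (simp add: AA)
    have c7: "\<exists>p'\<in>{1..n}. \<exists>q'\<in>{1..n}. \<kappa>' u v = pair_code n p' q' \<and> \<kappa>' p' q' = \<kappa>' u v"
      if uv: "u \<in> {1..n}" "v \<in> {1..n}" "2 \<le> \<kappa>' u v" for u v
    proof (cases "\<kappa>' u v = k")
      case True
      then have "\<kappa>' u v = pair_code n p q \<and> \<kappa>' p q = \<kappa>' u v" using Akey[OF pqA] by (simp add: k_def)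
      then show ?thesis using p q by blast
    next
      case False
      then have o: "\<kappa>' u v = \<kappa> u v" "2 \<le> \<kappa> u v" using old[of u v] uv by auto
      then obtain p' q' where *: "p' \<in> {1..n}" "q' \<in> {1..n}" "\<kappa> u v = pair_code n p' q'" "\<kappa> p' q' = \<kappa> u v"
        using I(8) uv by blast
      then have "\<kappa>' p' q' = \<kappa> p' q'" using hatK[of p' q'] o by (auto simp: \<kappa>')
      then show ?thesis using * o by metis
    qed
    have c8: "\<kappa>\<^sub>0 a b = \<kappa>\<^sub>0 c d"
      if V: "a \<in> {1..n}" "b \<in> {1..n}" "c \<in> {1..n}" "d \<in> {1..n}" and s: "\<kappa>' a b = \<kappa>' c d" for a b c d
    proof -
      have "\<kappa> a b = \<kappa> c d"
      proof (cases "\<kappa>' a b = k")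
        case True
        then show ?thesis using new[of a b] new[of c d] hat_color V s by metis
      next
        case False
        then show ?thesis using s by (auto simp: \<kappa>' split: if_splits)
      qed
      then show ?thesis using I(9) V by blast
    qed
    have sub: "R \<union> A \<subseteq> {1..n} \<times> {1..n}" using I(3) Akey by auto
    have c1: "gallai n \<kappa>'" unfolding \<kappa>' by (rule split_gallai[OF fresh])
    have c2: "\<exists>r. admissible n \<kappa>' r" using split_admissible[OF fresh] unfolding \<kappa>' by blast
    have "orient_inv n \<kappa>\<^sub>0 (\<kappa>', R \<union> A)"
      unfolding orient_inv_def prod.case
    proof (intro conjI)
      show "gallai n \<kappa>'" by (rule c1)
      show "\<exists>r. admissible n \<kappa>' r" by (rule c2)
      show "R \<union> A \<subseteq> {1..n} \<times> {1..n}" by (rule sub)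
      show "\<forall>u\<in>{1..n}. \<forall>v\<in>{1..n}. u \<noteq> v \<longrightarrow> 2 \<le> \<kappa>' u v \<longrightarrow> ((u, v) \<in> R \<union> A) = ((v, u) \<notin> R \<union> A)"
        by (intro ballI impI) (rule c4)
      show "\<forall>u v. (u, v) \<in> R \<union> A \<longrightarrow> u \<noteq> v \<and> 2 \<le> \<kappa>' u v"
        by (intro allI impI) (rule c3)
    qed (intro ballI impI, rule c5 c6 c7 c8; assumption)+
    then show ?thesis using Akey[OF pqA] k2 by simp
  qed
  then show "orient_inv n \<kappa>\<^sub>0 (split_class n p q S)" "p = q \<or> 2 \<le> fst (split_class n p q S) p q"
    by (simp_all add: split)
qed

lemma orient_inv_orient:
  assumes "orient_inv n \<kappa> (\<kappa>, {})"
  shows "orient_inv n \<kappa> (orient n \<kappa>)"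
    and "u \<in> {1..n} \<Longrightarrow> v \<in> {1..n} \<Longrightarrow> u \<noteq> v \<Longrightarrow> 2 \<le> fst (orient n \<kappa>) u v"
proof -
  let ?I = "orient_inv n \<kappa>" and ?D = "\<lambda>p q S. p = q \<or> 2 \<le> fst S p q"
  let ?row = "\<lambda>p. iter (\<lambda>q. split_class n p q) n"
  have row: "?I (?row p S)" if "?I S" "p \<in> {1..n}" for p S
    by (rule iter_invariant) (use that split_class_inv(1) in auto)
  have keep: "?D u v (?row p S)" if "?I S" "p \<in> {1..n}" "?D u v S" for p S u v
  proof -
    have "?I (?row p S) \<and> ?D u v (?row p S)"
      by (rule iter_invariant) (use that split_class_inv(1,3) in blast)+
    then show ?thesis by blast
  qed
  have done_row: "?D p q (?row p S)" if "?I S" "p \<in> {1..n}" "q \<in> {1..n}" for p q S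
    by (rule iter_covers[where I="?I" and D="\<lambda>q. ?D p q"]) (use that split_class_inv in blast)+
  show "?I (orient n \<kappa>)" unfolding orient_def
    by (rule iter_invariant) (use assms row in auto)
  assume uv: "u \<in> {1..n}" "v \<in> {1..n}" "u \<noteq> v"
  have "\<forall>q\<in>{1..n}. ?D u q (orient n \<kappa>)" unfolding orient_def
    by (rule iter_covers[where I="?I" and D="\<lambda>p S. \<forall>q\<in>{1..n}. ?D p q S"]) (use assms uv row keep done_row in blast)+
  then show "2 \<le> fst (orient n \<kappa>) u v" using uv by blast
qed

subsection \<open>The diagram\<close>

definition rank :: "nat \<Rightarrow> (nat \<Rightarrow> nat \<Rightarrow> bool) \<Rightarrow> nat \<Rightarrow> nat" where
  "rank n R u = card {v \<in> {1..n}. R v u}"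

lemma rank_less:
  assumes trans: "\<And>a b c. a \<in> {1..n} \<Longrightarrow> b \<in> {1..n} \<Longrightarrow> c \<in> {1..n} \<Longrightarrow> R a b \<Longrightarrow> R b c \<Longrightarrow> R a c"
    and irrefl: "\<And>a. \<not> R a a" and total: "\<And>a b. a \<in> {1..n} \<Longrightarrow> b \<in> {1..n} \<Longrightarrow> a \<noteq> b \<Longrightarrow> R a b \<or> R b a"
    and u: "u \<in> {1..n}" and v: "v \<in> {1..n}"
  shows "rank n R u < rank n R v \<longleftrightarrow> R u v"
proof -
  have lt: "rank n R a < rank n R b" if "R a b" "a \<in> {1..n}" "b \<in> {1..n}" for a b
    unfolding rank_def
  proof (rule psubset_card_mono)
    have "{v \<in> {1..n}. R v a} \<subseteq> {v \<in> {1..n}. R v b}" using trans[OF _ that(2,3)] that by blast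
    moreover have "a \<in> {v \<in> {1..n}. R v b}" "a \<notin> {v \<in> {1..n}. R v a}" using that irrefl by auto
    ultimately show "{v \<in> {1..n}. R v a} \<subset> {v \<in> {1..n}. R v b}" by blast
  qed simp
  show ?thesis using lt[of u v] lt[of v u] total[of u v] u v by (cases "u = v") (auto simp: irrefl)
qed

lemma rank_bij:
  assumes trans: "\<And>a b c. a \<in> {1..n} \<Longrightarrow> b \<in> {1..n} \<Longrightarrow> c \<in> {1..n} \<Longrightarrow> R a b \<Longrightarrow> R b c \<Longrightarrow> R a c"
    and irrefl: "\<And>a. \<not> R a a" and total: "\<And>a b. a \<in> {1..n} \<Longrightarrow> b \<in> {1..n} \<Longrightarrow> a \<noteq> b \<Longrightarrow> R a b \<or> R b a"
  shows "bij_betw (rank n R) {1..n} {..<n}"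
proof -
  have less: "rank n R u < rank n R v" if "R u v" "u \<in> {1..n}" "v \<in> {1..n}" for u v
    using rank_less[of n R u v] trans irrefl total that by blast
  have inj: "inj_on (rank n R) {1..n}"
  proof (rule inj_onI, rule ccontr)
    fix u v assume *: "u \<in> {1..n}" "v \<in> {1..n}" "rank n R u = rank n R v" "u \<noteq> v"
    then show False using total[of u v] less[of u v] less[of v u] by auto
  qed
  have "rank n R u < n" if "u \<in> {1..n}" for u
  proof -
    have "{v \<in> {1..n}. R v u} \<subset> {1..n}" using irrefl[of u] that by blast
    then have "card {v \<in> {1..n}. R v u} < card {1..n}" by (intro psubset_card_mono) auto
    then show ?thesis by (simp add: rank_def)
  qed
  then have "rank n R ` {1..n} \<subseteq> {..<n}" by auto
  then have "rank n R ` {1..n} = {..<n}"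
    using card_image[OF inj] by (intro card_subset_eq) auto
  then show ?thesis using inj by (simp add: bij_betw_def)
qed

definition edge_color :: "(nat \<times> nat) set \<Rightarrow> nat \<Rightarrow> nat \<Rightarrow> nat" where
  "edge_color E u v = of_bool ((u, v) \<in> E)"

text \<open>The directions \<open>R\<close> order the segments along the first line. Crossing
  segments change their order between the lines, so reversing \<open>R\<close> on the edges gives
  the second line.\<close>

definition seg_code :: "nat \<Rightarrow> (nat \<times> nat) set \<Rightarrow> bool \<Rightarrow> nat \<Rightarrow> nat" where
  "seg_code n E b u = (let R = snd (orient n (edge_color E)) in
     if b then 2 * rank n (\<lambda>v u. ((v, u) \<in> R) \<noteq> ((v, u) \<in> E)) u + 1 else 2 * rank n (\<lambda>v u. (v, u) \<in> R) u)"

text \<open>Two colours cannot make a three-coloured triangle, and the first line \<open>h\<close>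
  of any diagram is admissible: if \<open>b\<close> were between \<open>a\<close> and
  \<open>c\<close> there, two equal sides at \<open>b\<close> would make the second line monotone on
  the three vertices, and the third side would have their colour too.\<close>

lemma permutation_graph_inv:
  assumes "permutation_graph n E"
  shows "orient_inv n (edge_color E) (edge_color E, {})"
proof -
  obtain \<pi> h where \<pi>: "\<pi> permutes {1..n}" and h: "bij_betw h {1..n} {1..n}"
    and E: "\<And>u v. u \<in> {1..n} \<Longrightarrow> v \<in> {1..n} \<Longrightarrow> (u, v) \<in> E \<longleftrightarrow> (h u, h v) \<in> inversion_graph n \<pi>"
    and g: "graph n E"
    using assms unfolding permutation_graph_def graph_isomorphic_def by blast
  define y where "y u = \<pi> (h u)" for u
  have hV: "h u \<in> {1..n}" if "u \<in> {1..n}" for u using bij_betwE[OF h] that by blast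
  have hinj: "h u = h v \<longleftrightarrow> u = v" if "u \<in> {1..n}" "v \<in> {1..n}" for u v
    using inj_on_eq_iff[OF bij_betw_imp_inj_on[OF h] that] .
  have yinj: "y u = y v \<longleftrightarrow> u = v" if "u \<in> {1..n}" "v \<in> {1..n}" for u v
    using inj_eq[OF permutes_inj[OF \<pi>]] hinj[OF that] by (simp add: y_def)
  have E': "edge_color E u v = of_bool ((h u < h v) \<noteq> (y u < y v))" if "u \<in> {1..n}" "v \<in> {1..n}" for u v
  proof -
    have "(u, v) \<in> E \<longleftrightarrow> h u < h v \<and> y v < y u \<or> h v < h u \<and> y u < y v"
      unfolding E[OF that] inversion_graph_def using hV[OF that(1)] hV[OF that(2)] by (simp add: y_def)
    moreover have "h u = h v \<longleftrightarrow> y u = y v" using hinj[OF that] yinj[OF that] by simp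
    ultimately have "(u, v) \<in> E \<longleftrightarrow> (h u < h v) \<noteq> (y u < y v)" by linarith
    then show ?thesis by (simp add: edge_color_def)
  qed
  have sym: "edge_color E u v = edge_color E v u" if "u \<in> {1..n}" "v \<in> {1..n}" for u v
  proof -
    have "(u, v) \<in> E \<longleftrightarrow> (v, u) \<in> E" using g unfolding graph_def by (meson symD)
    then show ?thesis by (simp add: edge_color_def)
  qed
  have le: "edge_color E u v \<le> 1" for u v by (simp add: edge_color_def)
  have "gallai n (edge_color E)" unfolding gallai_def
  proof (intro conjI ballI impI)
    fix a b c
    have "edge_color E a b = 0 \<or> edge_color E a b = 1" "edge_color E b c = 0 \<or> edge_color E b c = 1"
      "edge_color E a c = 0 \<or> edge_color E a c = 1"
      by (simp_all add: edge_color_def)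
    then show "edge_color E a b = edge_color E b c \<or> edge_color E a b = edge_color E a c \<or>
        edge_color E b c = edge_color E a c" by auto
  qed (use sym in auto)
  moreover have "admissible n (edge_color E) h" unfolding admissible_def
  proof (intro conjI ballI impI)
    show "inj_on h {1..n}" using h by (rule bij_betw_imp_inj_on)
    fix a b c assume V: "a \<in> {1..n}" "b \<in> {1..n}" "c \<in> {1..n}" and ne: "a \<noteq> b" "b \<noteq> c" "a \<noteq> c"
      and s: "edge_color E a b = edge_color E b c" "edge_color E a b \<noteq> edge_color E a c"
    have "h a \<noteq> h b" "h b \<noteq> h c" "h a \<noteq> h c" "y a \<noteq> y b" "y b \<noteq> y c" "y a \<noteq> y c"
      using hinj yinj V ne by blast+
    then have ne: "h b < h a \<longleftrightarrow> \<not> h a < h b" "h c < h b \<longleftrightarrow> \<not> h b < h c" "h c < h a \<longleftrightarrow> \<not> h a < h c"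
      "y b < y a \<longleftrightarrow> \<not> y a < y b" "y c < y b \<longleftrightarrow> \<not> y b < y c" "y c < y a \<longleftrightarrow> \<not> y a < y c"
      by linarith+
    have tr: "h a < h b \<Longrightarrow> h b < h c \<Longrightarrow> h a < h c" "h c < h b \<Longrightarrow> h b < h a \<Longrightarrow> h c < h a"
      "y a < y b \<Longrightarrow> y b < y c \<Longrightarrow> y a < y c" "y c < y b \<Longrightarrow> y b < y a \<Longrightarrow> y c < y a"
      by linarith+
    have "((h a < h b) \<noteq> (y a < y b)) = ((h b < h c) \<noteq> (y b < y c))"
      "((h a < h b) \<noteq> (y a < y b)) \<noteq> ((h a < h c) \<noteq> (y a < y c))"
      using s unfolding E'[OF V(1,2)] E'[OF V(2,3)] E'[OF V(1,3)] of_bool_eq_iff by blast+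
    then show "h a < h b \<longleftrightarrow> h c < h b" using ne tr by argo
  qed
  moreover have "\<not> 2 \<le> edge_color E u v" for u v using le[of u v] by simp
  ultimately show ?thesis unfolding orient_inv_def by blast
qed

theorem seg_code_diagram:
  assumes "permutation_graph n E"
  shows "diagram n E (rank n (\<lambda>v u. (v, u) \<in> snd (orient n (edge_color E))))
    (rank n (\<lambda>v u. ((v, u) \<in> snd (orient n (edge_color E))) \<noteq> ((v, u) \<in> E))) (seg_code n E)"
proof -
  note inv = permutation_graph_inv[OF assms]
  have g: "graph n E" using assms by (simp add: permutation_graph_def)
  obtain \<kappa> R where S: "orient n (edge_color E) = (\<kappa>, R)" by fastforce
  note I = orient_invD[OF orient_inv_orient(1)[OF inv, unfolded S]]
  have oriented: "2 \<le> \<kappa> u v" if "u \<in> {1..n}" "v \<in> {1..n}" "u \<noteq> v" for u v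
    using orient_inv_orient(2)[OF inv that] by (simp add: S)
  have irr: "(u, u) \<notin> R" for u using I(5) by blast
  have tot: "(u, v) \<in> R \<longleftrightarrow> (v, u) \<notin> R" if "u \<in> {1..n}" "v \<in> {1..n}" "u \<noteq> v" for u v
    using I(4) oriented that by blast
  have csym: "\<kappa> u v = \<kappa> v u" if "u \<in> {1..n}" "v \<in> {1..n}" for u v using I(1) that unfolding gallai_def by blast
  have special: "(a, b) \<in> R \<longleftrightarrow> (c, b) \<in> R"
    if V: "a \<in> {1..n}" "b \<in> {1..n}" "c \<in> {1..n}" and s: "\<kappa> a b = \<kappa> b c" "\<kappa> a b \<noteq> \<kappa> a c" for a b c
    using I(6)[OF V s] I(6)[OF V(3,2,1)] s csym V by metis
  have rb: "\<kappa> a b = \<kappa> b c \<or> \<kappa> a b = \<kappa> a c \<or> \<kappa> b c = \<kappa> a c"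
    if "a \<in> {1..n}" "b \<in> {1..n}" "c \<in> {1..n}" "a \<noteq> b" "b \<noteq> c" "a \<noteq> c" for a b c
    using I(1) that unfolding gallai_def by blast
  \<comment> \<open>A monochromatic triangle is covered by the transitivity clause. In any other
    triangle the common vertex of the equal sides is a source or a sink, which a directed triangle
    does not have.\<close>
  have trans: "(a, c) \<in> R" if V: "a \<in> {1..n}" "b \<in> {1..n}" "c \<in> {1..n}" and R: "(a, b) \<in> R" "(b, c) \<in> R" for a b c
  proof -
    have ne: "a \<noteq> b" "b \<noteq> c" "a \<noteq> c" using R irr tot V by metis+
    have nR: "(b, a) \<notin> R" "(c, b) \<notin> R" using R tot V ne by blast+
    consider "\<kappa> a b = \<kappa> b c" "\<kappa> a b = \<kappa> a c" | "\<kappa> a b = \<kappa> b c" "\<kappa> a b \<noteq> \<kappa> a c"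
      | "\<kappa> a b = \<kappa> a c" "\<kappa> a b \<noteq> \<kappa> b c" | "\<kappa> b c = \<kappa> a c" "\<kappa> a b \<noteq> \<kappa> b c"
      using rb[OF V ne] by metis
    then show ?thesis
    proof cases
      case 1
      then show ?thesis using I(7)[OF V] R by blast
    next
      case 2
      then show ?thesis using special[OF V] R nR by blast
    next
      case 3
      then have "(c, a) \<notin> R" using special[of b a c] csym V nR by metis
      then show ?thesis using tot V ne by blast
    next
      case 4
      then show ?thesis using special[of b c a] csym V R by metis
    qed
  qed
  have Esym: "(u, v) \<in> E \<longleftrightarrow> (v, u) \<in> E" for u v using g unfolding graph_def by (meson symD)
  have special\<^sub>0: "(a, b) \<in> R \<longleftrightarrow> (c, b) \<in> R"
    if V: "a \<in> {1..n}" "b \<in> {1..n}" "c \<in> {1..n}" and ne: "a \<noteq> b" "b \<noteq> c" "a \<noteq> c"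
      and s: "(a, b) \<in> E \<longleftrightarrow> (b, c) \<in> E" "(a, b) \<in> E \<longleftrightarrow> (a, c) \<notin> E" for a b c
  proof -
    have "edge_color E a b \<noteq> edge_color E a c" "edge_color E b c \<noteq> edge_color E a c"
      using s by (auto simp: edge_color_def)
    \<comment> \<open>An edge and a non-edge never share a refined colour. Without three-coloured
      triangles, the two sides of equal kind therefore also have equal refined colours.\<close>
    then have "\<kappa> a b \<noteq> \<kappa> a c" "\<kappa> b c \<noteq> \<kappa> a c" using I(9) V by blast+
    then show ?thesis using special[OF V] rb[OF V ne] by metis
  qed
  let ?R' = "\<lambda>v u. ((v, u) \<in> R) \<noteq> ((v, u) \<in> E)"
  have Eirr: "(u, u) \<notin> E" for u using g unfolding graph_def irrefl_def by blast
  have tot': "?R' u v \<longleftrightarrow> \<not> ?R' v u" if "u \<in> {1..n}" "v \<in> {1..n}" "u \<noteq> v" for u v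
    using tot[OF that] Esym[of u v] by blast
  \<comment> \<open>Reversing the edges preserves acyclicity of triangles: a triangle of one kind is
    reversed entirely or not at all, and otherwise the sides of equal kind are reversed together, so
    their common vertex remains a source or a sink.\<close>
  have trans': "?R' a c" if V: "a \<in> {1..n}" "b \<in> {1..n}" "c \<in> {1..n}" and R: "?R' a b" "?R' b c" for a b c
  proof -
    have ne: "a \<noteq> b" "b \<noteq> c" "a \<noteq> c" using R irr Eirr tot' V by metis+
    note t = tot[OF V(1,2) ne(1)] tot[OF V(2,3) ne(2)] tot[OF V(1,3) ne(3)]
    note e = Esym[of a b] Esym[of b c] Esym[of a c]
    have ne': "c \<noteq> b" "b \<noteq> a" "c \<noteq> a" using ne by blast+
    show ?thesis
    proof (cases "(a, b) \<in> E \<longleftrightarrow> (b, c) \<in> E")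
      case True
      show ?thesis
      proof (cases "(a, b) \<in> E \<longleftrightarrow> (a, c) \<in> E")
        case same: True
        show ?thesis
        proof (cases "(a, b) \<in> E")
          case True
          then have "(c, a) \<in> R" using trans[OF V(3,2,1)] R t same \<open>(a, b) \<in> E \<longleftrightarrow> (b, c) \<in> E\<close> by blast
          then show ?thesis using t same True by blast
        next
          case False
          then show ?thesis using trans[OF V] R same \<open>(a, b) \<in> E \<longleftrightarrow> (b, c) \<in> E\<close> by blast
        qed
      next
        case False
        then show ?thesis using special\<^sub>0[OF V ne True] R t True by blast
      qed
    next
      case diff: False
      show ?thesis
      proof (cases "(a, b) \<in> E \<longleftrightarrow> (a, c) \<in> E")
        case True
        then show ?thesis using special\<^sub>0[OF V(2,1,3) ne'(2) ne(3) ne(2)] R t e diff by blast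
      next
        case False
        then show ?thesis using special\<^sub>0[OF V(2,3,1) ne(2) ne'(3) ne'(2)] R t e diff by blast
      qed
    qed
  qed
  have irr': "\<not> ?R' u u" for u using irr Eirr by blast
  have tt: "(a, b) \<in> R \<or> (b, a) \<in> R" and tt': "?R' a b \<or> ?R' b a"
    if "a \<in> {1..n}" "b \<in> {1..n}" "a \<noteq> b" for a b
    using tot[OF that] tot'[OF that] by blast+
  let ?x = "rank n (\<lambda>v u. (v, u) \<in> R)" and ?y = "rank n ?R'"
  have x_less: "?x u < ?x v \<longleftrightarrow> (u, v) \<in> R" if "u \<in> {1..n}" "v \<in> {1..n}" for u v
    by (rule rank_less[where R="\<lambda>v u. (v, u) \<in> R"]) (use trans irr tt that in blast)+
  have y_less: "?y u < ?y v \<longleftrightarrow> ?R' u v" if "u \<in> {1..n}" "v \<in> {1..n}" for u v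
    by (rule rank_less[where R="?R'"]) (use trans' irr' tt' that in blast)+
  have EV: "u \<in> {1..n} \<and> v \<in> {1..n}" if "(u, v) \<in> E" for u v using g that unfolding graph_def by blast
  show ?thesis unfolding S snd_conv
  proof
    show "bij_betw ?x {1..n} {..<n}"
      by (rule rank_bij[where R="\<lambda>v u. (v, u) \<in> R"]) (use trans irr tt in blast)+
    show "bij_betw ?y {1..n} {..<n}"
      by (rule rank_bij[where R="?R'"]) (use trans' irr' tt' in blast)+
    show "(u, v) \<in> E \<longleftrightarrow> u \<in> {1..n} \<and> v \<in> {1..n} \<and> (?x u < ?x v) \<noteq> (?y u < ?y v)" for u v
      using x_less y_less EV by blast
    show "seg_code n E b u = (if b then 2 * ?y u + 1 else 2 * ?x u)" for b u
      by (simp add: seg_code_def S)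
  qed
qed

section \<open>Levels and phases\<close>

text \<open>
  The greedy chain from position \<open>0\<close> divides both lines into levels. The number of greedy steps
  from a position \<open>z\<close> to beyond a position \<open>z'\<close> on the right line is the difference of the
  levels or this number plus \<open>2\<close>; \<open>beats\<close> tells which one, and it is a linear order on all positions.
\<close>

definition chain :: "nat \<Rightarrow> (bool \<Rightarrow> nat \<Rightarrow> nat) \<Rightarrow> nat \<Rightarrow> nat" where
  "chain n c i = (hop n c ^^ i) 0"

text \<open>The least index with the parity of \<open>z\<close> whose chain position is beyond
  \<open>z\<close>. Starting from \<open>z mod 2\<close>, \<open>n\<close> increments by 2 suffice
  for \<open>z < 2 * n\<close>, as the chain grows by at least 1 per index.\<close>

definition level :: "nat \<Rightarrow> (bool \<Rightarrow> nat \<Rightarrow> nat) \<Rightarrow> nat \<Rightarrow> nat" where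
  "level n c z = iter (\<lambda>_ i. if chain n c i \<le> z then i + 2 else i) n (z mod 2)"

definition beats :: "nat \<Rightarrow> (bool \<Rightarrow> nat \<Rightarrow> nat) \<Rightarrow> nat \<Rightarrow> nat \<Rightarrow> bool" where
  "beats n c z z' \<longleftrightarrow> (if level n c z \<le> level n c z' then z' < (hop n c ^^ (level n c z' - level n c z)) z
     else \<not> z < (hop n c ^^ (level n c z - level n c z')) z')"

definition comp_size :: "nat \<Rightarrow> (bool \<Rightarrow> nat \<Rightarrow> nat) \<Rightarrow> nat \<Rightarrow> nat" where
  "comp_size n c u = card {v \<in> {1..n}. comp_start n c v = comp_start n c u}"

text \<open>Positions on both lines are counted together, which makes ranks comparable across the
  lines.\<close>

definition local_rank :: "nat \<Rightarrow> (bool \<Rightarrow> nat \<Rightarrow> nat) \<Rightarrow> bool \<Rightarrow> nat \<Rightarrow> nat" where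
  "local_rank n c b u =
     card {v \<in> {1..n}. comp_start n c v = comp_start n c u \<and> beats n c (c b u) (c False v)} +
     card {v \<in> {1..n}. comp_start n c v = comp_start n c u \<and> beats n c (c b u) (c True v)}"

lemma parity_gap: "even i \<longleftrightarrow> even j \<Longrightarrow> i < j \<Longrightarrow> i + 2 \<le> (j :: nat)"
  by presburger

context diagram
begin

abbreviation "lev \<equiv> level n c"

section \<open>The greedy chain and its levels\<close>

lemma chain_0: "chain n c 0 = 0" and chain_Suc: "chain n c (Suc i) = H (chain n c i)"
  and chain_add: "chain n c (i + k) = (H ^^ k) (chain n c i)"
  by (simp_all add: chain_def funpow_add add.commute[of i])

lemma chain_parity: "even (chain n c i) \<longleftrightarrow> even i"
  by (simp add: chain_def hops_parity)

lemma chain_ge: "chain n c i + k \<le> chain n c (i + k)"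
  unfolding chain_add by (rule hops_ge)

lemma chain_mono: "i \<le> j \<Longrightarrow> chain n c i \<le> chain n c j"
  using chain_ge[of i "j - i"] by simp

lemma level_props:
  assumes "z < 2 * n"
  shows level_parity: "even (lev z) \<longleftrightarrow> even z"
    and level_upper: "z < chain n c (lev z)"
    and level_lower: "2 \<le> lev z \<Longrightarrow> chain n c (lev z - 2) \<le> z"
proof -
  let ?f = "\<lambda>i. if chain n c i \<le> z then i + 2 else i"
  have *: "(even ((?f ^^ k) (z mod 2)) \<longleftrightarrow> even z) \<and>
    (2 \<le> (?f ^^ k) (z mod 2) \<longrightarrow> chain n c ((?f ^^ k) (z mod 2) - 2) \<le> z) \<and>
    (z < chain n c ((?f ^^ k) (z mod 2)) \<or> 2 * k \<le> (?f ^^ k) (z mod 2))" for k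
    by (induction k) auto
  have "lev z = (?f ^^ n) (z mod 2)" by (simp add: level_def iter_funpow)
  moreover have "z < chain n c (lev z)" if "2 * n \<le> lev z"
    using chain_ge[of 0 "lev z"] that assms by simp
  ultimately show "even (lev z) \<longleftrightarrow> even z" "z < chain n c (lev z)" "2 \<le> lev z \<Longrightarrow> chain n c (lev z - 2) \<le> z"
    using *[of n] by auto
qed

lemma level_le_iff:
  assumes "z < 2 * n" "even j \<longleftrightarrow> even z"
  shows "lev z \<le> j \<longleftrightarrow> z < chain n c j"
proof
  assume "lev z \<le> j"
  then show "z < chain n c j" using level_upper[OF assms(1)] chain_mono[of "lev z" j] by simp
next
  assume z: "z < chain n c j"
  show "lev z \<le> j"
  proof (rule ccontr)
    assume "\<not> lev z \<le> j"
    moreover have "even (lev z) \<longleftrightarrow> even j" using level_parity[OF assms(1)] assms(2) by simp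
    ultimately have "2 \<le> lev z \<and> j \<le> lev z - 2" using parity_gap[of j "lev z"] by simp
    then show False using z chain_mono[of j "lev z - 2"] level_lower[OF assms(1)] by simp
  qed
qed

lemma level_pos: "z < 2 * n \<Longrightarrow> 0 < lev z"
  using level_upper[of z] by (cases "lev z") (simp_all add: chain_0)

text \<open>A position of level \<open>i\<close> lies between the chain positions
  \<open>i - 2\<close> and \<open>i\<close>, so by monotonicity its image after \<open>k\<close>
  hops lies between \<open>i - 2 + k\<close> and \<open>i + k\<close>. Levels of the target line
  have one parity, so only level \<open>i + k\<close> is left for \<open>beats\<close> to
  decide.\<close>

lemma hops_greater_iff:
  assumes z: "z < 2 * n" and z': "z' < 2 * n" and par: "even (z + k) \<longleftrightarrow> even z'"
  shows "z' < (H ^^ k) z \<longleftrightarrow> lev z' < lev z + k \<or> lev z' = lev z + k \<and> beats n c z z'"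
proof -
  let ?i = "lev z" and ?j = "lev z'"
  have lp: "even (?i + k) \<longleftrightarrow> even ?j" using par level_parity[OF z] level_parity[OF z'] by auto
  consider "?j + 2 \<le> ?i + k" | "?i + k = ?j" | "?i + k + 2 \<le> ?j" 
    using lp parity_gap[of "?i + k" ?j] parity_gap[of ?j "?i + k"] by (metis linorder_neqE_nat)
  then show ?thesis
  proof cases
    case 1
    have "z' < chain n c ?j" by (rule level_upper[OF z'])
    also have "chain n c ?j \<le> (H ^^ k) z"
    proof (cases "2 \<le> ?i")
      case True
      have "chain n c ?j \<le> chain n c (?i - 2 + k)" using 1 True by (intro chain_mono) simp
      also have "\<dots> = (H ^^ k) (chain n c (?i - 2))" by (rule chain_add)
      also have "\<dots> \<le> (H ^^ k) z"
        by (rule hops_mono[OF level_lower[OF z True]]) (use level_parity[OF z] True in \<open>simp add: chain_parity\<close>)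
      finally show ?thesis .
    next
      case False
      \<comment> \<open>Level 1 has no chain position below it. Instead the first hop leads to an
        even position, which is at least 0, the start of the chain.\<close>
      then have i: "?i = 1" using level_pos[OF z] by simp
      then obtain k' where k: "k = Suc k'" "?j \<le> k'" using 1 by (cases k) auto
      have "odd z" using level_parity[OF z] i by simp
      then have "(H ^^ k') 0 \<le> (H ^^ k') (H z)" by (intro hops_mono) (simp_all add: hop_parity)
      then have "chain n c k' \<le> (H ^^ k) z" by (simp add: chain_def k funpow_swap1)
      then show ?thesis using chain_mono[OF k(2)] by simp
    qed
    finally show ?thesis using 1 by simp
  next
    case 2
    then have "?i \<le> ?j" "?j - ?i = k" by simp_all
    then show ?thesis using 2 by (simp add: beats_def)
  next
    case 3
    have "(H ^^ k) z \<le> (H ^^ k) (chain n c ?i)"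
      by (rule hops_mono) (use level_upper[OF z] level_parity[OF z] in \<open>simp_all add: chain_parity\<close>)
    also have "\<dots> = chain n c (?i + k)" by (rule chain_add[symmetric])
    also have "\<dots> \<le> chain n c (?j - 2)" using 3 by (intro chain_mono) simp
    also have "\<dots> \<le> z'" using level_lower[OF z'] 3 by simp
    finally show ?thesis using 3 by simp
  qed
qed

lemma level_mono:
  assumes "z' < 2 * n" "z \<le> z'" "even z \<longleftrightarrow> even z'"
  shows "lev z \<le> lev z'"
proof -
  have z: "z < 2 * n" using assms by simp
  have "even (lev z') \<longleftrightarrow> even z" using level_parity[OF assms(1)] assms(3) by simp
  from level_le_iff[OF z this] show ?thesis using level_upper[OF assms(1)] assms(2) by simp
qed

text \<open>This keeps the levels inside a component within a multiple of its size, so that a short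
  field can hold them.\<close>

lemma level_add:
  assumes "z + 2 * d < 2 * n"
  shows "lev (z + 2 * d) \<le> lev z + 2 * d"
proof -
  have z: "z < 2 * n" using assms by simp
  have "even (lev z + 2 * d) \<longleftrightarrow> even (z + 2 * d)" using level_parity[OF z] by simp
  from level_le_iff[OF assms this] show ?thesis
    using level_upper[OF z] chain_ge[of "lev z" "2 * d"] by simp
qed

text \<open>One hop leads to at most the chain position with the next index. This bound is not
  strict, and levels on a line differ by multiples of 2, hence 3 instead of 1.\<close>

lemma level_other_line:
  assumes u: "u \<in> {1..n}"
  shows "lev (c (\<not> b) u) \<le> lev (c b u) + 3"
proof -
  let ?z = "c b u" and ?i = "lev (c b u)"
  note l = code_less[OF u]
  have "even (?i + 3) \<longleftrightarrow> even (c (\<not> b) u)" using level_parity[OF l, of b] by (simp add: code_parity)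
  note iff = level_le_iff[OF l this]
  have "c (\<not> b) u \<le> H ?z" by (rule hop_code[OF u order_refl]) (simp add: code_parity)
  also have "\<dots> \<le> H (chain n c ?i)"
    by (rule hop_mono) (use level_upper[OF l, of b] level_parity[OF l, of b] in \<open>simp_all add: chain_parity\<close>)
  also have "\<dots> = chain n c (Suc ?i)" by (simp add: chain_Suc)
  also have "\<dots> < chain n c (?i + 3)" using chain_ge[of "Suc ?i" 2] by (simp add: numeral_3_eq_3)
  finally show ?thesis using iff by simp
qed

text \<open>For different levels the second branch of the definition negates the first with
  exchanged roles; for equal levels \<open>beats\<close> compares the positions themselves.\<close>

lemma beats_linear:
  assumes "z \<noteq> z'"
  shows "beats n c z z' \<longleftrightarrow> \<not> beats n c z' z"
  using assms by (cases "lev z" "lev z'" rule: linorder_cases) (auto simp: beats_def)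

text \<open>Monotone hops carry the three comparisons to the higher level of the positions
  \<open>x\<^sub>2\<close> and \<open>x\<^sub>3\<close>, where they chain up to a number being less
  than itself.\<close>

lemma beats_no_cycle:
  assumes a: "x\<^sub>1 < 2 * n" "x\<^sub>2 < 2 * n" "x\<^sub>3 < 2 * n" and min: "lev x\<^sub>1 \<le> lev x\<^sub>2" "lev x\<^sub>1 \<le> lev x\<^sub>3"
    and cyc: "beats n c x\<^sub>1 x\<^sub>2" "beats n c x\<^sub>2 x\<^sub>3" "beats n c x\<^sub>3 x\<^sub>1"
  shows False
proof -
  let ?i = "lev x\<^sub>1" and ?j = "lev x\<^sub>2" and ?k = "lev x\<^sub>3"
  note par = level_parity[OF a(1)] level_parity[OF a(2)] level_parity[OF a(3)]
  have 12: "x\<^sub>2 < (H ^^ (?j - ?i)) x\<^sub>1" using cyc(1) min by (simp add: beats_def)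
  have 31: "(H ^^ (?k - ?i)) x\<^sub>1 \<le> x\<^sub>3"
    using cyc(3) min by (cases "?k = ?i") (auto simp: beats_def split: if_splits)
  show False
  proof (cases "?j \<le> ?k")
    case True
    then have 23: "x\<^sub>3 < (H ^^ (?k - ?j)) x\<^sub>2" using cyc(2) by (simp add: beats_def)
    have "(H ^^ (?k - ?j)) x\<^sub>2 \<le> (H ^^ (?k - ?j)) ((H ^^ (?j - ?i)) x\<^sub>1)"
      using 12 par min by (intro hops_mono) (auto simp: hops_parity)
    also have "\<dots> = (H ^^ (?k - ?j + (?j - ?i))) x\<^sub>1" by (simp only: funpow_add comp_apply)
    also have "\<dots> = (H ^^ (?k - ?i)) x\<^sub>1" using True min by simp
    finally show False using 23 31 by simp
  next
    case False
    then have 23: "(H ^^ (?j - ?k)) x\<^sub>3 \<le> x\<^sub>2" using cyc(2) by (simp add: beats_def)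
    have "(H ^^ (?j - ?i)) x\<^sub>1 = (H ^^ (?j - ?k + (?k - ?i))) x\<^sub>1" using False min by simp
    also have "\<dots> = (H ^^ (?j - ?k)) ((H ^^ (?k - ?i)) x\<^sub>1)" by (simp only: funpow_add comp_apply)
    also have "\<dots> \<le> (H ^^ (?j - ?k)) x\<^sub>3"
      using 31 par min by (intro hops_mono) (auto simp: hops_parity)
    finally show False using 23 12 by simp
  qed
qed

lemma beats_trans:
  assumes a: "x\<^sub>1 < 2 * n" "x\<^sub>2 < 2 * n" "x\<^sub>3 < 2 * n" and 12: "beats n c x\<^sub>1 x\<^sub>2" and 23: "beats n c x\<^sub>2 x\<^sub>3"
  shows "beats n c x\<^sub>1 x\<^sub>3"
proof (rule ccontr)
  assume n13: "\<not> beats n c x\<^sub>1 x\<^sub>3"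
  have irr: "\<not> beats n c z z" for z by (simp add: beats_def)
  then have "x\<^sub>1 \<noteq> x\<^sub>3" using beats_linear[of x\<^sub>1 x\<^sub>2] 12 23 by blast
  then have 31: "beats n c x\<^sub>3 x\<^sub>1" using n13 beats_linear by blast
  consider "lev x\<^sub>1 \<le> lev x\<^sub>2" "lev x\<^sub>1 \<le> lev x\<^sub>3" | "lev x\<^sub>2 \<le> lev x\<^sub>1" "lev x\<^sub>2 \<le> lev x\<^sub>3" | "lev x\<^sub>3 \<le> lev x\<^sub>1" "lev x\<^sub>3 \<le> lev x\<^sub>2"
    by linarith
  then show False
    using beats_no_cycle[OF a] beats_no_cycle[OF a(2,3,1)] beats_no_cycle[OF a(3,1,2)] 12 23 31
    by cases blast+
qed

text \<open>By transitivity the winner beats all that the loser beats, and it also beats the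
  loser.\<close>

lemma local_rank_less:
  assumes u: "u \<in> {1..n}" and w: "w \<in> {1..n}" and o: "o\<^sub>c u = o\<^sub>c w" and ne: "c b u \<noteq> c b' w"
  shows "local_rank n c b' w < local_rank n c b u \<longleftrightarrow> beats n c (c b u) (c b' w)"
proof -
  have lt: "local_rank n c b' w < local_rank n c b u"
    if u: "u \<in> {1..n}" and w: "w \<in> {1..n}" and o: "o\<^sub>c u = o\<^sub>c w" and *: "beats n c (c b u) (c b' w)" for b b' u w
  proof -
    let ?S = "\<lambda>d z. {v \<in> {1..n}. o\<^sub>c v = o\<^sub>c u \<and> beats n c z (c d v)}"
    have sub: "?S d (c b' w) \<subseteq> ?S d (c b u)" for d
      using beats_trans[OF code_less[OF u] code_less[OF w] code_less *] by blast
    have "w \<in> ?S b' (c b u)" "w \<notin> ?S b' (c b' w)" using w o * by (auto simp: beats_def)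
    then have "?S b' (c b' w) \<subset> ?S b' (c b u)" using sub[of b'] by blast
    then have less: "card (?S b' (c b' w)) < card (?S b' (c b u))" by (intro psubset_card_mono) auto
    have "card (?S d (c b' w)) \<le> card (?S d (c b u))" for d using sub by (intro card_mono) auto
    from less this[of "\<not> b'"] show ?thesis
      unfolding local_rank_def o[symmetric] by (cases b') auto
  qed
  show ?thesis using lt[OF u w o] lt[OF w u o[symmetric]] beats_linear[OF ne] by (metis less_asym)
qed

section \<open>Sizes and intervals of components\<close>

lemma position_in_comp: "u \<in> {1..n} \<Longrightarrow> x u - o\<^sub>c u < comp_size n c u"
proof -
  assume u: "u \<in> {1..n}"
  have le: "o\<^sub>c u \<le> x u" using comp_start_le[of u] by (simp add: code)
  have "{o\<^sub>c u..x u} \<subseteq> x ` {v \<in> {1..n}. o\<^sub>c v = o\<^sub>c u}"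
  proof
    fix i assume i: "i \<in> {o\<^sub>c u..x u}"
    then have "i \<in> {..<n}" using x_less[OF u] by auto
    then obtain v where v: "v \<in> {1..n}" "i = x v" using bij_betw_imp_surj_on[OF bij_x] by (metis imageE)
    have "o\<^sub>c u \<le> o\<^sub>c v" using comp_start_max[OF v(1) comp_start_cut[of u]] i v by (simp add: code)
    moreover have "o\<^sub>c v \<le> o\<^sub>c u"
      using comp_start_max[OF u comp_start_cut[of v]] comp_start_le[of v] i v by (simp add: code)
    ultimately show "i \<in> x ` {v \<in> {1..n}. o\<^sub>c v = o\<^sub>c u}" using v by auto
  qed
  then have "card {o\<^sub>c u..x u} \<le> card (x ` {v \<in> {1..n}. o\<^sub>c v = o\<^sub>c u})" by (intro card_mono) auto
  also have "\<dots> \<le> comp_size n c u" unfolding comp_size_def by (intro card_image_le) auto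
  finally show ?thesis using le by simp
qed

text \<open>On the first line, the segments of a component lie between its own cut and the cut of
  any later component. This spacing is what lets rounded starting positions tell components of
  similar size apart.\<close>

lemma comp_size_le_gap:
  assumes u: "u \<in> {1..n}" and lt: "o\<^sub>c u < o\<^sub>c w"
  shows "o\<^sub>c u + comp_size n c u \<le> o\<^sub>c w"
proof -
  let ?S = "{v \<in> {1..n}. o\<^sub>c v = o\<^sub>c u}"
  have "x v \<in> {o\<^sub>c u..<o\<^sub>c w}" if v: "v \<in> ?S" for v
  proof -
    have "\<not> o\<^sub>c w \<le> x v" using comp_start_max[of v, OF _ comp_start_cut[of w]] v lt by (auto simp: code)
    then show ?thesis using comp_start_le[of v] v by (simp add: code)
  qed
  then have "x ` ?S \<subseteq> {o\<^sub>c u..<o\<^sub>c w}" by blast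
  then have "card (x ` ?S) \<le> card {o\<^sub>c u..<o\<^sub>c w}" by (intro card_mono) auto
  moreover have "card (x ` ?S) = card ?S"
    by (rule card_image, rule inj_on_subset[OF bij_betw_imp_inj_on[OF bij_x] Collect_restrict])
  ultimately show ?thesis using lt by (simp add: comp_size_def)
qed

lemma comp_size_bounds:
  assumes u: "u \<in> {1..n}"
  shows "0 < comp_size n c u" "comp_size n c u \<le> n" "local_rank n c b u \<le> 2 * comp_size n c u"
proof -
  let ?S = "{v \<in> {1..n}. o\<^sub>c v = o\<^sub>c u}"
  show "0 < comp_size n c u" using position_in_comp[OF u] by simp
  have "card ?S \<le> card {1..n}" by (intro card_mono) auto
  then show "comp_size n c u \<le> n" by (simp add: comp_size_def)
  have "card {v \<in> {1..n}. o\<^sub>c v = o\<^sub>c u \<and> beats n c (c b u) (c d v)} \<le> card ?S" for d by (intro card_mono) auto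
  from this[of False] this[of True] show "local_rank n c b u \<le> 2 * comp_size n c u"
    by (simp add: local_rank_def comp_size_def)
qed

subsection \<open>Distances from levels and phases\<close>

text \<open>The number of hops, as bounded below by levels and phases, from one end of
  \<open>u\<close> to strictly beyond one end of \<open>w\<close>. It is an integer since the end on
  the other line may have been passed from the start.\<close>

definition steps :: "nat \<Rightarrow> nat \<Rightarrow> bool \<Rightarrow> bool \<Rightarrow> int" where
  "steps u w b b' = int (lev (c b' w)) - int (lev (c b u)) + (if beats n c (c b u) (c b' w) then 0 else 2)"

lemma steps_parity: "u \<in> {1..n} \<Longrightarrow> w \<in> {1..n} \<Longrightarrow> even (steps u w b b') \<longleftrightarrow> b = b'"
  using level_parity[OF code_less, of u b] level_parity[OF code_less, of w b'] by (auto simp: steps_def code_parity)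

lemma reach_iff_steps:
  assumes u: "u \<in> {1..n}" and w: "w \<in> {1..n}"
  shows "c b' w < reach u k b' \<longleftrightarrow> steps u w (b' \<noteq> odd k) b' \<le> int k"
proof -
  let ?b = "b' \<noteq> odd k"
  have "even (c ?b u + k) \<longleftrightarrow> even (c b' w)" by (auto simp: code_parity)
  from hops_greater_iff[OF code_less[OF u] code_less[OF w] this]
  have "c b' w < reach u k b' \<longleftrightarrow>
    lev (c b' w) < lev (c ?b u) + k \<or> lev (c b' w) = lev (c ?b u) + k \<and> beats n c (c ?b u) (c b' w)"
    by (simp only: reach_def)
  \<comment> \<open>Where \<open>beats\<close> fails, a level difference below \<open>k\<close> only
    bounds \<open>steps\<close> by \<open>k + 1\<close>; parity removes this value.\<close>
  moreover have "steps u w ?b b' \<noteq> int k + 1"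
    using steps_parity[OF u w, of ?b b'] by (cases "odd k") (auto simp del: of_nat_Suc)
  ultimately show ?thesis by (auto simp: steps_def split: if_splits)
qed

text \<open>Zero hops never pass \<open>w\<close>, as \<open>u\<close> is on its left; hence
  \<open>max 1\<close>. A nonpositive \<open>m\<close> can only come from ends on different lines,
  so it is odd, and a single hop between these lines suffices.\<close>

lemma graph_dist_dominated:
  assumes u: "u \<in> {1..n}" and w: "w \<in> {1..n}" and o: "o\<^sub>c u = o\<^sub>c w" and less: "\<And>b. c b u < c b w"
    and m: "m = Min {steps u w False False, steps u w False True, steps u w True False, steps u w True True}"
  shows "graph_dist E u w = enat (Suc (nat (max 1 m)))"
proof (rule graph_dist_eqI[OF u w o less])
  have ge: "m \<le> steps u w b b'" for b b' unfolding m by (cases b; cases b') (auto intro: Min_le)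
  have "m \<in> {steps u w False False, steps u w False True, steps u w True False, steps u w True True}"
    unfolding m by (rule Min_in) auto
  then obtain b b' where b: "steps u w b b' = m" by auto
  have no0: "\<not> steps u w b b \<le> 0" for b
    using reach_iff_steps[OF u w, of b 0] less[of b] by (auto simp: reach_0)
  have par: "even m \<longleftrightarrow> b = b'" using steps_parity[OF u w, of b b'] b by simp
  let ?k = "nat (max 1 m)"
  have "steps u w (b' \<noteq> odd ?k) b' \<le> int ?k"
  proof (cases "1 \<le> m")
    case True
    then have "odd ?k \<longleftrightarrow> b \<noteq> b'" using par by (auto simp: even_nat_iff)
    then have "(b' \<noteq> odd ?k) = b" by auto
    then show ?thesis using b True by simp
  next
    case False
    then have "b \<noteq> b'" using no0[of b] b by (cases b; cases b') simp_all
    then have "(b' \<noteq> odd ?k) = b" using False by auto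
    then show ?thesis using b False by simp
  qed
  then show "\<exists>b. c b w < reach u ?k b" using reach_iff_steps[OF u w] by blast
next
  fix j b assume j: "j < nat (max 1 m)"
  have ge: "m \<le> steps u w b b'" for b b' unfolding m by (cases b; cases b') (auto intro: Min_le)
  show "\<not> c b w < reach u j b"
  proof
    assume r: "c b w < reach u j b"
    then have "m \<le> int j" using reach_iff_steps[OF u w] ge order_trans by blast
    then have "j = 0" using j by simp
    then show False using r less[of b] by (simp add: reach_0)
  qed
qed

end

section \<open>Labels\<close>

text \<open>
  With \<open>2 ^ k \<le> comp_size n c u < 2 ^ (k + 1)\<close>, the \<open>block\<close> of \<open>u\<close> is \<open>2 ^ (k + 2)\<close>. The leading bit of a \<open>key\<close>
  reveals the block. Components have disjoint intervals of positions, so among components with the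
  same block, the \<open>place\<close> without its low \<open>k + 3\<close> bits identifies the component; the low bits hold a level.
\<close>

definition block :: "nat \<Rightarrow> (bool \<Rightarrow> nat \<Rightarrow> nat) \<Rightarrow> nat \<Rightarrow> nat" where
  "block n c u = 4 * iter (\<lambda>_ a. if 2 * a \<le> comp_size n c u then 2 * a else a) n 1"

definition key :: "nat \<Rightarrow> (bool \<Rightarrow> nat \<Rightarrow> nat) \<Rightarrow> bool \<Rightarrow> nat \<Rightarrow> nat" where
  "key n c b u = block n c u + local_rank n c b u"

definition place :: "nat \<Rightarrow> (bool \<Rightarrow> nat \<Rightarrow> nat) \<Rightarrow> nat \<Rightarrow> nat" where
  "place n c u = comp_start n c u div (block n c u div 4) * (2 * block n c u) +
     (level n c (c False u) - level n c (2 * comp_start n c u))"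

text \<open>The shift by 3 makes the difference nonnegative; by the symmetric bound it is at most 6
  and fits into 3 bits.\<close>

definition skew :: "nat \<Rightarrow> (bool \<Rightarrow> nat \<Rightarrow> nat) \<Rightarrow> nat \<Rightarrow> nat" where
  "skew n c u = level n c (c True u) + 3 - level n c (c False u)"

text \<open>The logarithm rounded up, plus 4: the factor 16 leaves room for keys below
  \<open>8 * n\<close> and places below \<open>12 * n\<close>.\<close>

definition field_width :: "nat \<Rightarrow> nat" where
  "field_width n = 4 + iter (\<lambda>_ a. if 2 ^ a < n then a + 1 else a) n 0"

definition label_value :: "nat \<Rightarrow> (bool \<Rightarrow> nat \<Rightarrow> nat) \<Rightarrow> nat \<Rightarrow> nat" where
  "label_value n c u = skew n c u + 8 * (key n c False u + 2 ^ field_width n *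
     (key n c True u + 2 ^ field_width n * place n c u))"

definition encode :: encoder where
  "encode n E u = map (bit (label_value n (seg_code n E) u)) [0..<3 * field_width n + 3]"

text \<open>Conjunction is below exclusive or exactly if the leading bits differ. If they agree,
  \<open>r\<close> lies between the block and its double and serves as a threshold: places of one
  component differ by less than the block in exclusive or, places of different components by at
  least its double.\<close>

definition connected_fields :: "nat \<Rightarrow> nat \<Rightarrow> nat \<Rightarrow> nat \<Rightarrow> bool" where
  "connected_fields r p r' p' \<longleftrightarrow>
     \<not> Bit_Operations.and r r' < Bit_Operations.xor r r' \<and> \<not> r < Bit_Operations.xor p p'"

text \<open>Levels are shifted by \<open>3\<close> and gaps by \<open>8\<close> to avoid negative numbers.\<close>

definition gap :: "nat \<Rightarrow> nat \<Rightarrow> nat \<Rightarrow> nat \<Rightarrow> nat" where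
  "gap l l' r r' = l' + 8 + (if r' < r then 0 else 2) - l"

text \<open>With the shift by 8 in \<open>m\<close>, this is one more than the maximum of 1 and
  \<open>m - 8\<close>.\<close>

definition dominated_dist :: "nat \<Rightarrow> nat \<Rightarrow> nat \<Rightarrow> nat \<Rightarrow> nat \<Rightarrow> nat \<Rightarrow> nat \<Rightarrow> nat \<Rightarrow> nat" where
  "dominated_dist l\<^sub>x l\<^sub>y r\<^sub>x r\<^sub>y l\<^sub>x' l\<^sub>y' r\<^sub>x' r\<^sub>y' =
     (let m = min (min (gap l\<^sub>x l\<^sub>x' r\<^sub>x r\<^sub>x') (gap l\<^sub>x l\<^sub>y' r\<^sub>x r\<^sub>y'))
                  (min (gap l\<^sub>y l\<^sub>x' r\<^sub>y r\<^sub>x') (gap l\<^sub>y l\<^sub>y' r\<^sub>y r\<^sub>y'))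
      in if m < 10 then 2 else m - 7)"

text \<open>The order of positions along one line, obtained from \<open>hops_greater_iff\<close>
  with zero hops.\<close>

definition before :: "nat \<Rightarrow> nat \<Rightarrow> nat \<Rightarrow> nat \<Rightarrow> bool" where
  "before l r l' r' \<longleftrightarrow> l < l' \<or> l = l' \<and> r < r'"

definition dist_fields :: "nat \<Rightarrow> nat \<Rightarrow> nat \<Rightarrow> nat \<Rightarrow> nat \<Rightarrow> nat \<Rightarrow> nat \<Rightarrow> nat \<Rightarrow> nat" where
  "dist_fields l\<^sub>x l\<^sub>y r\<^sub>x r\<^sub>y l\<^sub>x' l\<^sub>y' r\<^sub>x' r\<^sub>y' =
     (if before l\<^sub>x r\<^sub>x l\<^sub>x' r\<^sub>x' = before l\<^sub>y r\<^sub>y l\<^sub>y' r\<^sub>y' then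
        if before l\<^sub>x r\<^sub>x l\<^sub>x' r\<^sub>x' then dominated_dist l\<^sub>x l\<^sub>y r\<^sub>x r\<^sub>y l\<^sub>x' l\<^sub>y' r\<^sub>x' r\<^sub>y'
        else dominated_dist l\<^sub>x' l\<^sub>y' r\<^sub>x' r\<^sub>y' l\<^sub>x l\<^sub>y r\<^sub>x r\<^sub>y
      else 1)"

definition label_number :: "label \<Rightarrow> nat" where
  "label_number l = horner_sum of_bool 2 l"

definition decode_value :: "nat \<Rightarrow> nat \<Rightarrow> nat \<Rightarrow> enat" where
  "decode_value R V V' =
     (let d = V mod 8; r\<^sub>x = V div 8 mod R; r\<^sub>y = V div 8 div R mod R; p = V div 8 div R div R;
          d' = V' mod 8; r\<^sub>x' = V' div 8 mod R; r\<^sub>y' = V' div 8 div R mod R; p' = V' div 8 div R div R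
      in if connected_fields r\<^sub>x p r\<^sub>x' p'
         then enat (dist_fields (p + 3) (p + d) r\<^sub>x r\<^sub>y (p' + 3) (p' + d') r\<^sub>x' r\<^sub>y') else \<infinity>)"

text \<open>All that the decoder must know of \<open>n\<close> is the field width, and the label
  length \<open>3 * field_width n + 3\<close> reveals it.\<close>

definition decode :: decoder where
  "decode l l' = decode_value (2 ^ (length l div 3 - 1)) (label_number l) (label_number l')"

section \<open>Arithmetic of the label fields\<close>

lemma doubling_iter:
  assumes "1 \<le> s" "s \<le> n"
  obtains k where "iter (\<lambda>_ a. if 2 * a \<le> s then 2 * a else a) n 1 = 2 ^ k" "2 ^ k \<le> s" "s < 2 * 2 ^ k"
proof -
  let ?f = "\<lambda>a::nat. if 2 * a \<le> s then 2 * a else a"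
  have "\<exists>k. (?f ^^ t) 1 = 2 ^ k \<and> (2::nat) ^ k \<le> s \<and> (s < 2 * 2 ^ k \<or> k = t)" for t
  proof (induction t)
    case 0
    show ?case by (rule exI[of _ 0]) (use assms in auto)
  next
    case (Suc t)
    then obtain k where k: "(?f ^^ t) 1 = 2 ^ k" "(2::nat) ^ k \<le> s" "s < 2 * 2 ^ k \<or> k = t" by blast
    show ?case
    proof (cases "2 * 2 ^ k \<le> s")
      case True
      then show ?thesis using k by (intro exI[of _ "Suc k"]) auto
    next
      case False
      then show ?thesis using k by (intro exI[of _ k]) auto
    qed
  qed
  then obtain k where k: "(?f ^^ n) 1 = 2 ^ k" "(2::nat) ^ k \<le> s" "s < 2 * 2 ^ k \<or> k = n" by blast
  have "s < 2 * 2 ^ n" using assms(2) less_exp[of n] by linarith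
  then show ?thesis using that[of k] k by (auto simp: iter_funpow)
qed

lemma field_width_bounds:
  assumes "1 \<le> n"
  shows "16 * n \<le> 2 ^ field_width n" "2 ^ field_width n < 32 * n" "4 \<le> field_width n" "field_width n \<le> n + 4"
proof -
  let ?f = "\<lambda>a::nat. if 2 ^ a < n then a + 1 else a"
  have *: "(?f ^^ t) 0 \<le> t \<and> (2::nat) ^ (?f ^^ t) 0 < 2 * n \<and> (n \<le> 2 ^ (?f ^^ t) 0 \<or> (?f ^^ t) 0 = t)" for t
    using assms by (induction t) auto
  have w: "field_width n = 4 + (?f ^^ n) 0" by (simp add: field_width_def iter_funpow)
  have "n \<le> 2 ^ n" using less_exp[of n] by simp
  then show "16 * n \<le> 2 ^ field_width n" "2 ^ field_width n < 32 * n" "4 \<le> field_width n" "field_width n \<le> n + 4"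
    using *[of n] by (auto simp: w power_add)
qed

lemma less_power_iff: "a < 2 ^ e \<longleftrightarrow> drop_bit e a = (0 :: nat)"
  unfolding drop_bit_eq_div div_eq_0_iff by simp

lemma xor_less_power_iff: "Bit_Operations.xor a b < 2 ^ e \<longleftrightarrow> a div 2 ^ e = b div (2 ^ e :: nat)"
proof -
  have xor0: "Bit_Operations.xor m k = 0 \<longleftrightarrow> m = k" for m k :: nat
  proof
    assume "Bit_Operations.xor m k = 0"
    then have "bit m i = bit k i" for i using bit_xor_iff[of m k i] by simp
    then show "m = k" by (simp add: bit_eq_iff)
  qed simp
  show ?thesis unfolding less_power_iff drop_bit_xor xor0 unfolding drop_bit_eq_div ..
qed

text \<open>The highest bit present survives in the conjunction if both numbers have it, and in the
  exclusive or if only one has it.\<close>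

lemma and_less_xor_iff:
  assumes "(2::nat) ^ e \<le> a" "a < 2 * 2 ^ e" "2 ^ e' \<le> b" "b < 2 * 2 ^ e'"
  shows "Bit_Operations.and a b < Bit_Operations.xor a b \<longleftrightarrow> e \<noteq> e'"
proof -
  have diff: "Bit_Operations.and a b < Bit_Operations.xor a b"
    if "e < e'" "2 ^ e \<le> a" "a < 2 * 2 ^ e" "2 ^ e' \<le> b" "b < 2 * 2 ^ e'" for a b e e' :: nat
  proof -
    have "(2::nat) * 2 ^ e \<le> 2 ^ e'" using that(1) power_increasing[of "Suc e" e' "2::nat"] by simp
    then have "a < 2 ^ e'" using that by linarith
    moreover have "drop_bit e' a = 0" using \<open>a < 2 ^ e'\<close> by (simp add: less_power_iff)
    then have "drop_bit e' (Bit_Operations.and a b) = 0" by (simp add: drop_bit_and)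
    then have "Bit_Operations.and a b < 2 ^ e'" by (simp add: less_power_iff)
    moreover have "\<not> Bit_Operations.xor a b < 2 ^ e'"
      unfolding xor_less_power_iff using \<open>a < 2 ^ e'\<close> that(4) by (simp add: div_greater_zero_iff)
    ultimately show ?thesis by linarith
  qed
  show ?thesis
  proof (cases "e = e'")
    case True
    have "a div 2 ^ e = 1" "b div 2 ^ e = 1" using assms True by (auto intro!: div_nat_eqI)
    then have "Bit_Operations.xor a b < 2 ^ e" by (simp add: xor_less_power_iff)
    moreover have "drop_bit e a = 1" "drop_bit e b = 1"
      unfolding drop_bit_eq_div by fact+
    then have "drop_bit e (Bit_Operations.and a b) = 1" by (simp add: drop_bit_and)
    then have "2 ^ e \<le> Bit_Operations.and a b"
      using div_greater_zero_iff[of "Bit_Operations.and a b" "2 ^ e"] by (simp add: drop_bit_eq_div)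
    ultimately show ?thesis using True by simp
  next
    case False
    then show ?thesis using diff[of e e' a b] diff[of e' e b a] assms
      by (cases e e' rule: linorder_cases) (auto simp: and.commute xor.commute)
  qed
qed

context diagram
begin

lemma block_power:
  assumes "u \<in> {1..n}"
  obtains k where "block n c u = 4 * 2 ^ k" "2 ^ k \<le> comp_size n c u" "comp_size n c u < 2 * 2 ^ k"
proof -
  have "1 \<le> comp_size n c u" "comp_size n c u \<le> n" using comp_size_bounds[OF assms] by auto
  then obtain k where k: "iter (\<lambda>_ a. if 2 * a \<le> comp_size n c u then 2 * a else a) n 1 = 2 ^ k"
    "2 ^ k \<le> comp_size n c u" "comp_size n c u < 2 * 2 ^ k"
    by (rule doubling_iter)
  show ?thesis by (rule that[OF _ k(2,3)]) (simp only: block_def k(1))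
qed

lemma block_cong: "o\<^sub>c u = o\<^sub>c w \<Longrightarrow> block n c u = block n c w"
  by (simp add: block_def comp_size_def)

lemma key_bounds:
  assumes "u \<in> {1..n}"
  shows "block n c u \<le> key n c b u" "key n c b u < 2 * block n c u"
proof -
  obtain k where "block n c u = 4 * 2 ^ k" "2 ^ k \<le> comp_size n c u" "comp_size n c u < 2 * 2 ^ k"
    by (rule block_power[OF assms])
  then show "block n c u \<le> key n c b u" "key n c b u < 2 * block n c u"
    using comp_size_bounds(3)[OF assms, of b] by (auto simp: key_def)
qed

lemma level_offset:
  assumes u: "u \<in> {1..n}"
  shows "lev (2 * o\<^sub>c u) \<le> lev (c False u)" "lev (c False u) - lev (2 * o\<^sub>c u) < block n c u"
proof -
  have le: "o\<^sub>c u \<le> x u" using comp_start_le[of u] by (simp add: code)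
  have "2 * o\<^sub>c u + 2 * (x u - o\<^sub>c u) = c False u" using le by (simp add: code)
  then have "lev (c False u) \<le> lev (2 * o\<^sub>c u) + 2 * (x u - o\<^sub>c u)"
    using level_add[of "2 * o\<^sub>c u" "x u - o\<^sub>c u"] code_less[OF u, of False] by simp
  moreover obtain k where "block n c u = 4 * 2 ^ k" "comp_size n c u < 2 * 2 ^ k"
    by (rule block_power[OF u])
  ultimately show "lev (c False u) - lev (2 * o\<^sub>c u) < block n c u" using position_in_comp[OF u] by linarith
  show "lev (2 * o\<^sub>c u) \<le> lev (c False u)"
    by (rule level_mono) (use code_less[OF u, of False] comp_start_le[of u] in \<open>auto simp: code\<close>)
qed

lemma skew_props:
  assumes u: "u \<in> {1..n}"
  shows "skew n c u < 8" "skew n c u + lev (c False u) = lev (c True u) + 3"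
  using level_other_line[OF u, of False] level_other_line[OF u, of True] by (auto simp: skew_def)

lemma key_less: "u \<in> {1..n} \<Longrightarrow> key n c b u < 2 ^ field_width n"
proof -
  assume u: "u \<in> {1..n}"
  obtain k where "block n c u = 4 * 2 ^ k" "2 ^ k \<le> comp_size n c u" by (rule block_power[OF u])
  then show ?thesis using key_bounds(2)[OF u, of b] comp_size_bounds(2)[OF u] field_width_bounds(1)[of n] u by auto
qed

lemma place_less: "u \<in> {1..n} \<Longrightarrow> place n c u < 2 ^ field_width n"
proof -
  assume u: "u \<in> {1..n}"
  obtain k where k: "block n c u = 4 * 2 ^ k" "2 ^ k \<le> comp_size n c u" by (rule block_power[OF u])
  have "o\<^sub>c u < n" using comp_start_le[of u] x_less[OF u] by (simp add: code)
  moreover have "o\<^sub>c u div 2 ^ k * (8 * 2 ^ k) \<le> 8 * o\<^sub>c u"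
    using div_times_less_eq_dividend[of "o\<^sub>c u" "2 ^ k"] by simp
  moreover have "place n c u = o\<^sub>c u div 2 ^ k * (8 * 2 ^ k) + (lev (c False u) - lev (2 * o\<^sub>c u))"
    by (simp add: place_def k(1))
  moreover have "16 * n \<le> 2 ^ field_width n" using field_width_bounds(1)[of n] u by simp
  ultimately show ?thesis
    using level_offset(2)[OF u] comp_size_bounds(2)[OF u] k by linarith
qed

lemma connected_fields_iff:
  assumes u: "u \<in> {1..n}" and w: "w \<in> {1..n}"
  shows "connected_fields (key n c False u) (place n c u) (key n c False w) (place n c w) \<longleftrightarrow> o\<^sub>c u = o\<^sub>c w"
proof -
  obtain k where k: "block n c u = 4 * 2 ^ k" "2 ^ k \<le> comp_size n c u" "comp_size n c u < 2 * 2 ^ k"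
    by (rule block_power[OF u])
  obtain k' where k': "block n c w = 4 * 2 ^ k'" "2 ^ k' \<le> comp_size n c w" "comp_size n c w < 2 * 2 ^ k'"
    by (rule block_power[OF w])
  have p4: "4 * 2 ^ i = (2::nat) ^ (i + 2)" for i by (simp add: power_add)
  have divI: "a div m = q" if "a = r + m * q" "r < m" for a m q r :: nat
    using that by simp
  have keys: "Bit_Operations.and (key n c False u) (key n c False w) <
      Bit_Operations.xor (key n c False u) (key n c False w) \<longleftrightarrow> k + 2 \<noteq> k' + 2"
    using key_bounds[OF u, of False] key_bounds[OF w, of False] unfolding k(1) k'(1) p4
    by (intro and_less_xor_iff)
  show ?thesis
  proof (cases "o\<^sub>c u = o\<^sub>c w")
    case True
    then have kk: "k = k'" using block_cong[OF True] k(1) k'(1) by simp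
    \<comment> \<open>The level offset is below the block \<open>2 ^ (k + 2)\<close>, so bit
      \<open>k + 2\<close> of a place is zero and all higher bits depend on the component
      only.\<close>
    have pl: "place n c v div 2 ^ (k + 2) = 2 * (o\<^sub>c v div 2 ^ k)"
      if "block n c v = 4 * 2 ^ k" "lev (c False v) - lev (2 * o\<^sub>c v) < block n c v" for v
      by (rule divI[where r="lev (c False v) - lev (2 * o\<^sub>c v)"]) (use that in \<open>simp_all add: place_def power_add\<close>)
    have "place n c u div 2 ^ (k + 2) = place n c w div 2 ^ (k + 2)"
      using pl[of u] pl[of w] k k' kk level_offset(2)[OF u] level_offset(2)[OF w] True by simp
    then have "Bit_Operations.xor (place n c u) (place n c w) < 4 * 2 ^ k"
      unfolding xor_less_power_iff[symmetric] by (simp add: power_add)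
    then show ?thesis using keys kk True key_bounds(1)[OF u, of False] k(1) by (simp add: connected_fields_def)
  next
    case ne: False
    have "\<not> connected_fields (key n c False u) (place n c u) (key n c False w) (place n c w)"
    proof (cases "k = k'")
      case False
      then show ?thesis using keys by (simp add: connected_fields_def)
    next
      case kk: True
      have p8: "8 * 2 ^ k = (2::nat) ^ (k + 3)" by (simp add: power_add)
      have pl: "place n c v div 2 ^ (k + 3) = o\<^sub>c v div 2 ^ k"
        if "block n c v = 4 * 2 ^ k" "lev (c False v) - lev (2 * o\<^sub>c v) < block n c v" for v
        by (rule divI[where r="lev (c False v) - lev (2 * o\<^sub>c v)"]) (use that in \<open>simp_all add: place_def power_add\<close>)
      \<comment> \<open>The starts of two components are apart by at least the size of the earlier
        one, which is at least \<open>2 ^ k\<close>.\<close>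
      have sep: "a div 2 ^ k \<noteq> b div 2 ^ k" if "a + 2 ^ k \<le> b" for a b :: nat
        using that div_le_mono[of "a + 2 ^ k" b "2 ^ k"] by simp
      have "o\<^sub>c u div 2 ^ k \<noteq> o\<^sub>c w div 2 ^ k"
      proof (cases "o\<^sub>c u < o\<^sub>c w")
        case True
        then show ?thesis using comp_size_le_gap[OF u True] k(2) by (intro sep) simp
      next
        case False
        then have "o\<^sub>c w < o\<^sub>c u" using ne by simp
        then show ?thesis using comp_size_le_gap[OF w] k'(2) kk by (intro not_sym[OF sep]) fastforce
      qed
      then have "\<not> Bit_Operations.xor (place n c u) (place n c w) < 8 * 2 ^ k"
        unfolding p8 xor_less_power_iff
        using pl[of u] pl[of w] k k' kk level_offset(2)[OF u] level_offset(2)[OF w] by simp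
      then show ?thesis using key_bounds(2)[OF u, of False] k(1) by (simp add: connected_fields_def)
    qed
    then show ?thesis using ne by simp
  qed
qed

lemma code_less_iff:
  assumes u: "u \<in> {1..n}" and w: "w \<in> {1..n}" and o: "o\<^sub>c u = o\<^sub>c w" and ne: "u \<noteq> w"
    and l: "l = a + lev (c b u)" "l' = a + lev (c b w)"
  shows "before l (key n c b u) l' (key n c b w) \<longleftrightarrow> c b u < c b w"
proof -
  have n': "c b w \<noteq> c b u" using code_inj[OF u w] ne by metis
  have "c b u < c b w \<longleftrightarrow> lev (c b u) < lev (c b w) \<or> lev (c b u) = lev (c b w) \<and> beats n c (c b w) (c b u)"
    using hops_greater_iff[OF code_less[OF w] code_less[OF u], of b 0 b] by (simp add: code_parity)
  also have "beats n c (c b w) (c b u) \<longleftrightarrow> key n c b u < key n c b w"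
    using local_rank_less[OF w u o[symmetric] n'] block_cong[OF o] by (simp add: key_def)
  finally show ?thesis by (auto simp: before_def l)
qed

lemma gap_steps:
  assumes u: "u \<in> {1..n}" and w: "w \<in> {1..n}" and o: "o\<^sub>c u = o\<^sub>c w" and ne: "u \<noteq> w"
    and l: "l = a + lev (c b u)" "l' = a + lev (c b' w)" and ge: "- 8 \<le> steps u w b b'"
  shows "int (gap l l' (key n c b u) (key n c b' w)) = steps u w b b' + 8"
proof -
  have n': "c b u \<noteq> c b' w"
  proof
    assume e: "c b u = c b' w"
    then have "b = b'" using code_parity[of b u] code_parity[of b' w] by simp
    then show False using e ne code_inj[OF u w, of b] by simp
  qed
  have "beats n c (c b u) (c b' w) \<longleftrightarrow> key n c b' w < key n c b u"
    using local_rank_less[OF u w o n'] block_cong[OF o] by (simp add: key_def)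
  then show ?thesis using ge unfolding gap_def steps_def l by auto
qed

lemma dominated_dist_correct:
  assumes u: "u \<in> {1..n}" and w: "w \<in> {1..n}" and o: "o\<^sub>c u = o\<^sub>c w" and less: "\<And>b. c b u < c b w"
    and l: "\<And>b. l b = a + lev (c b u)" "\<And>b. l' b = a + lev (c b w)"
  shows "graph_dist E u w = enat (dominated_dist (l False) (l True) (key n c False u) (key n c True u)
     (l' False) (l' True) (key n c False w) (key n c True w))"
proof -
  have ne: "u \<noteq> w" using less by blast
  have mono: "lev (c b u) \<le> lev (c b w)" for b
    by (rule level_mono[OF code_less[OF w]]) (use less[of b] in \<open>simp_all add: code_parity\<close>)
  \<comment> \<open>On each line the level of \<open>w\<close> is at least that of \<open>u\<close>,
    and the two ends of \<open>u\<close> differ by at most 3 in level. So the shift by 8 prevents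
    truncation.\<close>
  have "- 8 \<le> steps u w b b'" for b b'
    using mono[of b'] mono[of b] level_other_line[OF u, of b'] level_other_line[OF u, of "\<not> b"] level_other_line[OF u, of b]
    by (cases b; cases b') (auto simp: steps_def)
  note g = gap_steps[OF u w o ne l this]
  define g' where "g' b b' = gap (l b) (l' b') (key n c b u) (key n c b' w)" for b b'
  have g': "steps u w b b' = int (g' b b') - 8" for b b' using g[of b b'] by (simp add: g'_def)
  let ?m = "min (min (g' False False) (g' False True)) (min (g' True False) (g' True True))"
  have "int ?m - 8 = Min {steps u w False False, steps u w False True, steps u w True False, steps u w True True}"
    by (simp add: g')
  from graph_dist_dominated[OF u w o less this]
  have "graph_dist E u w = enat (Suc (nat (max 1 (int ?m - 8))))" .
  also have "Suc (nat (max 1 (int k - 8))) = (if k < 10 then 2 else k - 7)" for k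
  proof (cases "k < 10")
    case True
    then have "max 1 (int k - 8) = 1" by simp
    then show ?thesis using True by simp
  next
    case False
    then have "max 1 (int k - 8) = int (k - 8)" by simp
    then show ?thesis using False by simp
  qed
  finally show ?thesis by (simp add: dominated_dist_def Let_def g'_def)
qed

lemma dist_fields_correct:
  assumes u: "u \<in> {1..n}" and w: "w \<in> {1..n}" and o: "o\<^sub>c u = o\<^sub>c w" and ne: "u \<noteq> w"
  shows "graph_dist E u w = enat (dist_fields
     (place n c u + 3) (place n c u + skew n c u) (key n c False u) (key n c True u)
     (place n c w + 3) (place n c w + skew n c w) (key n c False w) (key n c True w))"
proof -
  define a where "a = o\<^sub>c u div (block n c u div 4) * (2 * block n c u) + 3"
  define l where "l b v = place n c v + (if b then skew n c v else 3)" for b v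
  text \<open>\<open>l b v\<close> exceeds the level of \<open>c b v\<close> by a possibly negative constant of the component.\<close>
  let ?t = "lev (2 * o\<^sub>c u)"
  have l: "l b v + ?t = a + lev (c b v)" if "v \<in> {1..n}" "o\<^sub>c v = o\<^sub>c u" for b v
    using skew_props(2)[OF that(1)] level_offset(1)[OF that(1)] that(2) block_cong[OF that(2)]
    by (auto simp: l_def place_def a_def)
  \<comment> \<open>Only differences and comparisons of levels enter, so the constant missing in the
    label can be added to all levels.\<close>
  have "gap (l1 + t) (l2 + t) r1 r2 = gap l1 l2 r1 r2" for l1 l2 r1 r2 t
    by (simp add: gap_def)
  then have shift: "dominated_dist l1 l2 r1 r2 l3 l4 r3 r4 = dominated_dist (l1 + t) (l2 + t) r1 r2 (l3 + t) (l4 + t) r3 r4"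
    for l1 l2 r1 r2 l3 l4 r3 r4 t
    by (simp only: dominated_dist_def)
  have shift_before: "before l1 r1 l2 r2 \<longleftrightarrow> before (l1 + t) r1 (l2 + t) r2" for l1 r1 l2 r2 t
    by (simp add: before_def)
  have bef: "before (l b u) (key n c b u) (l b w) (key n c b w) \<longleftrightarrow> c b u < c b w" for b
    unfolding shift_before[of "l b u" _ _ _ ?t]
    by (rule code_less_iff[OF u w o ne]) (use l[OF u] l[OF w] o in auto)
  have dom: "graph_dist E u' w' = enat (dominated_dist (l False u') (l True u') (key n c False u') (key n c True u')
     (l False w') (l True w') (key n c False w') (key n c True w'))"
    if "u' \<in> {1..n}" "w' \<in> {1..n}" "o\<^sub>c u' = o\<^sub>c u" "o\<^sub>c w' = o\<^sub>c u" "\<And>b. c b u' < c b w'" for u' w'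
    unfolding shift[of "l False u'" _ _ _ _ _ _ _ ?t]
    by (rule dominated_dist_correct[where a=a and l="\<lambda>b. l b u' + ?t" and l'="\<lambda>b. l b w' + ?t"])
      (use that l in auto)
  note bF = bef[of False, unfolded l_def, simplified] and bT = bef[of True, unfolded l_def, simplified]
  have cne: "c b u \<noteq> c b w" for b using code_inj[OF u w] ne by blast
  show ?thesis
  proof (cases "c False u < c False w \<longleftrightarrow> c True u < c True w")
    case True
    show ?thesis
    proof (cases "c False u < c False w")
      case less: True
      have "c b u < c b w" for b using True less by (cases b) auto
      then show ?thesis using dom[OF u w refl o[symmetric]] True less unfolding dist_fields_def bF bT by (simp add: l_def)
    next
      case False
      have "c b w < c b u" for b using True False cne[of b] by (cases b) auto
      then show ?thesis using dom[OF w u o[symmetric] refl] True False graph_dist_commute[of u w]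
        unfolding dist_fields_def bF bT by (simp add: l_def)
    qed
  next
    case False
    then have "(u, w) \<in> E" unfolding edge_iff using u w by (simp add: code)
    then have "graph_dist E u w = enat 1" using graph_dist_adjacent by (simp add: one_enat_def)
    then show ?thesis using False unfolding dist_fields_def bF bT by simp
  qed
qed

lemma decode_value_correct:
  assumes u: "u \<in> {1..n}" and w: "w \<in> {1..n}" and ne: "u \<noteq> w"
  shows "decode_value (2 ^ field_width n) (label_value n c u) (label_value n c w) = graph_dist E u w"
proof -
  let ?R = "2 ^ field_width n :: nat"
  have f: "label_value n c v mod 8 = skew n c v" "label_value n c v div 8 mod ?R = key n c False v"
    "label_value n c v div 8 div ?R mod ?R = key n c True v" "label_value n c v div 8 div ?R div ?R = place n c v"
    if "v \<in> {1..n}" for v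
  proof -
    have digit: "(r + m * q) mod m = r" "(r + m * q) div m = q" if "r < m" for r m q :: nat
      using that by simp_all
    note * = digit[OF skew_props(1)[OF that]] digit[OF key_less[OF that]]
    show "label_value n c v mod 8 = skew n c v" "label_value n c v div 8 mod ?R = key n c False v"
      "label_value n c v div 8 div ?R mod ?R = key n c True v" "label_value n c v div 8 div ?R div ?R = place n c v"
      unfolding label_value_def * by (rule refl)+
  qed
  show ?thesis
    unfolding decode_value_def Let_def f[OF u] f[OF w] connected_fields_iff[OF u w]
    using dist_fields_correct[OF u w _ ne] graph_dist_infinite by simp
qed

lemma label_value_less:
  assumes u: "u \<in> {1..n}"
  shows "label_value n c u < 2 ^ (3 * field_width n + 3)"
proof -
  let ?R = "2 ^ field_width n :: nat"
  have step: "a + b * q < b * r" if "a < b" "q < r" for a b q r :: nat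
  proof -
    have "a + b * q < b * Suc q" using that by simp
    also have "\<dots> \<le> b * r" using that by (intro mult_le_mono2) simp
    finally show ?thesis .
  qed
  have "label_value n c u < 8 * (?R * (?R * ?R))"
    unfolding label_value_def
    by (intro step skew_props(1)[OF u] key_less[OF u] place_less[OF u])
  also have "\<dots> = 2 ^ (3 * field_width n + 3)"
    by (simp only: power_add mult.commute[of 3 "field_width n"] power_mult) (simp add: power3_eq_cube)
  finally show ?thesis .
qed

end

section \<open>Correctness and size of the scheme\<close>

lemma label_number_encode:
  assumes "permutation_graph n E" "u \<in> {1..n}"
  shows "label_number (encode n E u) = label_value n (seg_code n E) u"
proof -
  obtain x y where "diagram n E x y (seg_code n E)" using seg_code_diagram[OF assms(1)] by blast
  then interpret diagram n E x y "seg_code n E" .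
  have "label_number (encode n E u) = take_bit (3 * field_width n + 3) (label_value n (seg_code n E) u)"
    by (simp add: label_number_def encode_def horner_sum_bit_eq_take_bit)
  also have "\<dots> = label_value n (seg_code n E) u"
    using label_value_less[OF assms(2)] by (simp add: take_bit_nat_eq_self)
  finally show ?thesis .
qed

theorem encode_decode: "distance_labeling_scheme permutation_graph encode decode"
  unfolding distance_labeling_scheme_def
proof (intro allI impI ballI)
  fix n E u w assume g: "permutation_graph n E" and uw: "u \<in> {1..n}" "w \<in> {1..n}" "u \<noteq> w"
  obtain x y where "diagram n E x y (seg_code n E)" using seg_code_diagram[OF g] by blast
  then interpret diagram n E x y "seg_code n E" .
  have "length (encode n E u) div 3 - 1 = field_width n" by (simp add: encode_def)
  then show "decode (encode n E u) (encode n E w) = graph_dist E u w"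
    unfolding decode_def label_number_encode[OF g uw(1)] label_number_encode[OF g uw(2)]
    using decode_value_correct[OF uw] by simp
qed

lemma permutation_graph_empty: "permutation_graph n {}"
proof -
  have "inversion_graph n id = {}" by (auto simp: inversion_graph_def)
  then have "graph_isomorphic n {} (inversion_graph n id)"
    unfolding graph_isomorphic_def by (intro exI[of _ id]) auto
  then show ?thesis
    unfolding permutation_graph_def graph_def by (auto simp: sym_def irrefl_def intro!: exI[of _ id] permutes_id)
qed

text \<open>All labels for a given \<open>n\<close> have the same length; the edgeless graph shows
  that the maximum is over a nonempty set.\<close>

lemma scheme_size_encode:
  assumes "1 \<le> n"
  shows "scheme_size permutation_graph encode n = 3 * field_width n + 3"
proof -
  have "{length (encode n E u) | E u. permutation_graph n E \<and> u \<in> {1..n}} = {3 * field_width n + 3}"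
    using permutation_graph_empty[of n] assms by (force simp: encode_def)
  then show ?thesis unfolding scheme_size_def by simp
qed

lemma log_field_width:
  assumes "1 \<le> n"
  shows "real (field_width n) \<le> log 2 (real n) + 5"
proof -
  have "real (2 ^ field_width n) \<le> real (32 * n)"
    using field_width_bounds(2)[OF assms] by (intro of_nat_mono) simp
  then have "log 2 (2 ^ field_width n) \<le> log 2 (32 * real n)"
    using assms by (subst log_le_cancel_iff) auto
  also have "\<dots> = log 2 (2 ^ 5) + log 2 (real n)" using assms by (subst log_mult) auto
  also have "log 2 (2 ^ 5 :: real) = 5" by (subst log_pow_cancel) auto
  also have "log 2 (2 ^ field_width n :: real) = field_width n" by (subst log_pow_cancel) auto
  finally show ?thesis by simp
qed

text \<open>The iterated logarithm is at least 1 from \<open>n = 4\<close> on, so it absorbs every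
  constant.\<close>

lemma const_bigo_log_log: "(\<lambda>_. 18) \<in> O(\<lambda>n. log 2 (log 2 (real n)))"
proof (rule bigoI[where c=18])
  show "\<forall>\<^sub>F n in sequentially. norm (18::real) \<le> 18 * norm (log 2 (log 2 (real n)))"
  proof (rule eventually_sequentiallyI[of 4])
    fix n :: nat assume "4 \<le> n"
    then have "log 2 4 \<le> log 2 (real n)" by simp
    moreover have "log 2 4 = (2::real)" using log_nat_power[of 2 2 2] by simp
    ultimately have "log 2 2 \<le> log 2 (log 2 (real n))" by (subst log_le_cancel_iff) auto
    then show "norm (18::real) \<le> 18 * norm (log 2 (log 2 (real n)))" by simp
  qed
qed

section \<open>A language of bounded loops on the word RAM\<close>

text \<open>
  Variables are registers, and register \<open>0\<close> holds the bound \<open>n\<close> of all loops. \<open>EIter c i a b\<close> iterates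
  \<open>b\<close> for \<open>c * n\<close> times from the value of \<open>a\<close>, with the counter in variable \<open>i\<close> and the accumulator in
  variable \<open>i + 1\<close>. Registers from \<open>scratch\<close> on hold intermediate results.
\<close>

datatype exp =
    EVar nat
  | ENum nat
  | EOp binop exp exp
  | EMem exp
  | ECond exp exp exp
  | EIter nat nat exp exp
  | ELet nat exp exp

primrec ev :: "nat \<Rightarrow> exp \<Rightarrow> (nat \<Rightarrow> nat) \<Rightarrow> (nat \<Rightarrow> nat) \<Rightarrow> nat" where
  "ev w (EVar v) env m = env v"
| "ev w (ENum k) env m = k mod 2 ^ w"
| "ev w (EOp f a b) env m = binop_val w f (ev w a env m) (ev w b env m)"
| "ev w (EMem a) env m = m (ev w a env m)"
| "ev w (ECond c a b) env m = (if ev w c env m \<noteq> 0 then ev w a env m else ev w b env m)"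
| "ev w (EIter c i a b) env m =
     iter (\<lambda>k acc. ev w b (env(i := k, Suc i := acc)) m) (c * env 0) (ev w a env m)"
| "ev w (ELet i a b) env m = ev w b (env(i := ev w a env m)) m"

definition scratch :: nat where
  "scratch = 40"

text \<open>\<open>L\<close> is the set of live variables. Binders must take fresh registers below
  \<open>scratch\<close>, so inner code cannot overwrite an enclosing counter or
  accumulator.\<close>

primrec ok :: "nat set \<Rightarrow> exp \<Rightarrow> bool" where
  "ok L (EVar v) \<longleftrightarrow> v \<in> L"
| "ok L (ENum k) \<longleftrightarrow> True"
| "ok L (EOp f a b) \<longleftrightarrow> ok L a \<and> ok L b"
| "ok L (EMem a) \<longleftrightarrow> ok L a"
| "ok L (ECond c a b) \<longleftrightarrow> ok L c \<and> ok L a \<and> ok L b"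
| "ok L (EIter c i a b) \<longleftrightarrow> i \<notin> L \<and> Suc i \<notin> L \<and> Suc i < scratch \<and> ok L a \<and> ok (insert i (insert (Suc i) L)) b"
| "ok L (ELet i a b) \<longleftrightarrow> i \<notin> L \<and> i < scratch \<and> ok L a \<and> ok (insert i L) b"

text \<open>\<open>N\<close> bounds the coefficients of all loop bounds, so that
  \<open>N * n < 2 ^ w\<close> lets every counter fit into a word.\<close>

primrec fits :: "nat \<Rightarrow> exp \<Rightarrow> bool" where
  "fits N (EVar v) \<longleftrightarrow> True"
| "fits N (ENum k) \<longleftrightarrow> True"
| "fits N (EOp f a b) \<longleftrightarrow> fits N a \<and> fits N b"
| "fits N (EMem a) \<longleftrightarrow> fits N a"
| "fits N (ECond c a b) \<longleftrightarrow> fits N c \<and> fits N a \<and> fits N b"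
| "fits N (EIter c i a b) \<longleftrightarrow> c \<le> N \<and> fits N a \<and> fits N b"
| "fits N (ELet i a b) \<longleftrightarrow> fits N a \<and> fits N b"

text \<open>Both branches of a conditional are charged. The bound thus depends on \<open>n\<close>
  and the expression alone and is visibly polynomial.\<close>

primrec cost :: "nat \<Rightarrow> exp \<Rightarrow> nat" where
  "cost n (EVar v) = 1"
| "cost n (ENum k) = 1"
| "cost n (EOp f a b) = cost n a + cost n b + 1"
| "cost n (EMem a) = cost n a + 1"
| "cost n (ECond c a b) = cost n c + cost n a + cost n b + 1"
| "cost n (EIter c i a b) = cost n a + c * n * (cost n b + 4) + 5"
| "cost n (ELet i a b) = cost n a + cost n b + 1"

text \<open>The result goes to register \<open>d\<close>, and registers from \<open>d\<close> on
  serve as a stack. \<open>Or\<close> of a register with itself is a copy.\<close>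

primrec cexp :: "nat \<Rightarrow> exp \<Rightarrow> program" where
  "cexp d (EVar v) = Op d Or v v"
| "cexp d (ENum k) = Const d k"
| "cexp d (EOp f a b) = Seq (cexp d a) (Seq (cexp (Suc d) b) (Op d f d (Suc d)))"
| "cexp d (EMem a) = Seq (cexp d a) (Load d d)"
| "cexp d (ECond c a b) = Seq (cexp d c) (Cond d (cexp d a) (cexp d b))"
| "cexp d (EIter c i a b) = Seq (cexp d a) (Seq (Op (Suc i) Or d d) (Seq (Const i c) (Seq (Op i Mul i 0)
     (Seq (While i (Seq (cexp d b) (Seq (Op (Suc i) Or d d) (Seq (Const d 1) (Op i Sub i d)))))
       (Op d Or (Suc i) (Suc i))))))"
| "cexp d (ELet i a b) = Seq (cexp d a) (Seq (Op i Or d d) (cexp d b))"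

lemma ev_cong:
  "ok L e \<Longrightarrow> 0 \<in> L \<Longrightarrow> (\<And>r. r \<in> L \<Longrightarrow> env r = env' r) \<Longrightarrow> ev w e env m = ev w e env' m"
proof (induction e arbitrary: L env env')
  case (EIter c i a b)
  have "ev w a env m = ev w a env' m" by (rule EIter.IH(1)[of L]) (use EIter.prems in simp_all)
  moreover have "ev w b (env(i := k, Suc i := acc)) m = ev w b (env'(i := k, Suc i := acc)) m" for k acc
    by (rule EIter.IH(2)[of "insert i (insert (Suc i) L)"]) (use EIter.prems in auto)
  moreover have "env 0 = env' 0" using EIter.prems by blast
  ultimately show ?case by simp
next
  case (ELet i a b)
  have a: "ev w a env m = ev w a env' m" by (rule ELet.IH(1)[of L]) (use ELet.prems in simp_all)
  have "ev w b (env(i := k)) m = ev w b (env'(i := k)) m" for k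
    by (rule ELet.IH(2)[of "insert i L"]) (use ELet.prems in auto)
  then show ?case using a by simp
next
  case (EOp f a b)
  have "ev w a env m = ev w a env' m" by (rule EOp.IH(1)[of L]) (use EOp.prems in simp_all)
  moreover have "ev w b env m = ev w b env' m" by (rule EOp.IH(2)[of L]) (use EOp.prems in simp_all)
  ultimately show ?case by simp
next
  case (EMem a)
  have "ev w a env m = ev w a env' m" by (rule EMem.IH[of L]) (use EMem.prems in simp_all)
  then show ?case by simp
next
  case (ECond c a b)
  have "ev w c env m = ev w c env' m" by (rule ECond.IH(1)[of L]) (use ECond.prems in simp_all)
  moreover have "ev w a env m = ev w a env' m" by (rule ECond.IH(2)[of L]) (use ECond.prems in simp_all)
  moreover have "ev w b env m = ev w b env' m" by (rule ECond.IH(3)[of L]) (use ECond.prems in simp_all)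
  ultimately show ?case by simp
qed simp_all

text \<open>\<open>g\<close> is the observed part of the state: the accumulator register for
  expressions, the whole memory for commands.\<close>

lemma runs_loop:
  assumes "\<And>s k. reg s i = Suc k \<Longrightarrow> I s \<Longrightarrow>
      \<exists>t s'. runs w P s t s' \<and> t \<le> T \<and> reg s' i = k \<and> I s' \<and> g s' = f (Suc k) (g s)"
    and "reg s i = k" "I s"
  shows "\<exists>t s'. runs w (While i P) s t s' \<and> t \<le> k * (T + 1) + 1 \<and> I s' \<and> g s' = iter f k (g s)"
  using assms(2,3)
proof (induction k arbitrary: s)
  case 0
  then show ?case using runs.While_False[of s i w P] by (intro exI[of _ 1] exI[of _ s]) auto
next
  case (Suc k)
  obtain t s' where t: "runs w P s t s'" "t \<le> T" "reg s' i = k" "I s'" "g s' = f (Suc k) (g s)"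
    using assms(1)[OF Suc.prems] by blast
  obtain t' s'' where t': "runs w (While i P) s' t' s''" "t' \<le> k * (T + 1) + 1" "I s''" "g s'' = iter f k (g s')"
    using Suc.IH[OF t(3,4)] by blast
  have "runs w (While i P) s (Suc (t + t')) s''"
    by (rule runs.While_True[OF _ t(1) t'(1)]) (use Suc.prems in simp)
  moreover have "Suc (t + t') \<le> Suc k * (T + 1) + 1" using t(2) t'(2) by simp
  moreover have "g s'' = iter f (Suc k) (g s)" using t(5) t'(4) by simp
  ultimately show ?case using t'(3) by blast
qed

lemma binop_val_dec: "0 < x \<Longrightarrow> x < 2 ^ w \<Longrightarrow> binop_val w Sub x 1 = x - 1"
proof -
  assume x: "0 < x" "x < 2 ^ w"
  then have "x + 2 ^ w - 1 = (x - 1) + 2 ^ w" by simp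
  then have "(x + 2 ^ w - 1) mod 2 ^ w = (x - 1) mod 2 ^ w" by (metis mod_add_self2)
  then show ?thesis using x by simp
qed

text \<open>Besides the live variables, the scratch registers below \<open>d\<close> must survive,
  as they hold operands of enclosing operations.\<close>

definition computes :: "nat \<Rightarrow> nat set \<Rightarrow> nat \<Rightarrow> program \<Rightarrow> state \<Rightarrow> nat \<Rightarrow> nat \<Rightarrow> bool" where
  "computes w L d P s T x \<longleftrightarrow> (\<exists>t s'. runs w P s t s' \<and> t \<le> T \<and> mem s' = mem s \<and> reg s' d = x \<and>
     (\<forall>r. r \<in> L \<or> scratch \<le> r \<and> r < d \<longrightarrow> reg s' r = reg s r))"

lemma computesE:
  assumes "computes w L d P s T x"
  obtains t s' where "runs w P s t s'" "t \<le> T" "mem s' = mem s" "reg s' d = x"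
    "\<And>r. r \<in> L \<Longrightarrow> reg s' r = reg s r" "\<And>r. scratch \<le> r \<Longrightarrow> r < d \<Longrightarrow> reg s' r = reg s r"
  using assms unfolding computes_def by blast

lemma computesI:
  assumes "runs w P s t s'" "t \<le> T" "mem s' = mem s" "reg s' d = x"
    "\<And>r. r \<in> L \<Longrightarrow> reg s' r = reg s r" "\<And>r. scratch \<le> r \<Longrightarrow> r < d \<Longrightarrow> reg s' r = reg s r"
  shows "computes w L d P s T x"
  using assms unfolding computes_def by blast

lemma cexp_correct:
  assumes "ok L e" "0 \<in> L" "L \<subseteq> {..<scratch}" "scratch \<le> d" "fits N e" "N * n < 2 ^ w" "0 < N" "reg s 0 = n" "0 < w"
  shows "computes w L d (cexp d e) s (cost n e) (ev w e (reg s) (mem s))"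
  using assms
proof (induction e arbitrary: L d s)
  case (EVar v)
  show ?case unfolding cexp.simps
    by (rule computesI[OF runs.Op]) (use EVar.prems in auto)
next
  case (ENum k)
  show ?case unfolding cexp.simps
    by (rule computesI[OF runs.Const]) (use ENum.prems in auto)
next
  case (EOp f a b)
  have "computes w L d (cexp d a) s (cost n a) (ev w a (reg s) (mem s))"
    by (rule EOp.IH(1)) (use EOp.prems in simp_all)
  then obtain t1 s1 where 1: "runs w (cexp d a) s t1 s1" "t1 \<le> cost n a" "mem s1 = mem s"
    "reg s1 d = ev w a (reg s) (mem s)" "\<And>r. r \<in> L \<Longrightarrow> reg s1 r = reg s r"
    "\<And>r. scratch \<le> r \<Longrightarrow> r < d \<Longrightarrow> reg s1 r = reg s r"
    by (rule computesE) (rule that)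
  have "computes w L (Suc d) (cexp (Suc d) b) s1 (cost n b) (ev w b (reg s1) (mem s1))"
    by (rule EOp.IH(2)) (use EOp.prems 1(5)[of 0] in simp_all)
  then obtain t2 s2 where 2: "runs w (cexp (Suc d) b) s1 t2 s2" "t2 \<le> cost n b" "mem s2 = mem s1"
    "reg s2 (Suc d) = ev w b (reg s1) (mem s1)" "\<And>r. r \<in> L \<Longrightarrow> reg s2 r = reg s1 r"
    "\<And>r. scratch \<le> r \<Longrightarrow> r < Suc d \<Longrightarrow> reg s2 r = reg s1 r"
    by (rule computesE) (rule that)
  have b: "ev w b (reg s1) (mem s1) = ev w b (reg s) (mem s)"
    unfolding 1(3) by (rule ev_cong[of L]) (use EOp.prems 1(5) in auto)
  have "d \<notin> L" using EOp.prems by auto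
  show ?case unfolding cexp.simps
    by (rule computesI[OF runs.Seq[OF 1(1) runs.Seq[OF 2(1) runs.Op]]])
      (use 1 2 b EOp.prems \<open>d \<notin> L\<close> in auto)
next
  case (EMem a)
  have "computes w L d (cexp d a) s (cost n a) (ev w a (reg s) (mem s))"
    by (rule EMem.IH) (use EMem.prems in simp_all)
  then obtain t1 s1 where 1: "runs w (cexp d a) s t1 s1" "t1 \<le> cost n a" "mem s1 = mem s"
    "reg s1 d = ev w a (reg s) (mem s)" "\<And>r. r \<in> L \<Longrightarrow> reg s1 r = reg s r"
    "\<And>r. scratch \<le> r \<Longrightarrow> r < d \<Longrightarrow> reg s1 r = reg s r"
    by (rule computesE) (rule that)
  have "d \<notin> L" using EMem.prems by auto
  show ?case unfolding cexp.simps
    by (rule computesI[OF runs.Seq[OF 1(1) runs.Load]]) (use 1 EMem.prems \<open>d \<notin> L\<close> in auto)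
next
  case (ECond c a b)
  have "computes w L d (cexp d c) s (cost n c) (ev w c (reg s) (mem s))"
    by (rule ECond.IH(1)) (use ECond.prems in simp_all)
  then obtain t1 s1 where 1: "runs w (cexp d c) s t1 s1" "t1 \<le> cost n c" "mem s1 = mem s"
    "reg s1 d = ev w c (reg s) (mem s)" "\<And>r. r \<in> L \<Longrightarrow> reg s1 r = reg s r"
    "\<And>r. scratch \<le> r \<Longrightarrow> r < d \<Longrightarrow> reg s1 r = reg s r"
    by (rule computesE) (rule that)
  have cong: "ev w e (reg s1) (mem s1) = ev w e (reg s) (mem s)" if "ok L e" for e
    unfolding 1(3) by (rule ev_cong[OF that]) (use ECond.prems 1(5) in auto)
  show ?case
  proof (cases "reg s1 d \<noteq> 0")
    case True
    have "computes w L d (cexp d a) s1 (cost n a) (ev w a (reg s1) (mem s1))"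
      by (rule ECond.IH(2)) (use ECond.prems 1(5)[of 0] in simp_all)
    then obtain t2 s2 where 2: "runs w (cexp d a) s1 t2 s2" "t2 \<le> cost n a" "mem s2 = mem s1"
      "reg s2 d = ev w a (reg s1) (mem s1)" "\<And>r. r \<in> L \<Longrightarrow> reg s2 r = reg s1 r"
      "\<And>r. scratch \<le> r \<Longrightarrow> r < d \<Longrightarrow> reg s2 r = reg s1 r"
      by (rule computesE) (rule that)
    show ?thesis unfolding cexp.simps
      by (rule computesI[OF runs.Seq[OF 1(1) runs.Cond_True[OF True 2(1)]]])
        (use 1 2 True cong[of a] ECond.prems in auto)
  next
    case False
    have "computes w L d (cexp d b) s1 (cost n b) (ev w b (reg s1) (mem s1))"
      by (rule ECond.IH(3)) (use ECond.prems 1(5)[of 0] in simp_all)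
    then obtain t2 s2 where 2: "runs w (cexp d b) s1 t2 s2" "t2 \<le> cost n b" "mem s2 = mem s1"
      "reg s2 d = ev w b (reg s1) (mem s1)" "\<And>r. r \<in> L \<Longrightarrow> reg s2 r = reg s1 r"
      "\<And>r. scratch \<le> r \<Longrightarrow> r < d \<Longrightarrow> reg s2 r = reg s1 r"
      by (rule computesE) (rule that)
    show ?thesis unfolding cexp.simps
      by (rule computesI[OF runs.Seq[OF 1(1) runs.Cond_False[OF _ 2(1)]]])
        (use 1 2 False cong[of b] ECond.prems in auto)
  qed
next
  case (ELet i a b)
  have "i \<noteq> 0" using ELet.prems by (cases "i = 0") auto
  then have i: "i \<notin> L" "i < scratch" "i \<noteq> d" "i \<noteq> 0" using ELet.prems by auto
  have "computes w L d (cexp d a) s (cost n a) (ev w a (reg s) (mem s))"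
    by (rule ELet.IH(1)) (use ELet.prems in simp_all)
  then obtain t1 s1 where 1: "runs w (cexp d a) s t1 s1" "t1 \<le> cost n a" "mem s1 = mem s"
    "reg s1 d = ev w a (reg s) (mem s)" "\<And>r. r \<in> L \<Longrightarrow> reg s1 r = reg s r"
    "\<And>r. scratch \<le> r \<Longrightarrow> r < d \<Longrightarrow> reg s1 r = reg s r"
    by (rule computesE) (rule that)
  let ?s1 = "s1\<lparr>reg := (reg s1)(i := binop_val w Or (reg s1 d) (reg s1 d))\<rparr>"
  have "computes w (insert i L) d (cexp d b) ?s1 (cost n b) (ev w b (reg ?s1) (mem ?s1))"
    by (rule ELet.IH(2)) (use ELet.prems 1(5)[of 0] i in simp_all)
  then obtain t2 s2 where 2: "runs w (cexp d b) ?s1 t2 s2" "t2 \<le> cost n b" "mem s2 = mem ?s1"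
    "reg s2 d = ev w b (reg ?s1) (mem ?s1)" "\<And>r. r \<in> insert i L \<Longrightarrow> reg s2 r = reg ?s1 r"
    "\<And>r. scratch \<le> r \<Longrightarrow> r < d \<Longrightarrow> reg s2 r = reg ?s1 r"
    by (rule computesE) (rule that)
  have b: "ev w b (reg ?s1) (mem ?s1) = ev w b ((reg s)(i := ev w a (reg s) (mem s))) (mem s)"
  proof -
    have "mem ?s1 = mem s" using 1(3) by simp
    then show ?thesis
      by (simp only:) (rule ev_cong[of "insert i L"], use ELet.prems 1 in auto)
  qed
  have old: "reg ?s1 r = reg s1 r" if "r \<in> L \<or> scratch \<le> r" for r using that i by auto
  show ?case unfolding cexp.simps
    by (rule computesI[OF runs.Seq[OF 1(1) runs.Seq[OF runs.Op 2(1)]]])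
      (use 1 2 b old in \<open>simp_all del: binop_val.simps\<close>)
next
  case (EIter c i a b)
  have "i \<noteq> 0" using EIter.prems by (cases "i = 0") auto
  then have i: "i \<notin> L" "Suc i \<notin> L" "Suc i < scratch" "i \<noteq> d" "Suc i \<noteq> d" "i \<noteq> 0" "d \<notin> L" "d \<noteq> 0"
    using EIter.prems by auto
  \<comment> \<open>Loading \<open>c\<close> must not wrap around. This follows from the bound on
    \<open>c * n\<close>, except for \<open>n = 0\<close>, where the product is 0 anyway.\<close>
  have cn: "c * n < 2 ^ w" "c < 2 ^ w \<or> n = 0"
  proof -
    have "c * n \<le> N * n" using EIter.prems by (intro mult_le_mono1) simp
    then show "c * n < 2 ^ w" using EIter.prems(6) by linarith
    then show "c < 2 ^ w \<or> n = 0" by (cases n) auto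
  qed
  have "computes w L d (cexp d a) s (cost n a) (ev w a (reg s) (mem s))"
    by (rule EIter.IH(1)) (use EIter.prems in simp_all)
  then obtain t1 s1 where 1: "runs w (cexp d a) s t1 s1" "t1 \<le> cost n a" "mem s1 = mem s"
    "reg s1 d = ev w a (reg s) (mem s)" "\<And>r. r \<in> L \<Longrightarrow> reg s1 r = reg s r"
    "\<And>r. scratch \<le> r \<Longrightarrow> r < d \<Longrightarrow> reg s1 r = reg s r"
    by (rule computesE) (rule that)
  let ?f = "\<lambda>k acc. ev w b ((reg s)(i := k, Suc i := acc)) (mem s)"
  define s2 where "s2 = s1\<lparr>reg := (reg s1)(Suc i := reg s1 d)\<rparr>"
  define s3 where "s3 = s2\<lparr>reg := (reg s2)(i := c mod 2 ^ w)\<rparr>"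
  define s4 where "s4 = s3\<lparr>reg := (reg s3)(i := binop_val w Mul (reg s3 i) (reg s3 0))\<rparr>"
  have r2: "runs w (Op (Suc i) Or d d) s1 1 s2"
    using runs.Op[of w "Suc i" Or d d s1] by (simp add: s2_def)
  have r3: "runs w (Const i c) s2 1 s3" unfolding s3_def by (rule runs.Const)
  have r4: "runs w (Op i Mul i 0) s3 1 s4" unfolding s4_def by (rule runs.Op)
  define I where "I s' \<longleftrightarrow> mem s' = mem s \<and> (\<forall>r. r \<in> L \<or> scratch \<le> r \<and> r < d \<longrightarrow> reg s' r = reg s r) \<and> reg s' i < 2 ^ w" for s' :: state
  let ?body = "Seq (cexp d b) (Seq (Op (Suc i) Or d d) (Seq (Const d 1) (Op i Sub i d)))"
  have body: "\<exists>t s'. runs w ?body s5 t s' \<and> t \<le> cost n b + 3 \<and> reg s' i = k \<and> I s' \<and>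
      reg s' (Suc i) = ?f (Suc k) (reg s5 (Suc i))" if k: "reg s5 i = Suc k" and I: "I s5" for s5 k
  proof -
    let ?L = "insert i (insert (Suc i) L)"
    have n: "reg s5 0 = n" using I EIter.prems by (simp add: I_def)
    have "computes w ?L d (cexp d b) s5 (cost n b) (ev w b (reg s5) (mem s5))"
      by (rule EIter.IH(2)) (use EIter.prems n i in auto)
    then obtain t6 s6 where 6: "runs w (cexp d b) s5 t6 s6" "t6 \<le> cost n b" "mem s6 = mem s5"
      "reg s6 d = ev w b (reg s5) (mem s5)" "\<And>r. r \<in> ?L \<Longrightarrow> reg s6 r = reg s5 r"
      "\<And>r. scratch \<le> r \<Longrightarrow> r < d \<Longrightarrow> reg s6 r = reg s5 r"
      by (rule computesE) (rule that)
    have b: "ev w b (reg s5) (mem s5) = ?f (Suc k) (reg s5 (Suc i))"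
    proof -
      have "mem s5 = mem s" using I by (simp add: I_def)
      then show ?thesis
        by (simp only:) (rule ev_cong[of ?L], use EIter.prems k I in \<open>auto simp: I_def\<close>)
    qed
    define s7 where "s7 = s6\<lparr>reg := (reg s6)(Suc i := reg s6 d)\<rparr>"
    define s8 where "s8 = s7\<lparr>reg := (reg s7)(d := 1)\<rparr>"
    define s9 where "s9 = s8\<lparr>reg := (reg s8)(i := binop_val w Sub (reg s8 i) (reg s8 d))\<rparr>"
    have r7: "runs w (Op (Suc i) Or d d) s6 1 s7"
      using runs.Op[of w "Suc i" Or d d s6] by (simp add: s7_def)
    have "1 mod 2 ^ w = (1::nat)" using EIter.prems by simp
    then have r8: "runs w (Const d 1) s7 1 s8" using runs.Const[of w d 1 s7] by (simp add: s8_def)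
    have r9: "runs w (Op i Sub i d) s8 1 s9" unfolding s9_def by (rule runs.Op)
    have ki: "reg s8 i = Suc k" using 6(5)[of i] k i by (simp add: s8_def s7_def)
    have "Suc k < 2 ^ w" using k I by (simp add: I_def)
    then have i9: "reg s9 i = k" using binop_val_dec[of "Suc k" w] ki by (simp add: s9_def s8_def)
    have old: "reg s9 r = reg s6 r" if "r \<in> L \<or> scratch \<le> r \<and> r < d" for r
      using that i by (auto simp: s9_def s8_def s7_def)
    have "reg s9 r = reg s r" if "r \<in> L \<or> scratch \<le> r \<and> r < d" for r
      using old[OF that] 6(5)[of r] 6(6)[of r] I that unfolding I_def by auto
    moreover have "mem s9 = mem s" using 6(3) I by (simp add: I_def s9_def s8_def s7_def)
    ultimately have "I s9" using i9 \<open>Suc k < 2 ^ w\<close> by (simp add: I_def)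
    moreover have "reg s9 (Suc i) = ?f (Suc k) (reg s5 (Suc i))"
      using 6(4) b i by (simp add: s9_def s8_def s7_def)
    moreover have "runs w ?body s5 (t6 + (1 + (1 + 1))) s9"
      by (rule runs.Seq[OF 6(1) runs.Seq[OF r7 runs.Seq[OF r8 r9]]])
    ultimately show ?thesis using 6(2) i9 by (intro exI[of _ "t6 + (1 + (1 + 1))"] exI[of _ s9]) simp
  qed
  have i4: "reg s4 i = c * n"
  proof -
    have "reg s3 0 = n" using 1(5)[of 0] EIter.prems i by (simp add: s3_def s2_def)
    then show ?thesis using cn by (auto simp: s4_def s3_def)
  qed
  have "I s4"
    using 1(3,5,6) i i4 cn by (auto simp: I_def s4_def s3_def s2_def)
  from runs_loop[where I=I and i=i and g="\<lambda>s. reg s (Suc i)", OF body i4 this]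
  obtain t5 s5 where 5: "runs w (While i ?body) s4 t5 s5" "t5 \<le> c * n * (cost n b + 3 + 1) + 1" "I s5"
    "reg s5 (Suc i) = iter ?f (c * n) (reg s4 (Suc i))"
    by blast
  have "cost n b + 3 + 1 = cost n b + 4" by simp
  note t5 = 5(2)[unfolded this]
  have acc: "reg s4 (Suc i) = ev w a (reg s) (mem s)" using 1(4) i by (simp add: s4_def s3_def s2_def)
  have "runs w (Op d Or (Suc i) (Suc i)) s5 1 (s5\<lparr>reg := (reg s5)(d := reg s5 (Suc i))\<rparr>)"
    using runs.Op[of w d Or "Suc i" "Suc i" s5] by simp
  note run = runs.Seq[OF 1(1) runs.Seq[OF r2 runs.Seq[OF r3 runs.Seq[OF r4 runs.Seq[OF 5(1) this]]]]]
  have n: "reg s 0 = n" by fact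
  show ?case unfolding cexp.simps
    by (rule computesI[OF run])
      (use 1(2) t5 5(3,4) acc n i in \<open>auto simp: I_def simp del: add_mult_distrib2 distrib_left_numeral\<close>)
qed

subsection \<open>Commands\<close>

datatype com = Asg exp exp | CSeq com com | For nat com

primrec sem :: "nat \<Rightarrow> com \<Rightarrow> (nat \<Rightarrow> nat) \<Rightarrow> (nat \<Rightarrow> nat) \<Rightarrow> nat \<Rightarrow> nat" where
  "sem w (Asg a b) env m = m(ev w a env m := ev w b env m)"
| "sem w (CSeq p q) env m = sem w q env (sem w p env m)"
| "sem w (For i p) env m = iter (\<lambda>k m. sem w p (env(i := k)) m) (env 0) m"

primrec okc :: "nat set \<Rightarrow> com \<Rightarrow> bool" where
  "okc L (Asg a b) \<longleftrightarrow> ok L a \<and> ok L b"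
| "okc L (CSeq p q) \<longleftrightarrow> okc L p \<and> okc L q"
| "okc L (For i p) \<longleftrightarrow> i \<notin> L \<and> i < scratch \<and> okc (insert i L) p"

primrec fitsc :: "nat \<Rightarrow> com \<Rightarrow> bool" where
  "fitsc N (Asg a b) \<longleftrightarrow> fits N a \<and> fits N b"
| "fitsc N (CSeq p q) \<longleftrightarrow> fitsc N p \<and> fitsc N q"
| "fitsc N (For i p) \<longleftrightarrow> fitsc N p"

primrec costc :: "nat \<Rightarrow> com \<Rightarrow> nat" where
  "costc n (Asg a b) = cost n a + cost n b + 1"
| "costc n (CSeq p q) = costc n p + costc n q"
| "costc n (For i p) = n * (costc n p + 3) + 2"

primrec ccom :: "com \<Rightarrow> program" where
  "ccom (Asg a b) = Seq (cexp scratch a) (Seq (cexp (Suc scratch) b) (Store scratch (Suc scratch)))"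
| "ccom (CSeq p q) = Seq (ccom p) (ccom q)"
| "ccom (For i p) = Seq (Op i Or 0 0) (While i (Seq (ccom p) (Seq (Const scratch 1) (Op i Sub i scratch))))"

lemma sem_cong:
  "okc L p \<Longrightarrow> 0 \<in> L \<Longrightarrow> (\<And>r. r \<in> L \<Longrightarrow> env r = env' r) \<Longrightarrow> sem w p env m = sem w p env' m"
proof (induction p arbitrary: L env env' m)
  case (Asg a b)
  have "ev w a env m = ev w a env' m" "ev w b env m = ev w b env' m"
    by (rule ev_cong[of L]; use Asg.prems in simp)+
  then show ?case by simp
next
  case (CSeq p q)
  have "sem w p env m = sem w p env' m" for m by (rule CSeq.IH(1)[of L]) (use CSeq.prems in simp_all)
  moreover have "sem w q env m = sem w q env' m" for m by (rule CSeq.IH(2)[of L]) (use CSeq.prems in simp_all)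
  ultimately show ?case by simp
next
  case (For i p)
  have "sem w p (env(i := k)) m = sem w p (env'(i := k)) m" for k m
    by (rule For.IH[of "insert i L"]) (use For.prems in auto)
  moreover have "env 0 = env' 0" using For.prems by blast
  ultimately show ?case by simp
qed

lemma ccom_correct:
  assumes "okc L p" "0 \<in> L" "L \<subseteq> {..<scratch}" "fitsc N p" "N * n < 2 ^ w" "0 < N" "reg s 0 = n" "0 < w"
  shows "\<exists>t s'. runs w (ccom p) s t s' \<and> t \<le> costc n p \<and> mem s' = sem w p (reg s) (mem s) \<and>
    (\<forall>r\<in>L. reg s' r = reg s r)"
  using assms
proof (induction p arbitrary: L s)
  case (Asg a b)
  have "computes w L scratch (cexp scratch a) s (cost n a) (ev w a (reg s) (mem s))"
    by (rule cexp_correct[of L a scratch N]) (use Asg.prems in simp_all)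
  then obtain t1 s1 where 1: "runs w (cexp scratch a) s t1 s1" "t1 \<le> cost n a" "mem s1 = mem s"
    "reg s1 scratch = ev w a (reg s) (mem s)" "\<And>r. r \<in> L \<Longrightarrow> reg s1 r = reg s r"
    by (rule computesE) (rule that)
  have "computes w L (Suc scratch) (cexp (Suc scratch) b) s1 (cost n b) (ev w b (reg s1) (mem s1))"
    by (rule cexp_correct[of L b _ N]) (use Asg.prems 1(5)[of 0] in simp_all)
  then obtain t2 s2 where 2: "runs w (cexp (Suc scratch) b) s1 t2 s2" "t2 \<le> cost n b" "mem s2 = mem s1"
    "reg s2 (Suc scratch) = ev w b (reg s1) (mem s1)" "\<And>r. r \<in> L \<Longrightarrow> reg s2 r = reg s1 r"
    "\<And>r. scratch \<le> r \<Longrightarrow> r < Suc scratch \<Longrightarrow> reg s2 r = reg s1 r"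
    by (rule computesE) (rule that)
  have b: "ev w b (reg s1) (mem s1) = ev w b (reg s) (mem s)"
    unfolding 1(3) by (rule ev_cong[of L]) (use Asg.prems 1(5) in auto)
  note run = runs.Seq[OF 1(1) runs.Seq[OF 2(1) runs.Store[of w scratch "Suc scratch"]]]
  show ?case unfolding ccom.simps
    by (rule exI, rule exI, rule conjI, rule run) (use 1 2 b in auto)
next
  case (CSeq p q)
  obtain t1 s1 where 1: "runs w (ccom p) s t1 s1" "t1 \<le> costc n p" "mem s1 = sem w p (reg s) (mem s)"
    "\<forall>r\<in>L. reg s1 r = reg s r"
    using CSeq.IH(1)[of L s] CSeq.prems by auto
  obtain t2 s2 where 2: "runs w (ccom q) s1 t2 s2" "t2 \<le> costc n q" "mem s2 = sem w q (reg s1) (mem s1)"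
    "\<forall>r\<in>L. reg s2 r = reg s1 r"
    using CSeq.IH(2)[of L s1] CSeq.prems 1(4) by auto
  have "sem w q (reg s1) (mem s1) = sem w q (reg s) (mem s1)"
    by (rule sem_cong[of L]) (use CSeq.prems 1(4) in auto)
  then show ?case unfolding ccom.simps
    by (intro exI conjI, rule_tac runs.Seq[OF 1(1) 2(1)]) (use 1 2 in auto)
next
  case (For i p)
  have "i \<noteq> 0" using For.prems by (cases "i = 0") auto
  then have i: "i \<notin> L" "i < scratch" "i \<noteq> 0" "scratch \<notin> L" using For.prems by auto
  have n: "reg s 0 = n" by fact
  have nw: "n < 2 ^ w"
  proof -
    have "1 * n \<le> N * n" using For.prems by (intro mult_le_mono1) simp
    then show ?thesis using For.prems(5) by linarith
  qed
  let ?body = "Seq (ccom p) (Seq (Const scratch 1) (Op i Sub i scratch))"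
  let ?f = "\<lambda>k m. sem w p ((reg s)(i := k)) m"
  define I where "I s' \<longleftrightarrow> (\<forall>r\<in>L. reg s' r = reg s r) \<and> reg s' i < 2 ^ w" for s' :: state
  have body: "\<exists>t s'. runs w ?body s5 t s' \<and> t \<le> costc n p + 2 \<and> reg s' i = k \<and> I s' \<and>
      mem s' = ?f (Suc k) (mem s5)" if k: "reg s5 i = Suc k" and I: "I s5" for s5 k
  proof -
    have "reg s5 0 = n" using I For.prems by (simp add: I_def)
    then obtain t6 s6 where 6: "runs w (ccom p) s5 t6 s6" "t6 \<le> costc n p" "mem s6 = sem w p (reg s5) (mem s5)"
      "\<forall>r\<in>insert i L. reg s6 r = reg s5 r"
      using For.IH[of "insert i L" s5] For.prems by auto
    have b: "sem w p (reg s5) (mem s5) = ?f (Suc k) (mem s5)"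
      by (rule sem_cong[of "insert i L"]) (use For.prems k I in \<open>auto simp: I_def\<close>)
    define s8 where "s8 = s6\<lparr>reg := (reg s6)(scratch := 1)\<rparr>"
    define s9 where "s9 = s8\<lparr>reg := (reg s8)(i := binop_val w Sub (reg s8 i) (reg s8 scratch))\<rparr>"
    have "1 mod 2 ^ w = (1::nat)" using For.prems by simp
    then have r8: "runs w (Const scratch 1) s6 1 s8" using runs.Const[of w scratch 1 s6] by (simp add: s8_def)
    have r9: "runs w (Op i Sub i scratch) s8 1 s9" unfolding s9_def by (rule runs.Op)
    have ki: "reg s8 i = Suc k" using 6(4) k i by (simp add: s8_def)
    have "Suc k < 2 ^ w" using k I by (simp add: I_def)
    then have i9: "reg s9 i = k" using binop_val_dec[of "Suc k" w] ki by (simp add: s9_def s8_def)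
    have "reg s9 r = reg s6 r" if "r \<in> L" for r using that i by (auto simp: s9_def s8_def)
    then have "I s9" using I 6(4) i9 \<open>Suc k < 2 ^ w\<close> by (simp add: I_def)
    moreover have "mem s9 = ?f (Suc k) (mem s5)" using 6(3) b by (simp add: s9_def s8_def)
    moreover have "runs w ?body s5 (t6 + (1 + 1)) s9"
      by (rule runs.Seq[OF 6(1) runs.Seq[OF r8 r9]])
    ultimately show ?thesis using 6(2) i9 by (intro exI[of _ "t6 + (1 + 1)"] exI[of _ s9]) simp
  qed
  define s4 where "s4 = s\<lparr>reg := (reg s)(i := n)\<rparr>"
  have r4: "runs w (Op i Or 0 0) s 1 s4" using runs.Op[of w i Or 0 0 s] n by (simp add: s4_def)
  have i4: "reg s4 i = n" by (simp add: s4_def)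
  have "I s4" using i nw by (auto simp: I_def s4_def)
  from runs_loop[where I=I and i=i and g=mem, OF body i4 this]
  obtain t5 s5 where 5: "runs w (While i ?body) s4 t5 s5" "t5 \<le> n * (costc n p + 2 + 1) + 1" "I s5"
    "mem s5 = iter ?f n (mem s4)"
    by blast
  have "costc n p + 2 + 1 = costc n p + 3" by simp
  note t5 = 5(2)[unfolded this]
  show ?case unfolding ccom.simps
    by (rule exI, rule exI, rule conjI, rule runs.Seq[OF r4 5(1)])
      (use t5 5(3,4) n in \<open>auto simp: I_def s4_def\<close>)
qed

subsection \<open>Polynomial bounds\<close>

definition poly_bounded :: "(nat \<Rightarrow> nat) \<Rightarrow> bool" where
  "poly_bounded f \<longleftrightarrow> (\<exists>c k. \<forall>n\<ge>1. f n \<le> c * n ^ k)"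

lemma poly_bounded_const: "poly_bounded (\<lambda>_. c)"
  unfolding poly_bounded_def by (rule exI[of _ c], rule exI[of _ 0]) simp

lemma poly_bounded_id: "poly_bounded (\<lambda>n. n)"
  unfolding poly_bounded_def by (rule exI[of _ 1], rule exI[of _ 1]) simp

lemma poly_bounded_add:
  assumes "poly_bounded f" "poly_bounded g"
  shows "poly_bounded (\<lambda>n. f n + g n)"
proof -
  obtain c k where f: "\<And>n. 1 \<le> n \<Longrightarrow> f n \<le> c * n ^ k" using assms(1) unfolding poly_bounded_def by blast
  obtain d l where g: "\<And>n. 1 \<le> n \<Longrightarrow> g n \<le> d * n ^ l" using assms(2) unfolding poly_bounded_def by blast
  have "f n + g n \<le> (c + d) * n ^ (k + l)" if n: "1 \<le> n" for n
  proof -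
    have "n ^ k \<le> n ^ (k + l)" "n ^ l \<le> n ^ (k + l)"
      using n by (auto intro!: power_increasing)
    then have "c * n ^ k \<le> c * n ^ (k + l)" "d * n ^ l \<le> d * n ^ (k + l)" by (simp_all only: mult_le_mono2)
    then show ?thesis using f[OF n] g[OF n] unfolding add_mult_distrib by linarith
  qed
  then show ?thesis unfolding poly_bounded_def by blast
qed

lemma poly_bounded_mult:
  assumes "poly_bounded f" "poly_bounded g"
  shows "poly_bounded (\<lambda>n. f n * g n)"
proof -
  obtain c k where f: "\<And>n. 1 \<le> n \<Longrightarrow> f n \<le> c * n ^ k" using assms(1) unfolding poly_bounded_def by blast
  obtain d l where g: "\<And>n. 1 \<le> n \<Longrightarrow> g n \<le> d * n ^ l" using assms(2) unfolding poly_bounded_def by blast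
  have "f n * g n \<le> (c * d) * n ^ (k + l)" if n: "1 \<le> n" for n
    using mult_le_mono[OF f[OF n] g[OF n]] by (simp add: power_add mult_ac)
  then show ?thesis unfolding poly_bounded_def by blast
qed

lemmas poly_bounded_intros = poly_bounded_const poly_bounded_id poly_bounded_add poly_bounded_mult

lemma cost_poly_bounded: "poly_bounded (\<lambda>n. cost n e)"
  by (induction e) (simp_all only: cost.simps, (intro poly_bounded_intros; assumption?)+)

lemma costc_poly_bounded: "poly_bounded (\<lambda>n. costc n p)"
  by (induction p) (simp_all only: costc.simps, (intro poly_bounded_intros cost_poly_bounded; assumption?)+)

section \<open>The encoder on the word RAM\<close>

text \<open>The memory is divided into regions of \<open>n * n\<close> words, each holding a matrix.\<close>

definition adr :: "nat \<Rightarrow> nat \<Rightarrow> nat \<Rightarrow> nat \<Rightarrow> nat" where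
  "adr n j u v = (j * n + (u - 1)) * n + (v - 1)"

definition rep :: "nat \<Rightarrow> (nat \<Rightarrow> nat) \<Rightarrow> nat \<Rightarrow> (nat \<Rightarrow> nat \<Rightarrow> nat) \<Rightarrow> bool" where
  "rep n m j f \<longleftrightarrow> (\<forall>u\<in>{1..n}. \<forall>v\<in>{1..n}. m (adr n j u v) = f u v)"

definition agree :: "nat \<Rightarrow> nat \<Rightarrow> (nat \<Rightarrow> nat) \<Rightarrow> (nat \<Rightarrow> nat) \<Rightarrow> bool" where
  "agree n j m m' \<longleftrightarrow> (\<forall>j' u v. j' \<noteq> j \<longrightarrow> u \<in> {1..n} \<longrightarrow> v \<in> {1..n} \<longrightarrow> m' (adr n j' u v) = m (adr n j' u v))"

abbreviation add where "add \<equiv> EOp Add"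
abbreviation sub where "sub \<equiv> EOp Sub"
abbreviation mul where "mul \<equiv> EOp Mul"
abbreviation lessE where "lessE \<equiv> EOp Less"
abbreviation eqE where "eqE \<equiv> EOp Equal"
abbreviation notE where "notE a \<equiv> ECond a (ENum 0) (ENum 1)"
abbreviation andE where "andE a b \<equiv> ECond a b (ENum 0)"
abbreviation orE where "orE a b \<equiv> ECond a (ENum 1) b"
abbreviation maxE where "maxE a b \<equiv> ECond (lessE a b) b a"

definition adrE :: "exp \<Rightarrow> exp \<Rightarrow> exp \<Rightarrow> exp" where
  "adrE j a b = add (mul (add (mul j (EVar 0)) (sub a (ENum 1))) (EVar 0)) (sub b (ENum 1))"

abbreviation "rd j a b \<equiv> EMem (adrE j a b)"

text \<open>The expression is evaluated while region \<open>j\<close> is partly overwritten, so it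
  must not read that region; updates in place go through a buffer region.\<close>

definition fill :: "nat \<Rightarrow> exp \<Rightarrow> com" where
  "fill j e = For 1 (For 2 (Asg (adrE (ENum j) (EVar 1) (EVar 2)) e))"

definition exE :: "nat \<Rightarrow> exp \<Rightarrow> exp" where
  "exE k P = EIter 1 k (ENum 0) (ECond P (ENum 1) (EVar (Suc k)))"

definition countE :: "nat \<Rightarrow> exp \<Rightarrow> exp" where
  "countE k P = EIter 1 k (ENum 0) (ECond P (add (EVar (Suc k)) (ENum 1)) (EVar (Suc k)))"

text \<open>Region 5 holds the even codes and region 6 the odd ones, so \<open>5 + z mod 2\<close>
  is the line of \<open>z\<close> and \<open>6 - z mod 2\<close> the other one.\<close>

definition hopE :: "nat \<Rightarrow> nat \<Rightarrow> exp" where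
  "hopE k z = EIter 1 k (add (EVar z) (ENum 1))
     (ECond (lessE (EVar z) (rd (add (ENum 5) (EOp Mod (EVar z) (ENum 2))) (EVar k) (EVar k))) (EVar (Suc k))
       (maxE (EVar (Suc k)) (rd (sub (ENum 6) (EOp Mod (EVar z) (ENum 2))) (EVar k) (EVar k))))"

text \<open>Levels and their differences are at most \<open>2 * n + 1\<close>, so
  \<open>3 * n\<close> rounds always suffice; the guard makes exactly \<open>t\<close> of them
  effective.\<close>

definition hopsE :: "nat \<Rightarrow> nat \<Rightarrow> exp \<Rightarrow> exp" where
  "hopsE k t e = EIter 3 k e (ECond (lessE (EVar t) (EVar k)) (EVar (Suc k)) (hopE (k + 2) (Suc k)))"

definition levelE :: "nat \<Rightarrow> nat \<Rightarrow> exp" where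
  "levelE k z = EIter 1 k (EOp Mod (EVar z) (ENum 2))
     (ECond (lessE (EVar z) (hopsE (k + 2) (Suc k) (ENum 0))) (EVar (Suc k)) (add (EVar (Suc k)) (ENum 2)))"

definition beatsE :: "nat \<Rightarrow> nat \<Rightarrow> nat \<Rightarrow> nat \<Rightarrow> nat \<Rightarrow> exp" where
  "beatsE k z z' i j = ECond (lessE (EVar j) (EVar i))
     (ELet k (sub (EVar i) (EVar j)) (notE (lessE (EVar z) (hopsE (Suc k) k (EVar z')))))
     (ELet k (sub (EVar j) (EVar i)) (lessE (EVar z') (hopsE (Suc k) k (EVar z))))"

text \<open>All addresses and values stay below \<open>1000000 * (n * n * n)\<close>; the largest
  values are labels, bounded by \<open>8 * 32 ^ 3 * n ^ 3\<close>.\<close>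

locale machine =
  fixes w n :: nat
  assumes n: "1 \<le> n" and big: "2 ^ 30 * (n * n * n) \<le> (2::nat) ^ w"
begin

section \<open>Word arithmetic without overflow\<close>

lemma cube: "n \<le> n * n * n" "n * n \<le> n * n * n" "1 \<le> n * n * n"
  using n by auto

lemma word: "x \<le> 1000000 * (n * n * n) \<Longrightarrow> x < 2 ^ w"
proof -
  assume "x \<le> 1000000 * (n * n * n)"
  moreover have "1073741824 * (n * n * n) \<le> 2 ^ w" using big by simp
  ultimately show ?thesis using cube(3) by linarith
qed

lemma w_pos: "0 < w"
  using word[of 1] cube by (cases w) auto

lemma lin: "x \<le> 1000 * n \<Longrightarrow> x < 2 ^ w"
  by (rule word) (use cube in linarith)

lemma num: "k \<le> 1000 \<Longrightarrow> k mod 2 ^ w = (k :: nat)"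
  using lin[of k] n by simp

lemma num_ev: "k \<le> 1000 \<Longrightarrow> ev w (ENum k) env m = k"
  using num by simp

lemma binop_add: "x + y < 2 ^ w \<Longrightarrow> binop_val w Add x y = x + y"
  and binop_mul: "x * y < 2 ^ w \<Longrightarrow> binop_val w Mul x y = x * y"
  by simp_all

lemma binop_sub: "y \<le> x \<Longrightarrow> x < 2 ^ w \<Longrightarrow> binop_val w Sub x y = x - y"
proof -
  assume x: "y \<le> x" "x < 2 ^ w"
  then have "x + 2 ^ w - y = (x - y) + 2 ^ w" by simp
  then have "(x + 2 ^ w - y) mod 2 ^ w = (x - y) mod 2 ^ w" by (metis mod_add_self2)
  then show ?thesis using x by simp
qed

lemma adr_inj:
  assumes "u \<in> {1..n}" "v \<in> {1..n}" "u' \<in> {1..n}" "v' \<in> {1..n}" "adr n j u v = adr n j' u' v'"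
  shows "j = j' \<and> u = u' \<and> v = v'"
proof -
  have digit: "a = a' \<and> b = b'" if "a * n + b = a' * n + b'" "b < n" "b' < n" for a b a' b' :: nat
  proof -
    have "(a * n + b) div n = a" "(a * n + b) mod n = b" "(a' * n + b') div n = a'" "(a' * n + b') mod n = b'"
      using that(2,3) by simp_all
    then show ?thesis using that(1) by metis
  qed
  have "j * n + (u - 1) = j' * n + (u' - 1) \<and> v - 1 = v' - 1"
    using assms by (intro digit) (auto simp: adr_def)
  moreover from this have "j = j' \<and> u - 1 = u' - 1" using assms by (intro digit) auto
  ultimately show ?thesis using assms by auto
qed

lemma adr_less:
  assumes "j \<le> 100" "u \<in> {1..n}" "v \<in> {1..n}"
  shows "adr n j u v < 2 ^ w" "(j * n + (u - 1)) * n < 2 ^ w" "j * n + (u - 1) < 2 ^ w" "j * n < 2 ^ w"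
proof -
  have 1: "j * n \<le> 100 * n" using assms by (intro mult_le_mono1)
  have "u - 1 \<le> n" using assms by auto
  then have 2: "j * n + (u - 1) \<le> 101 * n" using 1 by linarith
  have 3: "(j * n + (u - 1)) * n \<le> 101 * n * n" using 2 by (intro mult_le_mono1)
  have 4: "adr n j u v \<le> 101 * n * n + n" unfolding adr_def by (intro add_mono 3) (use assms in auto)
  show "j * n < 2 ^ w" by (rule lin) (use 1 in linarith)
  show "j * n + (u - 1) < 2 ^ w" by (rule lin) (use 2 in linarith)
  have "101 * n * n + n \<le> 1000000 * (n * n * n)" using cube(1,2) by (simp only: mult.assoc)
  then show "(j * n + (u - 1)) * n < 2 ^ w" "adr n j u v < 2 ^ w" using 3 4 by (intro word; linarith)+
qed

lemma ev_adrE: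
  assumes "ev w j env m = jv" "jv \<le> 100" "ev w a env m = u" "u \<in> {1..n}" "ev w b env m = v" "v \<in> {1..n}" "env 0 = n"
  shows "ev w (adrE j a b) env m = adr n jv u v"
proof -
  note A = adr_less[OF assms(2,4,6)]
  have uv: "u < 2 ^ w" "v < 2 ^ w" using assms n by (intro lin; simp)+
  have one: "ev w (ENum 1) env m = 1" by (rule num_ev) simp
  have "binop_val w Sub u 1 = u - 1" "binop_val w Sub v 1 = v - 1" "binop_val w Mul jv n = jv * n"
    using assms(4,6) uv A by (auto intro!: binop_sub binop_mul simp del: binop_val.simps One_nat_def)
  moreover have "binop_val w Add (jv * n) (u - 1) = jv * n + (u - 1)"
    "binop_val w Mul (jv * n + (u - 1)) n = (jv * n + (u - 1)) * n"
    "binop_val w Add ((jv * n + (u - 1)) * n) (v - 1) = adr n jv u v"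
    unfolding adr_def by (rule binop_add[OF A(3)] binop_mul[OF A(2)] binop_add[OF A(1)[unfolded adr_def]])+
  ultimately show ?thesis
    unfolding adrE_def ev.simps(1,3) assms(1,3,5,7) one by (simp only:)
qed

lemma rd_rep:
  assumes "rep n m jv f" "ev w j env m = jv" "jv \<le> 100" "ev w a env m = u" "u \<in> {1..n}"
    "ev w b env m = v" "v \<in> {1..n}" "env 0 = n"
  shows "ev w (rd j a b) env m = f u v"
  using assms(1,5,7) ev_adrE[OF assms(2-8)] by (simp add: rep_def)

lemma agree_rep: "agree n j m m' \<Longrightarrow> j' \<noteq> j \<Longrightarrow> rep n m j' f \<Longrightarrow> rep n m' j' f"
  by (simp add: agree_def rep_def)

text \<open>The intermediate memories are among those that agree with the initial one outside region
  \<open>j\<close>, hence the quantification over \<open>m'\<close> for the value of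
  \<open>e\<close>.\<close>

lemma sem_fill:
  assumes env: "env 0 = n" and j: "j \<le> 100"
    and e: "\<And>u v m'. u \<in> {1..n} \<Longrightarrow> v \<in> {1..n} \<Longrightarrow> agree n j m m' \<Longrightarrow> ev w e (env(1 := u, 2 := v)) m' = f u v"
  shows "rep n (sem w (fill j e) env m) j f" "agree n j m (sem w (fill j e) env m)"
proof -
  let ?row = "\<lambda>u m. iter (\<lambda>v m. m(adr n j u v := ev w e (env(1 := u, 2 := v)) m)) n m"
  have asg: "sem w (Asg (adrE (ENum j) (EVar 1) (EVar 2)) e) (env(1 := u, 2 := v)) m =
      m(adr n j u v := ev w e (env(1 := u, 2 := v)) m)" if "u \<in> {1..n}" "v \<in> {1..n}" for u v m
    by (subst sem.simps(1), subst ev_adrE[where jv=j and u=u and v=v])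
      (use that env j num_ev[of j] in simp_all)
  have sem: "sem w (fill j e) env m = iter (\<lambda>u m. ?row u m) n m"
    unfolding fill_def sem.simps(3) env
  proof (rule iter_cong)
    fix u m assume u: "u \<in> {1..n}"
    have "(env(1 := u)) 0 = n" using env by simp
    then show "iter (\<lambda>v. sem w (Asg (adrE (ENum j) (EVar 1) (EVar 2)) e) (env(1 := u, 2 := v))) ((env(1 := u)) 0) m = ?row u m"
      using asg[OF u] by (simp only:) (rule iter_cong, simp)
  qed
  let ?D = "\<lambda>u v m'. m' (adr n j u v) = f u v"
  have step: "agree n j m (m'(adr n j u v := x))" if "agree n j m m'" "u \<in> {1..n}" "v \<in> {1..n}" for m' u v x
    using that adr_inj[of _ _ u v _ j] unfolding agree_def by (metis fun_upd_apply)
  have row_agree: "agree n j m (?row u m')" if "agree n j m m'" "u \<in> {1..n}" for u m'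
    by (rule iter_invariant[where I="agree n j m", OF that(1) step[OF _ that(2)]])
  have row_keep: "agree n j m (?row u m') \<and> ?D a b (?row u m')"
    if "agree n j m m'" "u \<in> {1..n}" "a \<in> {1..n}" "b \<in> {1..n}" "?D a b m'" for u m' a b
  proof (rule iter_invariant[where I="\<lambda>m'. agree n j m m' \<and> ?D a b m'"])
    fix k m'' assume k: "k \<in> {1..n}" and I: "agree n j m m'' \<and> ?D a b m''"
    show "agree n j m (m''(adr n j u k := ev w e (env(1 := u, 2 := k)) m'')) \<and>
        ?D a b (m''(adr n j u k := ev w e (env(1 := u, 2 := k)) m''))"
      using step[of m'' u k] I k that e[of u k m''] adr_inj[of a b u k j j] by auto
  qed (use that in simp)
  have row_done: "?D u v (?row u m')" if a: "agree n j m m'" and u: "u \<in> {1..n}" and v: "v \<in> {1..n}" for u v m'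
  proof (rule iter_covers[where I="agree n j m" and D="\<lambda>v m'. v \<in> {1..n} \<longrightarrow> ?D u v m'", THEN mp])
    show "agree n j m m'" by (rule a)
    fix k m'' assume k: "k \<in> {1..n}" and I: "agree n j m m''"
    show "agree n j m (m''(adr n j u k := ev w e (env(1 := u, 2 := k)) m''))" by (rule step[OF I u k])
    show "k \<in> {1..n} \<longrightarrow> ?D u k (m''(adr n j u k := ev w e (env(1 := u, 2 := k)) m''))" using e[OF u k I] by simp
    fix i assume "i \<in> {1..n} \<longrightarrow> ?D u i m''"
    then show "i \<in> {1..n} \<longrightarrow> ?D u i (m''(adr n j u k := ev w e (env(1 := u, 2 := k)) m''))"
      using e[OF u k I] adr_inj[of u i u k j j] u k by auto
  qed (use v in simp_all)
  have "agree n j m m" by (simp add: agree_def)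
  then show "agree n j m (sem w (fill j e) env m)" unfolding sem
    by (rule iter_invariant[where I="agree n j m", OF _ row_agree])
  have "\<forall>v\<in>{1..n}. ?D u v (iter (\<lambda>u m. ?row u m) n m)" if "u \<in> {1..n}" for u
  proof (rule iter_covers[where I="agree n j m" and D="\<lambda>u m'. u \<in> {1..n} \<longrightarrow> (\<forall>v\<in>{1..n}. ?D u v m')", THEN mp])
    show "agree n j m m" by fact
    fix k m'' assume k: "k \<in> {1..n}" and I: "agree n j m m''"
    show "agree n j m (?row k m'')" by (rule row_agree[OF I k])
    show "k \<in> {1..n} \<longrightarrow> (\<forall>v\<in>{1..n}. ?D k v (?row k m''))" using row_done[OF I k] by blast
    fix i assume "i \<in> {1..n} \<longrightarrow> (\<forall>v\<in>{1..n}. ?D i v m'')"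
    then show "i \<in> {1..n} \<longrightarrow> (\<forall>v\<in>{1..n}. ?D i v (?row k m''))" using row_keep[OF I k] by blast
  qed (use that in simp_all)
  then show "rep n (sem w (fill j e) env m) j f" unfolding sem rep_def by blast
qed

lemma ev_exE:
  assumes "env 0 = n" "\<And>v a. v \<in> {1..n} \<Longrightarrow> ev w P (env(k := v, Suc k := a)) m \<noteq> 0 \<longleftrightarrow> Q v"
  shows "ev w (exE k P) env m = of_bool (\<exists>v\<in>{1..n}. Q v)"
proof -
  have one: "ev w (ENum 1) e m = 1" for e by (rule num_ev) simp
  have f: "ev w (ECond P (ENum 1) (EVar (Suc k))) (env(k := v, Suc k := a)) m = (if Q v then 1 else a)"
    if "v \<in> {1..n}" for v a
    using assms(2)[OF that, of a] unfolding ev.simps(1,5) one by simp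
  have "ev w (ENum 0) env m = 0" by (rule num_ev) simp
  then have "ev w (exE k P) env m = iter (\<lambda>v a. if Q v then 1 else a) n 0"
    unfolding exE_def ev.simps(6) assms(1) mult_1 by (simp only:) (rule iter_cong, rule f)
  also have "iter (\<lambda>v a. if Q v then 1 else a) n' a = (if \<exists>v\<in>{1..n'}. Q v then 1 else a)" for n' and a :: nat
  proof (induction n' arbitrary: a)
    case (Suc n')
    have "{1..Suc n'} = insert (Suc n') {1..n'}" by auto
    then show ?case using Suc by simp
  qed simp
  finally show ?thesis by simp
qed

lemma ev_countE:
  assumes "env 0 = n" "\<And>v a. v \<in> {1..n} \<Longrightarrow> ev w P (env(k := v, Suc k := a)) m \<noteq> 0 \<longleftrightarrow> Q v"
  shows "ev w (countE k P) env m = card {v \<in> {1..n}. Q v}"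
proof -
  define f where "f v a = ev w (ECond P (add (EVar (Suc k)) (ENum 1)) (EVar (Suc k))) (env(k := v, Suc k := a)) m" for v a
  have one: "ev w (ENum 1) e m = 1" for e by (rule num_ev) simp
  have f: "f v a = (if Q v then a + 1 else a)" if "v \<in> {1..n}" "a + 1 < 2 ^ w" for v a
    using assms(2)[OF that(1), of a] binop_add[OF that(2)] unfolding f_def ev.simps(1,3,5) one
    by (simp del: binop_val.simps)
  have "iter f n' a = iter (\<lambda>v a. if Q v then a + 1 else a) n' a" if "n' \<le> n" "a + n' \<le> n" for n' a
    using that
  proof (induction n' arbitrary: a)
    case (Suc n')
    have "Suc n' \<in> {1..n}" "a + 1 < 2 ^ w" using Suc.prems lin[of "a + 1"] by auto
    from f[OF this] show ?case using Suc.IH[of "if Q (Suc n') then a + 1 else a"] Suc.prems by simp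
  qed simp
  from this[of n 0] have "iter f n 0 = card {v \<in> {1..n}. Q v}" by (simp add: iter_count)
  moreover have "ev w (ENum 0) env m = 0" by (rule num_ev) simp
  ultimately show ?thesis
    unfolding countE_def ev.simps(6) assms(1) mult_1 f_def by (simp only:)
qed

end

text \<open>The counter falls, so \<open>N - k\<close> rounds precede round \<open>k\<close>, each
  adding at most \<open>d\<close>. Below this bound a loop on words does not wrap around and equals
  the loop on numbers.\<close>

lemma iter_eq_bounded:
  fixes f g :: "nat \<Rightarrow> nat \<Rightarrow> nat"
  assumes "\<And>k a. k \<in> {1..N} \<Longrightarrow> a \<le> b + d * (N - k) \<Longrightarrow> f k a = g k a \<and> g k a \<le> b + d * (N - k) + d"
    and "a \<le> b"
  shows "iter f N a = iter g N a \<and> iter g N a \<le> b + d * N"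
proof -
  have "iter f M a = iter g M a \<and> iter g M a \<le> b + d * N" if "M \<le> N" "a \<le> b + d * (N - M)" for M a
    using that
  proof (induction M arbitrary: a)
    case 0
    then show ?case by simp
  next
    case (Suc M)
    have *: "f (Suc M) a = g (Suc M) a" "g (Suc M) a \<le> b + d * (N - Suc M) + d"
      using assms(1)[of "Suc M" a] Suc.prems by auto
    have "N - M = Suc (N - Suc M)" using Suc.prems by simp
    then have "g (Suc M) a \<le> b + d * (N - M)" using *(2) by simp
    then show ?case using Suc.IH[of "g (Suc M) a"] Suc.prems *(1) by simp
  qed
  from this[of N a] show ?thesis using assms(2) by simp
qed

context machine
begin

section \<open>Evaluating moves, levels and phases\<close>

definition codes_rep :: "(nat \<Rightarrow> nat) \<Rightarrow> (bool \<Rightarrow> nat \<Rightarrow> nat) \<Rightarrow> bool" where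
  "codes_rep m c \<longleftrightarrow> rep n m 5 (\<lambda>u _. c False u) \<and> rep n m 6 (\<lambda>u _. c True u) \<and> (\<forall>b. \<forall>u\<in>{1..n}. c b u < 2 * n)"

lemma const_ev: "ev w (ENum 0) env m = 0" "ev w (ENum 1) env m = 1" "ev w (ENum 2) env m = 2"
  "ev w (ENum 3) env m = 3" "ev w (ENum 4) env m = 4" "ev w (ENum 5) env m = 5" "ev w (ENum 6) env m = 6"
  "ev w (ENum 7) env m = 7" "ev w (ENum 8) env m = 8" "ev w (ENum 9) env m = 9"
  by (rule num_ev; simp)+

lemma not_ev: "ev w (notE a) env m = of_bool (ev w a env m = 0)"
  and and_ev: "ev w (andE a b) env m \<noteq> 0 \<longleftrightarrow> ev w a env m \<noteq> 0 \<and> ev w b env m \<noteq> 0"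
  and or_ev: "ev w (orE a b) env m \<noteq> 0 \<longleftrightarrow> ev w a env m \<noteq> 0 \<or> ev w b env m \<noteq> 0"
  and max_ev: "ev w (maxE a b) env m = max (ev w a env m) (ev w b env m)"
  and less_ev: "ev w (lessE a b) env m = of_bool (ev w a env m < ev w b env m)"
  and eq_ev: "ev w (eqE a b) env m = of_bool (ev w a env m = ev w b env m)"
  using const_ev(1,2)[of env m] by auto

lemma add_ev: "ev w a env m + ev w b env m < 2 ^ w \<Longrightarrow> ev w (add a b) env m = ev w a env m + ev w b env m"
  and mul_ev: "ev w a env m * ev w b env m < 2 ^ w \<Longrightarrow> ev w (mul a b) env m = ev w a env m * ev w b env m"
  and sub_ev: "ev w b env m \<le> ev w a env m \<Longrightarrow> ev w a env m < 2 ^ w \<Longrightarrow>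
    ev w (sub a b) env m = ev w a env m - ev w b env m"
  unfolding ev.simps(3) by (rule binop_add binop_mul binop_sub; assumption)+

text \<open>Beyond all codes a hop adds only 1, which bounds the values in a loop of hops.\<close>

lemma hop_le:
  assumes "codes_rep m c"
  shows "hop n c z \<le> max (z + 1) (2 * n)"
proof -
  have c: "c b v < 2 * n" if "v \<in> {1..n}" for b v using assms that unfolding codes_rep_def by blast
  have "hop n c z = z + 1 \<or> (\<exists>v\<in>{1..n}. c (odd z) v \<le> z \<and> hop n c z = c (even z) v)"
    unfolding hop_def by (rule iter_max(3))
  then show ?thesis using c by (metis less_imp_le max.cobounded1 max.coboundedI2)
qed

lemma ev_hopE:
  assumes c: "codes_rep m c" and env: "env 0 = n" "env z \<le> 100 * n" "z \<noteq> k" "z \<noteq> Suc k" "k \<noteq> 0"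
  shows "ev w (hopE k z) env m = hop n c (env z)"
proof -
  let ?z = "env z"
  have "?z + 1 < 2 ^ w" using env n by (intro lin) simp
  then have start: "ev w (add (EVar z) (ENum 1)) env m = ?z + 1"
    by (subst add_ev) (simp_all only: ev.simps(1) const_ev)
  have body: "ev w (ECond (lessE (EVar z) (rd (add (ENum 5) (EOp Mod (EVar z) (ENum 2))) (EVar k) (EVar k))) (EVar (Suc k))
       (maxE (EVar (Suc k)) (rd (sub (ENum 6) (EOp Mod (EVar z) (ENum 2))) (EVar k) (EVar k)))) (env(k := v, Suc k := a)) m =
    (if c (odd ?z) v \<le> ?z then max a (c (even ?z) v) else a)" if v: "v \<in> {1..n}" for v a
  proof -
    let ?e = "env(k := v, Suc k := a)"
    have e: "?e 0 = n" "?e z = ?z" "?e k = v" "?e (Suc k) = a" using env by simp_all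
    have md: "ev w (EOp Mod (EVar z) (ENum 2)) ?e m = ?z mod 2"
      unfolding ev.simps(1,3) const_ev e binop_val.simps by simp
    have lt: "5 + ?z mod 2 < 2 ^ w" "6 < (2::nat) ^ w" using n by (intro lin; linarith)+
    have 1: "ev w (add (ENum 5) (EOp Mod (EVar z) (ENum 2))) ?e m = 5 + ?z mod 2"
      using lt by (subst add_ev) (simp_all only: md const_ev)
    have 2: "ev w (sub (ENum 6) (EOp Mod (EVar z) (ENum 2))) ?e m = 6 - ?z mod 2"
      using sub_ev[where a="ENum 6" and b="EOp Mod (EVar z) (ENum 2)" and env="?e" and m=m] lt
      unfolding md const_ev by simp
    have r1: "rep n m (5 + ?z mod 2) (\<lambda>u _. c (odd ?z) u)" and r2: "rep n m (6 - ?z mod 2) (\<lambda>u _. c (even ?z) u)"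
    proof -
      have cr: "rep n m 5 (\<lambda>u _. c False u)" "rep n m 6 (\<lambda>u _. c True u)" using c unfolding codes_rep_def by blast+
      consider "even ?z" "?z mod 2 = 0" | "odd ?z" "?z mod 2 = 1" by (metis even_iff_mod_2_eq_zero odd_iff_mod_2_eq_one)
      then have "rep n m (5 + ?z mod 2) (\<lambda>u _. c (odd ?z) u) \<and> rep n m (6 - ?z mod 2) (\<lambda>u _. c (even ?z) u)"
        using cr by cases simp_all
      then show "rep n m (5 + ?z mod 2) (\<lambda>u _. c (odd ?z) u)" "rep n m (6 - ?z mod 2) (\<lambda>u _. c (even ?z) u)" by blast+
    qed
    have b: "5 + ?z mod 2 \<le> 100" "6 - ?z mod 2 \<le> 100" by simp_all
    have "ev w (EVar k) ?e m = v" using e by simp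
    note R = rd_rep[OF r1 1 b(1) this v this v e(1)] rd_rep[OF r2 2 b(2) this v this v e(1)]
    show ?thesis unfolding ev.simps(5) less_ev max_ev R unfolding ev.simps(1) e by (auto simp: not_le)
  qed
  show ?thesis unfolding hopE_def ev.simps(6) env(1) mult_1 start hop_def
    by (rule iter_cong) (rule body)
qed

lemma ev_hopsE:
  assumes c: "codes_rep m c" and env: "env 0 = n" "env t \<le> 3 * n" "t \<noteq> k" "t \<noteq> Suc k" "k \<noteq> 0"
    and e: "ev w e env m = z" "z \<le> 10 * n"
  shows "ev w (hopsE k t e) env m = (hop n c ^^ env t) z"
proof -
  let ?f = "\<lambda>v a. ev w (ECond (lessE (EVar t) (EVar k)) (EVar (Suc k)) (hopE (k + 2) (Suc k))) (env(k := v, Suc k := a)) m"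
  have "iter ?f (3 * n) z = iter (\<lambda>v a. if v \<le> env t then hop n c a else a) (3 * n) z \<and>
    iter (\<lambda>v a. if v \<le> env t then hop n c a else a) (3 * n) z \<le> 10 * n + 1 * (3 * n)"
  proof (rule iter_eq_bounded[OF _ e(2)])
    fix v a assume v: "v \<in> {1..3 * n}" and a: "a \<le> 10 * n + 1 * (3 * n - v)"
    let ?e = "env(k := v, Suc k := a)"
    have "ev w (hopE (k + 2) (Suc k)) ?e m = hop n c (?e (Suc k))"
      by (rule ev_hopE[OF c]) (use env a in auto)
    then have "?f v a = (if v \<le> env t then hop n c a else a)"
      unfolding ev.simps(5) less_ev unfolding ev.simps(1) using env by (simp add: not_le)
    moreover have "hop n c a \<le> 10 * n + 1 * (3 * n - v) + 1" using hop_le[OF c, of a] a by simp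
    ultimately show "?f v a = (if v \<le> env t then hop n c a else a) \<and>
        (if v \<le> env t then hop n c a else a) \<le> 10 * n + 1 * (3 * n - v) + 1" using a by simp
  qed
  then show ?thesis unfolding hopsE_def ev.simps(6) env(1) e(1) using iter_funpow_le[OF env(2)] by metis
qed

lemma ev_levelE:
  assumes c: "codes_rep m c" and env: "env 0 = n" "env z < 2 * n" "z \<noteq> k" "z \<noteq> Suc k" "z < k + 2" "k \<noteq> 0"
  shows "ev w (levelE k z) env m = level n c (env z) \<and> level n c (env z) \<le> 2 * n + 1"
proof -
  let ?z = "env z"
  let ?f = "\<lambda>v a. ev w (ECond (lessE (EVar z) (hopsE (k + 2) (Suc k) (ENum 0))) (EVar (Suc k)) (add (EVar (Suc k)) (ENum 2)))
    (env(k := v, Suc k := a)) m"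
  let ?g = "\<lambda>(v::nat) a. if chain n c a \<le> ?z then a + 2 else a"
  have "iter ?f n (?z mod 2) = iter ?g n (?z mod 2) \<and> iter ?g n (?z mod 2) \<le> 1 + 2 * n"
  proof (rule iter_eq_bounded)
    fix v a assume v: "v \<in> {1..n}" and a: "a \<le> 1 + 2 * (n - v)"
    let ?e = "env(k := v, Suc k := a)"
    have e: "?e 0 = n" "?e z = ?z" "?e (Suc k) = a" using env by simp_all
    have "ev w (hopsE (k + 2) (Suc k) (ENum 0)) ?e m = (hop n c ^^ ?e (Suc k)) 0"
      by (rule ev_hopsE[OF c]) (use env a v in \<open>auto simp: const_ev simp del: ev.simps(2)\<close>)
    then have h: "ev w (hopsE (k + 2) (Suc k) (ENum 0)) ?e m = chain n c a" unfolding e by (simp add: chain_def)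
    have "a + 2 < 2 ^ w" using a v by (intro lin) auto
    then have "ev w (add (EVar (Suc k)) (ENum 2)) ?e m = a + 2"
      by (subst add_ev) (simp_all only: ev.simps(1) e const_ev)
    then show "?f v a = ?g v a \<and> ?g v a \<le> 1 + 2 * (n - v) + 2"
      unfolding ev.simps(5) less_ev h unfolding ev.simps(1) e using a by (simp add: not_le)
  qed simp
  moreover have "ev w (EOp Mod (EVar z) (ENum 2)) env m = ?z mod 2"
    unfolding ev.simps(1,3) const_ev binop_val.simps ..
  ultimately show ?thesis unfolding levelE_def ev.simps(6) env(1) mult_1 level_def by (simp only:) simp
qed

lemma ev_beatsE:
  assumes c: "codes_rep m c" and env: "env 0 = n" "env z < 2 * n" "env z' < 2 * n"
    "env i = level n c (env z)" "env j = level n c (env z')" "env i \<le> 2 * n + 1" "env j \<le> 2 * n + 1"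
    and k: "z < k" "z' < k" "i < k" "j < k"
  shows "ev w (beatsE k z z' i j) env m \<noteq> 0 \<longleftrightarrow> beats n c (env z) (env z')"
proof -
  have lt: "env i < 2 ^ w" "env j < 2 ^ w" using env n by (intro lin; linarith)+
  have hops: "ev w (hopsE (Suc k) k (EVar y)) (env(k := t)) m = (hop n c ^^ t) (env y)"
    if "t \<le> 3 * n" "y < k" "env y < 2 * n" for t y
  proof -
    have "ev w (hopsE (Suc k) k (EVar y)) (env(k := t)) m = (hop n c ^^ ((env(k := t)) k)) (env y)"
      by (rule ev_hopsE[OF c]) (use that env k in auto)
    then show ?thesis by simp
  qed
  show ?thesis
  proof (cases "env j < env i")
    case True
    have s: "ev w (sub (EVar i) (EVar j)) env m = env i - env j"
      using True lt by (subst sub_ev) simp_all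
    have "env i - env j \<le> 3 * n" using env n by linarith
    note h = hops[OF this k(2) env(3)]
    show ?thesis
      unfolding beatsE_def ev.simps(5) less_ev ev.simps(7) s not_ev h
      unfolding ev.simps(1) using True k env(4,5) w_pos by (simp add: beats_def)
  next
    case False
    have s: "ev w (sub (EVar j) (EVar i)) env m = env j - env i"
      using False lt by (subst sub_ev) simp_all
    have "env j - env i \<le> 3 * n" using env n by linarith
    note h = hops[OF this k(1) env(2)]
    show ?thesis
      unfolding beatsE_def ev.simps(5) less_ev ev.simps(7) s h
      unfolding ev.simps(1) using False k env(4,5) by (simp add: beats_def)
  qed
qed

end

abbreviation "rdv j a b \<equiv> rd (ENum j) (EVar a) (EVar b)"

definition gammaE :: exp where
  "gammaE = orE (rdv 3 1 2) (exE 7 (orE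
     (andE (rdv 3 7 2) (andE (eqE (rdv 1 7 2) (rdv 1 1 2)) (notE (eqE (rdv 1 7 1) (rdv 1 1 2)))))
     (andE (rdv 3 1 7) (andE (eqE (rdv 1 1 7) (rdv 1 1 2)) (notE (eqE (rdv 1 7 2) (rdv 1 1 2)))))))"

text \<open>Region 0 holds the input, 1 the colours, 2 the oriented pairs, 3 the class, and 4 is the
  buffer. The loops in variables 5 and 6 make the \<open>n * n\<close> rounds of
  \<open>gamma_class\<close>.\<close>

definition split_com :: com where
  "split_com =
     CSeq (fill 3 (andE (eqE (EVar 1) (EVar 3)) (andE (eqE (EVar 2) (EVar 4))
       (andE (notE (eqE (EVar 3) (EVar 4))) (lessE (rdv 1 3 4) (ENum 2))))))
     (CSeq (For 5 (For 6 (CSeq (fill 4 gammaE) (fill 3 (rdv 4 1 2)))))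
     (CSeq (fill 4 (orE (rdv 2 1 2) (rdv 3 1 2)))
     (CSeq (fill 2 (rdv 4 1 2))
     (CSeq (fill 4 (ECond (orE (rdv 3 1 2) (rdv 3 2 1))
        (add (add (ENum 2) (mul (EVar 3) (add (EVar 0) (ENum 1)))) (EVar 4)) (rdv 1 1 2)))
     (fill 1 (rdv 4 1 2))))))"

definition orient_com :: com where
  "orient_com = CSeq (fill 1 (rdv 0 1 2)) (CSeq (fill 2 (ENum 0)) (For 3 (For 4 split_com)))"

context machine
begin

definition set_rep :: "(nat \<Rightarrow> nat) \<Rightarrow> nat \<Rightarrow> (nat \<times> nat) set \<Rightarrow> bool" where
  "set_rep m j A \<longleftrightarrow> rep n m j (\<lambda>u v. of_bool ((u, v) \<in> A))"

lemma rdv_ev: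
  assumes "rep n m j f" "j \<le> 100" "env 0 = n" "env a \<in> {1..n}" "env b \<in> {1..n}"
  shows "ev w (rdv j a b) env m = f (env a) (env b)"
proof (rule rd_rep[where jv=j and f=f and u="env a" and v="env b"])
  show "ev w (ENum j) env m = j" by (rule num_ev) (use assms(2) in simp)
qed (use assms in simp_all)

lemma fill_copy:
  assumes "rep n m j f" "env 0 = n" "i \<noteq> j" "i \<le> 100" "j \<le> 100"
  shows "rep n (sem w (fill i (rdv j 1 2)) env m) i f" "agree n i m (sem w (fill i (rdv j 1 2)) env m)"
proof -
  have "ev w (rdv j 1 2) (env(1 := u, 2 := v)) m' = f u v"
    if "u \<in> {1..n}" "v \<in> {1..n}" "agree n i m m'" for u v m'
    using rdv_ev[OF agree_rep[OF that(3) _ assms(1)], of "env(1 := u, 2 := v)" 1 2] assms that by simp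
  then show "rep n (sem w (fill i (rdv j 1 2)) env m) i f" "agree n i m (sem w (fill i (rdv j 1 2)) env m)"
    using sem_fill[where f=f and env=env and j=i and e="rdv j 1 2" and m=m] assms(2,4) by blast+
qed

lemma ev_gammaE:
  assumes A: "set_rep m 3 A" and \<kappa>: "rep n m 1 \<kappa>" and env: "env 0 = n" "env 1 = u" "env 2 = v"
    and uv: "u \<in> {1..n}" "v \<in> {1..n}"
  shows "ev w gammaE env m = of_bool ((u, v) \<in> gamma_step n \<kappa> A)"
proof -
  note A' = rdv_ev[OF A[unfolded set_rep_def]] and K' = rdv_ev[OF \<kappa>]
  let ?Q = "\<lambda>z. (z, v) \<in> A \<and> \<kappa> z v = \<kappa> u v \<and> \<kappa> z u \<noteq> \<kappa> u v \<or> (u, z) \<in> A \<and> \<kappa> u z = \<kappa> u v \<and> \<kappa> z v \<noteq> \<kappa> u v"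
  have "ev w (exE 7 (orE
     (andE (rdv 3 7 2) (andE (eqE (rdv 1 7 2) (rdv 1 1 2)) (notE (eqE (rdv 1 7 1) (rdv 1 1 2)))))
     (andE (rdv 3 1 7) (andE (eqE (rdv 1 1 7) (rdv 1 1 2)) (notE (eqE (rdv 1 7 2) (rdv 1 1 2))))))) env m =
    of_bool (\<exists>z\<in>{1..n}. ?Q z)"
  proof (rule ev_exE)
    show "env 0 = n" by (rule env(1))
    fix z a assume z: "z \<in> {1..n}"
    let ?e = "env(7 := z, Suc 7 := a)"
    have e: "?e 0 = n" "?e 1 = u" "?e 2 = v" "?e 7 = z" using env by simp_all
    have r: "ev w (rdv 3 7 2) ?e m = of_bool ((z, v) \<in> A)" "ev w (rdv 3 1 7) ?e m = of_bool ((u, z) \<in> A)"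
      "ev w (rdv 1 7 2) ?e m = \<kappa> z v" "ev w (rdv 1 1 2) ?e m = \<kappa> u v" "ev w (rdv 1 7 1) ?e m = \<kappa> z u"
      "ev w (rdv 1 1 7) ?e m = \<kappa> u z"
      using A'[of ?e 7 2] A'[of ?e 1 7] K'[of ?e 7 2] K'[of ?e 1 2] K'[of ?e 7 1] K'[of ?e 1 7] uv z
      unfolding e by simp_all
    show "ev w (orE
     (andE (rdv 3 7 2) (andE (eqE (rdv 1 7 2) (rdv 1 1 2)) (notE (eqE (rdv 1 7 1) (rdv 1 1 2)))))
     (andE (rdv 3 1 7) (andE (eqE (rdv 1 1 7) (rdv 1 1 2)) (notE (eqE (rdv 1 7 2) (rdv 1 1 2)))))) ?e m \<noteq> 0 \<longleftrightarrow> ?Q z"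
      unfolding or_ev and_ev not_ev eq_ev r by simp
  qed
  moreover have "ev w (rdv 3 1 2) env m = of_bool ((u, v) \<in> A)" using A'[of env 1 2] env uv by simp
  moreover have "(u, v) \<in> gamma_step n \<kappa> A \<longleftrightarrow> (u, v) \<in> A \<or> (\<exists>z\<in>{1..n}. ?Q z)"
    using uv by (auto simp: gamma_step_def)
  ultimately show ?thesis unfolding gammaE_def ev.simps(5) const_ev by simp
qed

definition orient_state :: "(nat \<Rightarrow> nat) \<Rightarrow> (nat \<Rightarrow> nat \<Rightarrow> nat) \<Rightarrow> (nat \<Rightarrow> nat \<Rightarrow> nat) \<times> (nat \<times> nat) set \<Rightarrow> bool" where
  "orient_state m e S \<longleftrightarrow> rep n m 0 e \<and> rep n m 1 (fst S) \<and> set_rep m 2 (snd S)"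

lemma orient_state_agree:
  "agree n j m m' \<Longrightarrow> j \<notin> {0, 1, 2} \<Longrightarrow> orient_state m e S \<Longrightarrow> orient_state m' e S"
  unfolding orient_state_def set_rep_def
  using agree_rep[of j m m' 0] agree_rep[of j m m' 1] agree_rep[of j m m' 2] by simp

lemma sem_split_com:
  assumes st: "orient_state m e S" and env: "env 0 = n" "env 3 = p" "env 4 = q" and pq: "p \<in> {1..n}" "q \<in> {1..n}"
  shows "orient_state (sem w split_com env m) e (split_class n p q S)"
proof -
  obtain \<kappa> R where S: "S = (\<kappa>, R)" by fastforce
  let ?A0 = "{(u, v). u = p \<and> v = q \<and> p \<noteq> q \<and> \<kappa> p q < 2}"
  let ?c1 = "fill 3 (andE (eqE (EVar 1) (EVar 3)) (andE (eqE (EVar 2) (EVar 4))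
       (andE (notE (eqE (EVar 3) (EVar 4))) (lessE (rdv 1 3 4) (ENum 2)))))"
  let ?round = "CSeq (fill 4 gammaE) (fill 3 (rdv 4 1 2))"
  let ?c4 = "fill 4 (orE (rdv 2 1 2) (rdv 3 1 2))"
  let ?c6 = "fill 4 (ECond (orE (rdv 3 1 2) (rdv 3 2 1))
        (add (add (ENum 2) (mul (EVar 3) (add (EVar 0) (ENum 1)))) (EVar 4)) (rdv 1 1 2))"
  define m1 where "m1 = sem w ?c1 env m"
  define m2 where "m2 = sem w (For 5 (For 6 ?round)) env m1"
  define m3 where "m3 = sem w ?c4 env m2"
  define m4 where "m4 = sem w (fill 2 (rdv 4 1 2)) env m3"
  define m5 where "m5 = sem w ?c6 env m4"
  define m6 where "m6 = sem w (fill 1 (rdv 4 1 2)) env m5"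
  have m6: "sem w split_com env m = m6"
    unfolding split_com_def sem.simps(2) m6_def m5_def m4_def m3_def m2_def m1_def ..
  have \<kappa>: "rep n m 1 \<kappa>" using st by (simp add: orient_state_def S)
  have e1: "ev w (andE (eqE (EVar 1) (EVar 3)) (andE (eqE (EVar 2) (EVar 4))
       (andE (notE (eqE (EVar 3) (EVar 4))) (lessE (rdv 1 3 4) (ENum 2))))) (env(1 := u, 2 := v)) m' =
      of_bool ((u, v) \<in> ?A0)" if "u \<in> {1..n}" "v \<in> {1..n}" "agree n 3 m m'" for u v m'
  proof -
    have r: "ev w (rdv 1 3 4) (env(1 := u, 2 := v)) m' = \<kappa> p q"
      using rdv_ev[OF agree_rep[OF that(3) _ \<kappa>], of "env(1 := u, 2 := v)" 3 4] env pq by simp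
    show ?thesis unfolding ev.simps(5) eq_ev less_ev const_ev r unfolding ev.simps(1) using env by simp
  qed
  have A1: "set_rep m1 3 ?A0" and ag1: "agree n 3 m m1"
    unfolding m1_def set_rep_def
    using sem_fill[where env=env and j=3 and f="\<lambda>u v. of_bool ((u, v) \<in> ?A0)" and m=m, OF env(1) _ e1] by simp_all
  have st1: "orient_state m1 e S" by (rule orient_state_agree[OF ag1 _ st]) simp
  let ?I = "\<lambda>m A. orient_state m e S \<and> set_rep m 3 A"
  have round: "?I (sem w ?round env' m') (gamma_step n \<kappa> A)" if I: "?I m' A" and env': "env' 0 = n" for m' A env'
  proof -
    define m'' where "m'' = sem w (fill 4 gammaE) env' m'"
    have "ev w gammaE (env'(1 := u, 2 := v)) m3 = of_bool ((u, v) \<in> gamma_step n \<kappa> A)"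
      if "u \<in> {1..n}" "v \<in> {1..n}" "agree n 4 m' m3" for u v m3
    proof (rule ev_gammaE)
      show "set_rep m3 3 A" using I agree_rep[OF that(3)] unfolding set_rep_def by simp
      show "rep n m3 1 \<kappa>" using I agree_rep[OF that(3)] unfolding orient_state_def S by simp
    qed (use env' that in simp_all)
    note F = sem_fill[where env=env' and j=4 and f="\<lambda>u v. of_bool ((u, v) \<in> gamma_step n \<kappa> A)" and m=m',
        OF env' _ this, folded m''_def, simplified]
    have st'': "orient_state m'' e S" using orient_state_agree[OF F(2)] I by simp
    note C = fill_copy[where env=env' and i=3, OF F(1) env', simplified]
    show ?thesis
      unfolding sem.simps(2) m''_def[symmetric] set_rep_def using C(1) orient_state_agree[OF C(2)] st'' by simp
  qed
  have "?I m2 (iter (\<lambda>_. iter (\<lambda>_. gamma_step n \<kappa>) n) n ?A0)"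
    unfolding m2_def sem.simps(3) env(1)
  proof (rule iter_rel[where R="?I"])
    show "?I m1 ?A0" using st1 A1 by blast
    fix k m' A assume I: "?I m' A"
    have "(env(5 := k)) 0 = n" using env by simp
    then show "?I (iter (\<lambda>k' m. sem w ?round (env(5 := k, 6 := k')) m) ((env(5 := k)) 0) m')
        (iter (\<lambda>_. gamma_step n \<kappa>) n A)"
      by (simp only:) (rule iter_rel[where R="?I"], rule I, rule round, simp_all add: env)
  qed
  moreover have "iter (\<lambda>_. iter (\<lambda>_. gamma_step n \<kappa>) n) n ?A0 = gamma_class n \<kappa> p q"
  proof -
    have "(\<lambda>_::nat. iter (\<lambda>_. gamma_step n \<kappa>) n) = (\<lambda>_. gamma_step n \<kappa> ^^ n)" by (simp add: fun_eq_iff iter_funpow)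
    then show ?thesis by (simp only: iter_funpow gamma_class_def funpow_mult)
  qed
  ultimately have st2: "orient_state m2 e S" and A2: "set_rep m2 3 (gamma_class n \<kappa> p q)" by simp_all
  define A where "A = gamma_class n \<kappa> p q"
  note A2 = A2[folded A_def]
  have e4: "ev w (orE (rdv 2 1 2) (rdv 3 1 2)) (env(1 := u, 2 := v)) m' = of_bool ((u, v) \<in> R \<union> A)"
    if "u \<in> {1..n}" "v \<in> {1..n}" "agree n 4 m2 m'" for u v m'
  proof -
    have "rep n m2 2 (\<lambda>u v. of_bool ((u, v) \<in> R))" "rep n m2 3 (\<lambda>u v. of_bool ((u, v) \<in> A))"
      using st2 A2 by (simp_all add: orient_state_def S set_rep_def)
    then have "ev w (rdv 2 1 2) (env(1 := u, 2 := v)) m' = of_bool ((u, v) \<in> R)"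
      "ev w (rdv 3 1 2) (env(1 := u, 2 := v)) m' = of_bool ((u, v) \<in> A)"
      using rdv_ev[OF agree_rep[OF that(3)], of _ _ "env(1 := u, 2 := v)" 1 2] env that by simp_all
    then show ?thesis unfolding ev.simps(5) const_ev by simp
  qed
  have B3: "rep n m3 4 (\<lambda>u v. of_bool ((u, v) \<in> R \<union> A))" and ag3: "agree n 4 m2 m3"
    unfolding m3_def
    using sem_fill[where env=env and j=4 and f="\<lambda>u v. of_bool ((u, v) \<in> R \<union> A)" and m=m2, OF env(1) _ e4] by simp_all
  have B4: "rep n m4 2 (\<lambda>u v. of_bool ((u, v) \<in> R \<union> A))" and ag4: "agree n 2 m3 m4"
    unfolding m4_def using fill_copy[where env=env and i=2, OF B3 env(1)] by simp_all
  have e4: "rep n m4 0 e" and K4: "rep n m4 1 \<kappa>" and A4: "rep n m4 3 (\<lambda>u v. of_bool ((u, v) \<in> A))"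
    using agree_rep[OF ag4] agree_rep[OF ag3] st2 A2 by (simp_all add: orient_state_def S set_rep_def)
  let ?\<kappa>' = "\<lambda>u v. if (u, v) \<in> A \<or> (v, u) \<in> A then pair_code n p q else \<kappa> u v"
  have e6: "ev w (ECond (orE (rdv 3 1 2) (rdv 3 2 1))
        (add (add (ENum 2) (mul (EVar 3) (add (EVar 0) (ENum 1)))) (EVar 4)) (rdv 1 1 2)) (env(1 := u, 2 := v)) m' = ?\<kappa>' u v"
    if "u \<in> {1..n}" "v \<in> {1..n}" "agree n 4 m4 m'" for u v m'
  proof -
    let ?e = "env(1 := u, 2 := v)"
    have r: "ev w (rdv 3 1 2) ?e m' = of_bool ((u, v) \<in> A)" "ev w (rdv 3 2 1) ?e m' = of_bool ((v, u) \<in> A)"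
      "ev w (rdv 1 1 2) ?e m' = \<kappa> u v"
      using rdv_ev[OF agree_rep[OF that(3) _ A4], of ?e 1 2] rdv_ev[OF agree_rep[OF that(3) _ A4], of ?e 2 1]
        rdv_ev[OF agree_rep[OF that(3) _ K4], of ?e 1 2] env that by simp_all
    have le: "p * (n + 1) \<le> n * n + n" using pq by (simp add: algebra_simps mult_le_mono add_mono)
    have b: "n + 1 < 2 ^ w" "p * (n + 1) < 2 ^ w" "2 + p * (n + 1) < 2 ^ w" "2 + p * (n + 1) + q < 2 ^ w"
      using le pq cube n by (intro word; simp; linarith)+
    have v: "ev w (EVar 0) ?e m' = n" "ev w (EVar 3) ?e m' = p" "ev w (EVar 4) ?e m' = q" using env by simp_all
    have 1: "ev w (add (EVar 0) (ENum 1)) ?e m' = n + 1"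
      using add_ev[of "EVar 0" ?e m' "ENum 1"] b(1) unfolding v const_ev by simp
    have 2: "ev w (mul (EVar 3) (add (EVar 0) (ENum 1))) ?e m' = p * (n + 1)"
      using mul_ev[of "EVar 3" ?e m' "add (EVar 0) (ENum 1)"] b(2) unfolding v 1 by simp
    have 3: "ev w (add (ENum 2) (mul (EVar 3) (add (EVar 0) (ENum 1)))) ?e m' = 2 + p * (n + 1)"
      using add_ev[of "ENum 2" ?e m' "mul (EVar 3) (add (EVar 0) (ENum 1))"] b(3) unfolding 2 const_ev by simp
    have "ev w (add (add (ENum 2) (mul (EVar 3) (add (EVar 0) (ENum 1)))) (EVar 4)) ?e m' = 2 + p * (n + 1) + q"
      using add_ev[of "add (ENum 2) (mul (EVar 3) (add (EVar 0) (ENum 1)))" ?e m' "EVar 4"] b(4) unfolding 3 v by simp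
    then have code: "ev w (add (add (ENum 2) (mul (EVar 3) (add (EVar 0) (ENum 1)))) (EVar 4)) ?e m' = pair_code n p q"
      by (simp add: pair_code_def)
    show ?thesis unfolding ev.simps(5) code r const_ev by simp
  qed
  have B5: "rep n m5 4 ?\<kappa>'" and ag5: "agree n 4 m4 m5"
    unfolding m5_def using sem_fill[where env=env and j=4 and f="?\<kappa>'" and m=m4, OF env(1) _ e6] by simp_all
  have B6: "rep n m6 1 ?\<kappa>'" and ag6: "agree n 1 m5 m6"
    unfolding m6_def using fill_copy[where env=env and i=1, OF B5 env(1)] by simp_all
  have sc: "split_class n p q S = (?\<kappa>', R \<union> A)"
    unfolding split_class_def S Let_def fst_conv snd_conv A_def ..
  have "rep n m6 0 e" "rep n m6 2 (\<lambda>u v. of_bool ((u, v) \<in> R \<union> A))"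
    using agree_rep[OF ag6] agree_rep[OF ag5] e4 B4 by simp_all
  then show ?thesis
    unfolding m6 sc orient_state_def set_rep_def fst_conv snd_conv using B6 by blast
qed

lemma sem_orient_com:
  assumes e: "rep n m 0 e" and env: "env 0 = n"
  shows "orient_state (sem w orient_com env m) e (orient n e)"
proof -
  define m1 where "m1 = sem w (fill 1 (rdv 0 1 2)) env m"
  define m2 where "m2 = sem w (fill 2 (ENum 0)) env m1"
  have m1: "rep n m1 1 e" "agree n 1 m m1"
    unfolding m1_def using fill_copy[where env=env and i=1, OF e env] by simp_all
  have "ev w (ENum 0) (env(1 := u, 2 := v)) m' = 0" for u v m' by (rule const_ev)
  from sem_fill[where env=env and j=2 and f="\<lambda>_ _. 0" and m=m1, OF env _ this]
  have m2: "rep n m2 2 (\<lambda>u v. 0)" "agree n 2 m1 m2" unfolding m2_def by simp_all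
  have "orient_state m2 e (e, {})"
    unfolding orient_state_def set_rep_def
    using agree_rep[OF m2(2)] agree_rep[OF m1(2)] m1(1) m2(1) e by simp
  then have "orient_state (iter (\<lambda>p m. iter (\<lambda>q m. sem w split_com (env(3 := p, 4 := q)) m) n m) n m2) e (orient n e)"
    unfolding orient_def
  proof (rule iter_rel[where R="\<lambda>m. orient_state m e"])
    fix p m S assume p: "p \<in> {1..n}" and S: "orient_state m e S"
    show "orient_state (iter (\<lambda>q m. sem w split_com (env(3 := p, 4 := q)) m) n m) e (iter (\<lambda>q. split_class n p q) n S)"
      by (rule iter_rel[where R="\<lambda>m. orient_state m e", OF S]) (rule sem_split_com, use env p in simp_all)
  qed
  then show ?thesis
    unfolding orient_com_def sem.simps(2,3) m1_def[symmetric] m2_def[symmetric] using env by simp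
qed

end

subsection \<open>Computing the labels\<close>

text \<open>Word \<open>p\<close> of the output: at even \<open>p\<close> the common label length,
  at odd \<open>p\<close> the address of the first column of row \<open>p div 2\<close> in region
  15. A label fits into the single word stored there.\<close>

definition cell :: "nat \<Rightarrow> nat \<Rightarrow> nat" where
  "cell n p = (if even p then 3 * field_width n + 3 else (15 * n + p div 2) * n)"

text \<open>
  The contents of the regions; column vectors are stored as matrices with equal columns. Regions
  \<open>16\<close> and \<open>17\<close> together hold the table of the lengths and addresses of the labels.
\<close>

definition table :: "nat \<Rightarrow> (nat \<times> nat) set \<Rightarrow> nat \<Rightarrow> nat \<Rightarrow> nat \<Rightarrow> nat" where
  "table n E j u v = (let c = seg_code n E in
     if j = 0 then edge_color E u v
     else if j = 2 then of_bool ((u, v) \<in> snd (orient n (edge_color E)))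
     else if j = 5 then c False u
     else if j = 6 then c True u
     else if j = 7 then comp_start n c u
     else if j = 8 then level n c (c False u)
     else if j = 9 then level n c (c True u)
     else if j = 10 then level n c (2 * comp_start n c u)
     else if j = 11 then comp_size n c u
     else if j = 12 then block n c u
     else if j = 13 then key n c False u
     else if j = 14 then key n c True u
     else if j = 15 then label_value n c u
     else if j = 16 then cell n ((u - 1) * n + (v - 1))
     else cell n (n * n + ((u - 1) * n + (v - 1))))"

lemma table_simps:
  "table n E 0 u v = edge_color E u v" "table n E 2 u v = of_bool ((u, v) \<in> snd (orient n (edge_color E)))"
  "table n E 5 u v = seg_code n E False u" "table n E 6 u v = seg_code n E True u"
  "table n E 7 u v = comp_start n (seg_code n E) u"
  "table n E 8 u v = level n (seg_code n E) (seg_code n E False u)"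
  "table n E 9 u v = level n (seg_code n E) (seg_code n E True u)"
  "table n E 10 u v = level n (seg_code n E) (2 * comp_start n (seg_code n E) u)"
  "table n E 11 u v = comp_size n (seg_code n E) u" "table n E 12 u v = block n (seg_code n E) u"
  "table n E 13 u v = key n (seg_code n E) False u" "table n E 14 u v = key n (seg_code n E) True u"
  "table n E 15 u v = label_value n (seg_code n E) u" "table n E 16 u v = cell n ((u - 1) * n + (v - 1))"
  "table n E 17 u v = cell n (n * n + ((u - 1) * n + (v - 1)))"
  by (simp_all add: table_def Let_def)

definition xE :: exp where
  "xE = mul (ENum 2) (countE 3 (rdv 2 3 1))"

definition yE :: exp where
  "yE = add (mul (ENum 2) (countE 3 (notE (eqE (rdv 2 3 1) (rdv 0 3 1))))) (ENum 1)"

definition no_cutE :: exp where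
  "no_cutE = exE 5 (notE (eqE (lessE (rdv 5 5 5) (mul (ENum 2) (EVar 3))) (lessE (rdv 6 5 5) (mul (ENum 2) (EVar 3)))))"

definition startE :: exp where
  "startE = EIter 1 3 (ENum 0) (ECond (lessE (rdv 5 1 1) (mul (ENum 2) (EVar 3))) (EVar (Suc 3))
     (ECond no_cutE (EVar (Suc 3)) (maxE (EVar (Suc 3)) (EVar 3))))"

definition level_ofE :: "exp \<Rightarrow> exp" where
  "level_ofE e = ELet 3 e (levelE 4 3)"

definition sizeE :: exp where
  "sizeE = countE 3 (eqE (rdv 7 3 3) (rdv 7 1 1))"

definition blockE :: exp where
  "blockE = mul (ENum 4) (EIter 1 3 (ENum 1)
     (ECond (lessE (rdv 11 1 1) (mul (ENum 2) (EVar (Suc 3)))) (EVar (Suc 3)) (mul (ENum 2) (EVar (Suc 3)))))"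

text \<open>Variables 3 and 4 hold the position to be ranked and its level; regions \<open>i\<close>
  and \<open>j\<close> hold the codes on one line and their levels.\<close>

definition rank_partE :: "nat \<Rightarrow> nat \<Rightarrow> exp" where
  "rank_partE i j = countE 5 (andE (eqE (rdv 7 5 5) (rdv 7 1 1))
     (ELet 7 (rdv i 5 5) (ELet 8 (rdv j 5 5) (beatsE 9 3 7 4 8))))"

definition keyE :: "nat \<Rightarrow> nat \<Rightarrow> exp" where
  "keyE i j = ELet 3 (rdv i 1 1) (ELet 4 (rdv j 1 1)
     (add (rdv 12 1 1) (add (rank_partE 5 8) (rank_partE 6 9))))"

definition widthE :: "nat \<Rightarrow> exp" where
  "widthE k = add (ENum 4) (EIter 1 k (ENum 0)
     (ECond (lessE (EOp Shl (ENum 1) (EVar (Suc k))) (EVar 0)) (add (EVar (Suc k)) (ENum 1)) (EVar (Suc k))))"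

definition placeE :: exp where
  "placeE = add (mul (EOp Div (rdv 7 1 1) (EOp Div (rdv 12 1 1) (ENum 4))) (mul (ENum 2) (rdv 12 1 1)))
     (sub (rdv 8 1 1) (rdv 10 1 1))"

definition valueE :: exp where
  "valueE = ELet 3 (widthE 5) (ELet 4 (EOp Shl (ENum 1) (EVar 3))
     (add (sub (add (rdv 9 1 1) (ENum 3)) (rdv 8 1 1)) (mul (ENum 8) (add (rdv 13 1 1)
       (mul (EVar 4) (add (rdv 14 1 1) (mul (EVar 4) placeE)))))))"

definition indexE :: exp where
  "indexE = add (mul (sub (EVar 1) (ENum 1)) (EVar 0)) (sub (EVar 2) (ENum 1))"

definition cellE :: "exp \<Rightarrow> exp" where
  "cellE p = ELet 3 p (ECond (EOp Mod (EVar 3) (ENum 2))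
     (mul (add (mul (ENum 15) (EVar 0)) (EOp Div (EVar 3) (ENum 2))) (EVar 0))
     (ELet 4 (widthE 5) (add (mul (ENum 3) (EVar 4)) (ENum 3))))"

definition encoder_com :: com where
  "encoder_com = CSeq orient_com (CSeq (fill 5 xE) (CSeq (fill 6 yE) (CSeq (fill 7 startE)
     (CSeq (fill 8 (level_ofE (rdv 5 1 1))) (CSeq (fill 9 (level_ofE (rdv 6 1 1)))
     (CSeq (fill 10 (level_ofE (mul (ENum 2) (rdv 7 1 1)))) (CSeq (fill 11 sizeE) (CSeq (fill 12 blockE)
     (CSeq (fill 13 (keyE 5 8)) (CSeq (fill 14 (keyE 6 9)) (CSeq (fill 15 valueE)
     (CSeq (fill 16 (cellE indexE)) (fill 17 (cellE (add (mul (EVar 0) (EVar 0)) indexE)))))))))))))))"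

context machine
begin

lemma add_val: "ev w a env m = x \<Longrightarrow> ev w b env m = y \<Longrightarrow> x + y < 2 ^ w \<Longrightarrow> ev w (add a b) env m = x + y"
  and mul_val: "ev w a env m = x \<Longrightarrow> ev w b env m = y \<Longrightarrow> x * y < 2 ^ w \<Longrightarrow> ev w (mul a b) env m = x * y"
  and sub_val: "ev w a env m = x \<Longrightarrow> ev w b env m = y \<Longrightarrow> y \<le> x \<Longrightarrow> x < 2 ^ w \<Longrightarrow> ev w (sub a b) env m = x - y"
  and div_val: "ev w a env m = x \<Longrightarrow> ev w b env m = y \<Longrightarrow> ev w (EOp Div a b) env m = x div y"
  and mod_val: "ev w a env m = x \<Longrightarrow> ev w b env m = y \<Longrightarrow> ev w (EOp Mod a b) env m = x mod y"
  and shl_val: "ev w b env m = y \<Longrightarrow> 2 ^ y < (2::nat) ^ w \<Longrightarrow> ev w (EOp Shl (ENum 1) b) env m = 2 ^ y"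
  and less_val: "ev w a env m = x \<Longrightarrow> ev w b env m = y \<Longrightarrow> ev w (lessE a b) env m = of_bool (x < y)"
  and var_val: "env i = x \<Longrightarrow> ev w (EVar i) env m = x"
  using add_ev[of a env m b] mul_ev[of a env m b] sub_ev[of b env m a] const_ev(2)[of env m] w_pos by auto

lemma ev_widthE:
  assumes "env 0 = n" "k \<noteq> 0"
  shows "ev w (widthE k) env m = field_width n"
proof -
  let ?f = "\<lambda>v a. ev w (ECond (lessE (EOp Shl (ENum 1) (EVar (Suc k))) (EVar 0)) (add (EVar (Suc k)) (ENum 1)) (EVar (Suc k)))
    (env(k := v, Suc k := a)) m"
  let ?g = "\<lambda>_ a. if 2 ^ a < n then a + 1 else a"
  have "iter ?f n 0 = iter ?g n 0 \<and> 2 ^ iter ?f n 0 < 2 * n"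
  proof (rule iter_rel[where R="\<lambda>a b. a = b \<and> 2 ^ a < 2 * n"])
    fix v a b :: nat assume "a = b \<and> 2 ^ a < 2 * n"
    then have ab: "a = b" and a: "2 ^ a < 2 * n" by auto
    let ?e = "env(k := v, Suc k := a)"
    have p: "(2::nat) ^ a < 2 ^ w" using a by (intro lin) simp
    have s: "a + 1 < 2 ^ w" using a less_exp[of a] n by (intro lin) linarith
    have e: "ev w (EVar (Suc k)) ?e m = a" "ev w (EVar 0) ?e m = n" using assms by simp_all
    have f: "?f v a = (if 2 ^ a < n then a + 1 else a)"
      unfolding ev.simps(5) less_val[OF shl_val[OF e(1) p] e(2)] add_val[OF e(1) const_ev(2) s] e by simp
    have "(2::nat) ^ (if 2 ^ a < n then a + 1 else a) < 2 * n" using a by simp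
    then show "?f v a = ?g v b \<and> 2 ^ ?f v a < 2 * n" unfolding f ab[symmetric] by blast
  qed (use n in simp)
  then have it: "iter ?f n 0 = iter ?g n 0" by blast
  have i: "ev w (EIter 1 k (ENum 0)
     (ECond (lessE (EOp Shl (ENum 1) (EVar (Suc k))) (EVar 0)) (add (EVar (Suc k)) (ENum 1)) (EVar (Suc k)))) env m = iter ?g n 0"
    unfolding ev.simps(6) assms(1) mult_1 const_ev it ..
  have "4 + iter ?g n 0 < 2 ^ w" using field_width_bounds(4)[OF n] n by (intro lin) (simp add: field_width_def)
  from add_val[OF const_ev(5) i this] show ?thesis unfolding widthE_def field_width_def .
qed

end

locale encoder_run = machine +
  fixes E :: "(nat \<times> nat) set"
  assumes perm: "permutation_graph n E"
begin

abbreviation "c \<equiv> seg_code n E"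
abbreviation "F \<equiv> table n E"

definition tab :: "(nat \<Rightarrow> nat) \<Rightarrow> nat set \<Rightarrow> bool" where
  "tab m J \<longleftrightarrow> (\<forall>j\<in>J. rep n m j (F j))"

lemma diag: obtains x y where "diagram n E x y c"
  using seg_code_diagram[OF perm] by blast

lemma c_less: "u \<in> {1..n} \<Longrightarrow> c b u < 2 * n"
  by (rule diag) (rule diagram.code_less)

lemma stage:
  assumes "tab m J" "j \<notin> J" "env 0 = n" "j \<le> 100"
    and "\<And>m' u v. tab m' J \<Longrightarrow> u \<in> {1..n} \<Longrightarrow> v \<in> {1..n} \<Longrightarrow> ev w e (env(1 := u, 2 := v)) m' = F j u v"
  shows "tab (sem w (fill j e) env m) (insert j J)"
proof -
  have ag: "tab m' J" if "agree n j m m'" for m'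
    unfolding tab_def
  proof
    fix j' assume "j' \<in> J"
    then show "rep n m' j' (F j')" using agree_rep[OF that, of j'] assms(1,2) unfolding tab_def by metis
  qed
  have "ev w e (env(1 := u, 2 := v)) m' = F j u v" if "u \<in> {1..n}" "v \<in> {1..n}" "agree n j m m'" for u v m'
    using assms(5)[OF ag[OF that(3)] that(1,2)] .
  from sem_fill[where env=env and j=j and m=m and f="F j", OF assms(3,4) this]
  show ?thesis using ag unfolding tab_def by blast
qed

lemma tab_rd:
  assumes "tab m J" "j \<in> J" "j \<le> 100" "env 0 = n" "env a = u" "u \<in> {1..n}" "env b = v" "v \<in> {1..n}"
  shows "ev w (rdv j a b) env m = F j u v"
  using rdv_ev[where f="F j" and env=env and a=a and b=b] assms unfolding tab_def by blast

lemma tab_codes: "tab m J \<Longrightarrow> {5, 6} \<subseteq> J \<Longrightarrow> codes_rep m c"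
  using c_less unfolding codes_rep_def tab_def by (auto simp: table_simps rep_def)

lemma xE_val:
  assumes t: "tab m J" "{0, 2} \<subseteq> J" and env: "env 0 = n" "env 1 = u" and u: "u \<in> {1..n}"
  shows "ev w xE env m = F 5 u v"
proof -
  let ?R = "snd (orient n (edge_color E))"
  have cnt: "ev w (countE 3 (rdv 2 3 1)) env m = card {v \<in> {1..n}. (v, u) \<in> ?R}"
  proof (rule ev_countE)
    fix v a assume v: "v \<in> {1..n}"
    have "ev w (rdv 2 3 1) (env(3 := v, Suc 3 := a)) m = F 2 v u"
      by (rule tab_rd[OF t(1)]) (use t env u v in auto)
    then show "ev w (rdv 2 3 1) (env(3 := v, Suc 3 := a)) m \<noteq> 0 \<longleftrightarrow> (v, u) \<in> ?R" by (simp add: table_simps)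
  qed (use env in simp)
  have e: "F 5 u v = 2 * card {v \<in> {1..n}. (v, u) \<in> ?R}" by (simp add: table_simps seg_code_def rank_def)
  then have "2 * card {v \<in> {1..n}. (v, u) \<in> ?R} < 2 ^ w" using c_less[OF u, of False] by (intro lin) (simp add: table_simps)
  from mul_val[OF const_ev(3) cnt this] show ?thesis unfolding xE_def e .
qed

lemma yE_val:
  assumes t: "tab m J" "{0, 2} \<subseteq> J" and env: "env 0 = n" "env 1 = u" and u: "u \<in> {1..n}"
  shows "ev w yE env m = F 6 u v"
proof -
  let ?Q = "\<lambda>v. ((v, u) \<in> snd (orient n (edge_color E))) \<noteq> ((v, u) \<in> E)"
  have cnt: "ev w (countE 3 (notE (eqE (rdv 2 3 1) (rdv 0 3 1)))) env m = card {v \<in> {1..n}. ?Q v}"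
  proof (rule ev_countE)
    fix v a assume v: "v \<in> {1..n}"
    have r: "ev w (rdv 2 3 1) (env(3 := v, Suc 3 := a)) m = F 2 v u" "ev w (rdv 0 3 1) (env(3 := v, Suc 3 := a)) m = F 0 v u"
      by (rule tab_rd[OF t(1)]; use t env u v in auto)+
    show "ev w (notE (eqE (rdv 2 3 1) (rdv 0 3 1))) (env(3 := v, Suc 3 := a)) m \<noteq> 0 \<longleftrightarrow> ?Q v"
      unfolding not_ev eq_ev r by (simp add: table_simps edge_color_def)
  qed (use env in simp)
  have e: "F 6 u v = 2 * card {v \<in> {1..n}. ?Q v} + 1" by (simp add: table_simps seg_code_def rank_def)
  then have "2 * card {v \<in> {1..n}. ?Q v} + 1 < 2 ^ w" using c_less[OF u, of True] by (intro lin) (simp add: table_simps)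
  moreover from this have "2 * card {v \<in> {1..n}. ?Q v} < 2 ^ w" by linarith
  ultimately show ?thesis unfolding yE_def e by (intro add_val mul_val const_ev cnt)
qed

lemma startE_val:
  assumes t: "tab m J" "{5, 6} \<subseteq> J" and env: "env 0 = n" "env 1 = u" and u: "u \<in> {1..n}"
  shows "ev w startE env m = F 7 u v"
proof -
  have two: "ev w (mul (ENum 2) (EVar 3)) e m = 2 * k" if "k \<in> {1..n}" "e 3 = k" for e k
  proof -
    have "2 * k < 2 ^ w" using that by (intro lin) simp
    then show ?thesis by (intro mul_val const_ev var_val that)
  qed
  have body: "ev w (ECond (lessE (rdv 5 1 1) (mul (ENum 2) (EVar 3))) (EVar (Suc 3))
     (ECond no_cutE (EVar (Suc 3)) (maxE (EVar (Suc 3)) (EVar 3)))) (env(3 := k, Suc 3 := a)) m =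
    (if 2 * k \<le> c False u \<and> cut n c k then max a k else a)" if k: "k \<in> {1..n}" for k a
  proof -
    let ?e = "env(3 := k, Suc 3 := a)"
    have e: "?e 3 = k" "?e (Suc 3) = a" by simp_all
    have r: "ev w (rdv 5 1 1) ?e m = F 5 u u"
      by (rule tab_rd[OF t(1)]) (use t env u in auto)
    have nc: "ev w no_cutE ?e m = of_bool (\<exists>v\<in>{1..n}. \<not> (c False v < 2 * k \<longleftrightarrow> c True v < 2 * k))"
      unfolding no_cutE_def
    proof (rule ev_exE)
      fix v b assume v: "v \<in> {1..n}"
      let ?d = "?e(5 := v, Suc 5 := b)"
      have "ev w (rdv 5 5 5) ?d m = F 5 v v" "ev w (rdv 6 5 5) ?d m = F 6 v v"
        by (rule tab_rd[OF t(1)]; use t env v in auto)+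
      then have r: "ev w (rdv 5 5 5) ?d m = c False v" "ev w (rdv 6 5 5) ?d m = c True v" by (simp_all add: table_simps)
      have "ev w (mul (ENum 2) (EVar 3)) ?d m = 2 * k" by (rule two[OF k]) simp
      then show "ev w (notE (eqE (lessE (rdv 5 5 5) (mul (ENum 2) (EVar 3))) (lessE (rdv 6 5 5) (mul (ENum 2) (EVar 3))))) ?d m \<noteq> 0
          \<longleftrightarrow> \<not> (c False v < 2 * k \<longleftrightarrow> c True v < 2 * k)"
        unfolding not_ev eq_ev less_ev r by simp
    qed (use env in simp)
    have F5: "F 5 u u = c False u" by (simp add: table_simps)
    show ?thesis
      unfolding ev.simps(5) less_ev r nc two[where e="?e" and k=k, OF k e(1)] F5 unfolding ev.simps(1) e by (auto simp: cut_def not_le max_def)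
  qed
  have "ev w startE env m = comp_start n c u"
    unfolding startE_def ev.simps(6) env(1) mult_1 const_ev comp_start_def by (rule iter_cong) (rule body)
  then show ?thesis by (simp add: table_simps)
qed

lemma level_ofE_val:
  assumes t: "tab m J" "{5, 6} \<subseteq> J" and env: "env 0 = n" and e: "ev w e env m = z" "z < 2 * n"
  shows "ev w (level_ofE e) env m = level n c z"
  using ev_levelE[OF tab_codes[OF t], of "env(3 := z)" 3 4] assms by (simp add: level_ofE_def)

lemma level_le: "tab m J \<Longrightarrow> {5, 6} \<subseteq> J \<Longrightarrow> z < 2 * n \<Longrightarrow> level n c z \<le> 2 * n + 1"
  using ev_levelE[OF tab_codes, of m J "(\<lambda>_. 0)(0 := n, 3 := z)" 3 4] by simp

lemma sizeE_val:
  assumes t: "tab m J" "7 \<in> J" and env: "env 0 = n" "env 1 = u" and u: "u \<in> {1..n}"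
  shows "ev w sizeE env m = F 11 u v"
proof -
  have "ev w sizeE env m = card {v \<in> {1..n}. comp_start n c v = comp_start n c u}"
    unfolding sizeE_def
  proof (rule ev_countE)
    fix v a assume v: "v \<in> {1..n}"
    have r: "ev w (rdv 7 3 3) (env(3 := v, Suc 3 := a)) m = F 7 v v" "ev w (rdv 7 1 1) (env(3 := v, Suc 3 := a)) m = F 7 u u"
      by (rule tab_rd[OF t(1)]; use t env u v in auto)+
    show "ev w (eqE (rdv 7 3 3) (rdv 7 1 1)) (env(3 := v, Suc 3 := a)) m \<noteq> 0 \<longleftrightarrow> comp_start n c v = comp_start n c u"
      unfolding eq_ev r by (simp add: table_simps)
  qed (use env in simp)
  then show ?thesis by (simp add: table_simps comp_size_def)
qed

lemma blockE_val:
  assumes t: "tab m J" "11 \<in> J" and env: "env 0 = n" "env 1 = u" and u: "u \<in> {1..n}"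
  shows "ev w blockE env m = F 12 u v"
proof -
  have s: "comp_size n c u \<le> n" by (rule diag) (rule diagram.comp_size_bounds(2)[OF _ u])
  let ?f = "\<lambda>k a. ev w (ECond (lessE (rdv 11 1 1) (mul (ENum 2) (EVar (Suc 3)))) (EVar (Suc 3)) (mul (ENum 2) (EVar (Suc 3))))
    (env(3 := k, Suc 3 := a)) m"
  let ?g = "\<lambda>(_::nat) a. if 2 * a \<le> comp_size n c u then 2 * a else a"
  have it: "iter ?f n 1 = iter ?g n 1 \<and> iter ?g n 1 \<le> n + 0 * n"
  proof (rule iter_eq_bounded)
    fix k a assume k: "k \<in> {1..n}" and a: "a \<le> n + 0 * (n - k)"
    let ?e = "env(3 := k, Suc 3 := a)"
    have "ev w (rdv 11 1 1) ?e m = F 11 u u" by (rule tab_rd[OF t(1)]) (use t env u in auto)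
    then have r: "ev w (rdv 11 1 1) ?e m = comp_size n c u" by (simp add: table_simps)
    have "2 * a < 2 ^ w" using a by (intro lin) simp
    then have m2: "ev w (mul (ENum 2) (EVar (Suc 3))) ?e m = 2 * a" by (intro mul_val const_ev var_val) simp_all
    have v: "ev w (EVar (Suc 3)) ?e m = a" by simp
    show "?f k a = ?g k a \<and> ?g k a \<le> n + 0 * (n - k) + 0"
      unfolding ev.simps(5) less_ev r m2 v using s a by simp
  qed (use n in simp)
  have "ev w (EIter 1 3 (ENum 1)
     (ECond (lessE (rdv 11 1 1) (mul (ENum 2) (EVar (Suc 3)))) (EVar (Suc 3)) (mul (ENum 2) (EVar (Suc 3))))) env m = iter ?g n 1"
    unfolding ev.simps(6) env(1) mult_1 const_ev by (rule it[THEN conjunct1])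
  moreover have "4 * iter ?g n 1 < 2 ^ w" using it by (intro lin) simp
  ultimately have "ev w blockE env m = 4 * iter ?g n 1" unfolding blockE_def by (intro mul_val const_ev)
  then show ?thesis by (simp add: table_simps block_def)
qed

lemma rank_partE_val:
  assumes t: "tab m J" "{5, 6, 7, i, j} \<subseteq> J" "i \<le> 100" "j \<le> 100"
    and env: "env 0 = n" "env 1 = u" "env 3 = z" "env 4 = level n c z" and u: "u \<in> {1..n}" and z: "z < 2 * n"
    and F: "\<And>v. F i v v = c b v" "\<And>v. F j v v = level n c (c b v)"
  shows "ev w (rank_partE i j) env m = card {v \<in> {1..n}. comp_start n c v = comp_start n c u \<and> beats n c z (c b v)}"
  unfolding rank_partE_def
proof (rule ev_countE)
  have J: "{5, 6} \<subseteq> J" using t(2) by simp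
  fix v a assume v: "v \<in> {1..n}"
  let ?e = "env(5 := v, Suc 5 := a)"
  have r: "ev w (rdv 7 5 5) ?e m = F 7 v v" "ev w (rdv 7 1 1) ?e m = F 7 u u"
    by (rule tab_rd[OF t(1)]; use t env u v in auto)+
  have 7: "ev w (rdv i 5 5) ?e m = c b v"
    by (subst F(1)[symmetric], rule tab_rd[OF t(1)]) (use t env v in auto)
  let ?e7 = "?e(7 := c b v)"
  have 8: "ev w (rdv j 5 5) ?e7 m = level n c (c b v)"
    by (subst F(2)[symmetric], rule tab_rd[OF t(1)]) (use t env v in auto)
  let ?e8 = "?e7(8 := level n c (c b v))"
  have "ev w (beatsE 9 3 7 4 8) ?e8 m \<noteq> 0 \<longleftrightarrow> beats n c (?e8 3) (?e8 7)"
    by (rule ev_beatsE[OF tab_codes[OF t(1) J]])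
      (use env z c_less[OF v, of b] level_le[OF t(1) J] in auto)
  then have "ev w (beatsE 9 3 7 4 8) ?e8 m \<noteq> 0 \<longleftrightarrow> beats n c z (c b v)" using env by simp
  then show "ev w (andE (eqE (rdv 7 5 5) (rdv 7 1 1)) (ELet 7 (rdv i 5 5) (ELet 8 (rdv j 5 5) (beatsE 9 3 7 4 8)))) ?e m \<noteq> 0 \<longleftrightarrow>
      comp_start n c v = comp_start n c u \<and> beats n c z (c b v)"
    unfolding and_ev eq_ev r ev.simps(7) 7 8 by (simp add: table_simps)
qed (use env in simp)

lemma keyE_val:
  assumes t: "tab m J" "{5, 6, 7, 8, 9, 12} \<subseteq> J" "i \<in> J" "j \<in> J" "i \<le> 100" "j \<le> 100"
    and env: "env 0 = n" "env 1 = u" and u: "u \<in> {1..n}"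
    and F: "F i u u = c b u" "F j u u = level n c (c b u)"
  shows "ev w (keyE i j) env m = key n c b u"
proof -
  have 3: "ev w (rdv i 1 1) env m = c b u"
    by (subst F(1)[symmetric], rule tab_rd[OF t(1)]) (use t env u in auto)
  let ?e3 = "env(3 := c b u)"
  have 4: "ev w (rdv j 1 1) ?e3 m = level n c (c b u)"
    by (subst F(2)[symmetric], rule tab_rd[OF t(1)]) (use t env u in auto)
  let ?e = "?e3(4 := level n c (c b u))"
  have "ev w (rdv 12 1 1) ?e m = F 12 u u" by (rule tab_rd[OF t(1)]) (use t env u in auto)
  then have bl: "ev w (rdv 12 1 1) ?e m = block n c u" by (simp add: table_simps)
  let ?C = "\<lambda>d. card {v \<in> {1..n}. comp_start n c v = comp_start n c u \<and> beats n c (c b u) (c d v)}"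
  have p: "ev w (rank_partE 5 8) ?e m = ?C False" "ev w (rank_partE 6 9) ?e m = ?C True"
    by (rule rank_partE_val[OF t(1)]; use t env u c_less[OF u] in \<open>auto simp: table_simps\<close>)+
  have "key n c b u < 2 ^ field_width n" by (rule diag) (rule diagram.key_less[OF _ u])
  then have "key n c b u < 2 ^ w" using field_width_bounds(2)[OF n] by (intro lin) linarith
  then have "block n c u + (?C False + ?C True) < 2 ^ w" by (simp add: key_def local_rank_def)
  moreover from this have "?C False + ?C True < 2 ^ w" by linarith
  ultimately have "ev w (add (rdv 12 1 1) (add (rank_partE 5 8) (rank_partE 6 9))) ?e m = block n c u + (?C False + ?C True)"
    by (intro add_val bl p)
  then show ?thesis unfolding keyE_def ev.simps(7) 3 4 by (simp add: key_def local_rank_def)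
qed

lemma valueE_val:
  assumes t: "tab m J" "{7, 8, 9, 10, 12, 13, 14} \<subseteq> J" and env: "env 0 = n" "env 1 = u" and u: "u \<in> {1..n}"
  shows "ev w valueE env m = F 15 u v"
proof -
  obtain x y where "diagram n E x y c" by (rule diag)
  then interpret diagram n E x y c .
  let ?fw = "field_width n" and ?R = "2 ^ field_width n :: nat"
  have R: "?R < 2 ^ w" using field_width_bounds(2)[OF n] by (intro lin) linarith
  let ?e3 = "env(3 := ?fw)" and ?e = "env(3 := ?fw, 4 := ?R)"
  have 3: "ev w (widthE 5) env m = ?fw" by (rule ev_widthE) (use env in auto)
  have 4: "ev w (EOp Shl (ENum 1) (EVar 3)) ?e3 m = ?R" by (rule shl_val[OF _ R]) simp
  have "ev w (rdv j 1 1) ?e m = F j u u" if "j \<in> {7, 8, 9, 10, 12, 13, 14}" for j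
    by (rule tab_rd[OF t(1)]) (use that t env u in auto)
  from this[of 7] this[of 8] this[of 9] this[of 10] this[of 12] this[of 13] this[of 14]
  have r: "ev w (rdv 7 1 1) ?e m = comp_start n c u" "ev w (rdv 8 1 1) ?e m = level n c (c False u)"
    "ev w (rdv 9 1 1) ?e m = level n c (c True u)" "ev w (rdv 10 1 1) ?e m = level n c (2 * comp_start n c u)"
    "ev w (rdv 12 1 1) ?e m = block n c u" "ev w (rdv 13 1 1) ?e m = key n c False u" "ev w (rdv 14 1 1) ?e m = key n c True u"
    by (simp_all add: table_simps)
  have R4: "ev w (EVar 4) ?e m = ?R" by simp
  define V where "V = label_value n c u"
  have "V < 2 ^ (3 * ?fw + 3)" unfolding V_def by (rule label_value_less[OF u])
  also have "(2::nat) ^ (3 * ?fw + 3) = 8 * (?R * ?R * ?R)"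
    by (simp only: power_add mult.commute[of 3 "field_width n"] power_mult) (simp add: power3_eq_cube)
  also have "8 * (?R * ?R * ?R) \<le> 8 * ((32 * n) * (32 * n) * (32 * n))"
    using field_width_bounds(2)[OF n] by (intro mult_le_mono2 mult_le_mono) simp_all
  also have "\<dots> \<le> 1000000 * (n * n * n)" by simp
  finally have V: "V < 2 ^ w" by (intro word) simp
  define q where "q = comp_start n c u div (block n c u div 4) * (2 * block n c u)"
  define l where "l = level n c (c False u) - level n c (2 * comp_start n c u)"
  have Veq: "V = skew n c u + 8 * (key n c False u + ?R * (key n c True u + ?R * (q + l)))"
    by (simp only: V_def label_value_def place_def q_def l_def)
  \<comment> \<open>No intermediate result of this Horner scheme exceeds the final value, so the
    bound on \<open>V\<close> rules out overflow throughout.\<close>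
  have le: "x \<le> ?R * x" for x by simp
  define X where "X = q + l"
  define Y where "Y = key n c True u + ?R * X"
  define Z where "Z = key n c False u + ?R * Y"
  have VZ: "V = skew n c u + 8 * Z" by (simp only: Veq X_def Y_def Z_def)
  have b: "8 * Z < 2 ^ w" "Z < 2 ^ w" "?R * Y < 2 ^ w" "Y < 2 ^ w" "?R * X < 2 ^ w" "X < 2 ^ w"
    using V le[of X] le[of Y] VZ Z_def Y_def by linarith+
  have lv: "level n c (c b u) \<le> 4 * n + 8" for b
  proof -
    have "c b u < chain n c (2 * n + of_bool b)"
      using chain_ge[of 0 "2 * n + of_bool b"] code_less[OF u, of b] by (simp add: chain_0)
    moreover have "even (2 * n + of_bool b) \<longleftrightarrow> even (c b u)" by (cases b) (simp_all add: code_parity)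
    ultimately have "level n c (c b u) \<le> 2 * n + of_bool b" using level_le_iff[OF code_less[OF u]] by blast
    then show ?thesis by (cases b) simp_all
  qed
  have lw: "level n c (c True u) + 3 < 2 ^ w" "level n c (c False u) < 2 ^ w"
    using lv[of True] lv[of False] n by (intro lin; linarith)+
  have bw: "2 * block n c u < 2 ^ w"
  proof -
    have "block n c u < ?R" using key_bounds(1)[OF u, of False] key_less[OF u, of False] by linarith
    then show ?thesis using field_width_bounds(2)[OF n] by (intro lin) linarith
  qed
  have lle: "level n c (c False u) \<le> level n c (c True u) + 3" using level_other_line[OF u, of True] by simp
  have sk: "ev w (sub (add (rdv 9 1 1) (ENum 3)) (rdv 8 1 1)) ?e m = skew n c u"
    unfolding skew_def by (intro sub_val add_val const_ev r lw lle)
  have "q < 2 ^ w" using b(6) X_def by linarith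
  then have "ev w placeE ?e m = q + l"
    using b(6) unfolding placeE_def q_def l_def X_def
    by (intro add_val mul_val div_val sub_val const_ev r bw lw level_offset(1)[OF u])
  then have pl: "ev w placeE ?e m = X" by (simp only: X_def)
  have "ev w (add (sub (add (rdv 9 1 1) (ENum 3)) (rdv 8 1 1)) (mul (ENum 8) (add (rdv 13 1 1)
       (mul (EVar 4) (add (rdv 14 1 1) (mul (EVar 4) placeE)))))) ?e m = V"
    using b V unfolding VZ Z_def Y_def by (intro add_val mul_val sk pl r R4 const_ev)
  then show ?thesis unfolding valueE_def ev.simps(7) 3 4 by (simp add: table_simps V_def)
qed

lemma indexE_val:
  assumes "env 0 = n" "env 1 = u" "env 2 = v" "u \<in> {1..n}" "v \<in> {1..n}"
  shows "ev w indexE env m = (u - 1) * n + (v - 1)" "(u - 1) * n + (v - 1) < n * n"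
proof -
  have "(u - 1) * n + (v - 1) < (u - 1) * n + n" using assms by auto
  also have "\<dots> = (u - 1 + 1) * n" by (simp only: add_mult_distrib mult_1)
  also have "\<dots> \<le> n * n" using assms by (intro mult_le_mono1) auto
  finally show lt: "(u - 1) * n + (v - 1) < n * n" .
  then have "(u - 1) * n + (v - 1) < 2 ^ w" "(u - 1) * n < 2 ^ w" using cube(2) by (intro word; linarith)+
  moreover have "u < 2 ^ w" "v < 2 ^ w" using assms by (intro lin; simp)+
  ultimately show "ev w indexE env m = (u - 1) * n + (v - 1)"
    unfolding indexE_def using assms by (intro add_val mul_val sub_val const_ev var_val) auto
qed

lemma cellE_val:
  assumes e: "ev w e env m = p" "p < 2 * (n * n)" and env: "env 0 = n"
  shows "ev w (cellE e) env m = cell n p"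
proof -
  let ?e = "env(3 := p)"
  have v: "ev w (EVar 3) ?e m = p" "ev w (EVar 0) ?e m = n" using env by simp_all
  have md: "ev w (EOp Mod (EVar 3) (ENum 2)) ?e m = p mod 2" by (intro mod_val v const_ev)
  have "p div 2 < n * n" by (rule less_mult_imp_div_less) (use e(2) in simp)
  moreover have "n \<le> n * n" using n by simp
  ultimately have "15 * n + p div 2 \<le> 16 * (n * n)" by linarith
  then have "(15 * n + p div 2) * n \<le> 16 * (n * n) * n" by (intro mult_le_mono1)
  also have "16 * (n * n) * n \<le> 1000000 * (n * n * n)" by simp
  finally have b1: "(15 * n + p div 2) * n < 2 ^ w" by (rule word)
  have b2: "15 * n + p div 2 < 2 ^ w"
    using \<open>15 * n + p div 2 \<le> 16 * (n * n)\<close> cube(2) by (intro word) linarith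
  have b3: "15 * n < 2 ^ w" using b2 by linarith
  have fifteen: "ev w (ENum 15) ?e m = 15" by (rule num_ev) simp
  have 1: "ev w (mul (add (mul (ENum 15) (EVar 0)) (EOp Div (EVar 3) (ENum 2))) (EVar 0)) ?e m = (15 * n + p div 2) * n"
    by (intro mul_val add_val div_val v const_ev fifteen b1 b2 b3)
  have wd: "ev w (widthE 5) ?e m = field_width n" by (rule ev_widthE) (use env in simp_all)
  have b4: "3 * field_width n + 3 < 2 ^ w" using field_width_bounds(4)[OF n] n by (intro lin) linarith
  then have b5: "3 * field_width n < 2 ^ w" by linarith
  have "ev w (add (mul (ENum 3) (EVar 4)) (ENum 3)) (?e(4 := field_width n)) m = 3 * field_width n + 3"
    by (intro add_val mul_val const_ev var_val b4 b5) simp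
  then show ?thesis
    unfolding cellE_def ev.simps(7) e ev.simps(5) md 1 wd cell_def by (simp add: even_iff_mod_2_eq_zero)
qed

theorem encoder_com_table:
  assumes m: "rep n m 0 (edge_color E)" and env: "env 0 = n"
  shows "tab (sem w encoder_com env m) {0, 2, 5, 6, 7, 8, 9, 10, 11, 12, 13, 14, 15, 16, 17}"
proof -
  \<comment> \<open>Regions 1, 3 and 4 are working space of the orientation, so \<open>?J\<close>
    records no contents for them.\<close>
  let ?J = "\<lambda>k. {0, 2} \<union> {5..<k}"
  define m0 where "m0 = sem w orient_com env m"
  have "orient_state m0 (edge_color E) (orient n (edge_color E))" unfolding m0_def by (rule sem_orient_com[where env=env, OF m env])
  then have t: "tab m0 (?J 5)" by (simp add: tab_def orient_state_def set_rep_def table_simps rep_def)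
  have st: "tab (sem w (fill j e) env m) (?J k)"
    if "tab m (?J j)"
      "\<And>m' u v. tab m' (?J j) \<Longrightarrow> u \<in> {1..n} \<Longrightarrow> v \<in> {1..n} \<Longrightarrow> ev w e (env(1 := u, 2 := v)) m' = F j u v"
      "5 \<le> j" "j \<le> 100" "k = Suc j" for j k e m
  proof -
    have "?J k = insert j (?J j)" using that(3,5) by auto
    then show ?thesis using stage[where e=e and env=env, OF that(1) _ env that(4,2)] that(3) by simp
  qed
  have E: "(env(1 := u, 2 := v)) 0 = n" "(env(1 := u, 2 := v)) 1 = u" "(env(1 := u, 2 := v)) 2 = v" for u v
    using env by simp_all
  have rd: "ev w (rdv j 1 1) (env(1 := u, 2 := v)) m' = F j u u" if "tab m' J" "u \<in> {1..n}" "j \<in> J" "j \<le> 100" for j m' J u v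
    by (rule tab_rd[where env="env(1 := u, 2 := v)", OF that(1,3,4)]) (use that env in simp_all)
  have start: "2 * comp_start n c u < 2 * n" if "u \<in> {1..n}" for u
  proof (rule diag)
    fix x y assume "diagram n E x y c"
    then show ?thesis using diagram.comp_start_le[of n E x y c u] c_less[OF that, of False] by simp
  qed
  have lev: "ev w (level_ofE e) env' m' = level n c z"
    if "tab m' J" "{5, 6} \<subseteq> J" "env' 0 = n" "ev w e env' m' = z" "z < 2 * n" for m' J env' e z
    by (rule level_ofE_val[OF that])
  define m5 where "m5 = sem w (fill 5 xE) env m0"
  have t: "tab m5 (?J 6)" unfolding m5_def
    by (rule st[OF t], rule xE_val, assumption) (use env in auto)
  define m6 where "m6 = sem w (fill 6 yE) env m5"
  have t: "tab m6 (?J 7)" unfolding m6_def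
    by (rule st[OF t], rule yE_val, assumption) (use env in auto)
  define m7 where "m7 = sem w (fill 7 startE) env m6"
  have t: "tab m7 (?J 8)" unfolding m7_def
    by (rule st[OF t], rule startE_val, assumption) (use env in auto)
  define m8 where "m8 = sem w (fill 8 (level_ofE (rdv 5 1 1))) env m7"
  have t: "tab m8 (?J 9)" unfolding m8_def
  proof (rule st[OF t])
    fix m' u v assume t: "tab m' (?J 8)" and u: "u \<in> {1..n}"
    show "ev w (level_ofE (rdv 5 1 1)) (env(1 := u, 2 := v)) m' = F 8 u v"
      unfolding table_simps by (rule lev[OF t]) (use env rd[OF t u, of 5] c_less[OF u] in \<open>auto simp: table_simps\<close>)
  qed simp_all
  define m9 where "m9 = sem w (fill 9 (level_ofE (rdv 6 1 1))) env m8"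
  have t: "tab m9 (?J 10)" unfolding m9_def
  proof (rule st[OF t])
    fix m' u v assume t: "tab m' (?J 9)" and u: "u \<in> {1..n}"
    show "ev w (level_ofE (rdv 6 1 1)) (env(1 := u, 2 := v)) m' = F 9 u v"
      unfolding table_simps by (rule lev[OF t]) (use env rd[OF t u, of 6] c_less[OF u] in \<open>auto simp: table_simps\<close>)
  qed simp_all
  define m10 where "m10 = sem w (fill 10 (level_ofE (mul (ENum 2) (rdv 7 1 1)))) env m9"
  have t: "tab m10 (?J 11)" unfolding m10_def
  proof (rule st[OF t])
    fix m' u v assume t: "tab m' (?J 10)" and u: "u \<in> {1..n}"
    have "2 * comp_start n c u < 2 ^ w" using start[OF u] by (intro lin) simp
    then have val: "ev w (mul (ENum 2) (rdv 7 1 1)) (env(1 := u, 2 := v)) m' = 2 * comp_start n c u"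
      by (intro mul_val const_ev) (use rd[OF t u, of 7] in \<open>simp_all add: table_simps del: ev.simps\<close>)
    show "ev w (level_ofE (mul (ENum 2) (rdv 7 1 1))) (env(1 := u, 2 := v)) m' = F 10 u v"
      unfolding table_simps by (rule lev[OF t]) (use val env start[OF u] in auto)
  qed simp_all
  define m11 where "m11 = sem w (fill 11 sizeE) env m10"
  have t: "tab m11 (?J 12)" unfolding m11_def
    by (rule st[OF t], rule sizeE_val, assumption) (use env in auto)
  define m12 where "m12 = sem w (fill 12 blockE) env m11"
  have t: "tab m12 (?J 13)" unfolding m12_def
    by (rule st[OF t], rule blockE_val, assumption) (use env in auto)
  define m13 where "m13 = sem w (fill 13 (keyE 5 8)) env m12"
  have t: "tab m13 (?J 14)" unfolding m13_def
  proof (rule st[OF t])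
    fix m' u v assume t: "tab m' (?J 13)" and u: "u \<in> {1..n}"
    show "ev w (keyE 5 8) (env(1 := u, 2 := v)) m' = F 13 u v"
      unfolding table_simps by (rule keyE_val[OF t]) (use env u in \<open>auto simp: table_simps\<close>)
  qed simp_all
  define m14 where "m14 = sem w (fill 14 (keyE 6 9)) env m13"
  have t: "tab m14 (?J 15)" unfolding m14_def
  proof (rule st[OF t])
    fix m' u v assume t: "tab m' (?J 14)" and u: "u \<in> {1..n}"
    show "ev w (keyE 6 9) (env(1 := u, 2 := v)) m' = F 14 u v"
      unfolding table_simps by (rule keyE_val[OF t]) (use env u in \<open>auto simp: table_simps\<close>)
  qed simp_all
  define m15 where "m15 = sem w (fill 15 valueE) env m14"
  have t: "tab m15 (?J 16)" unfolding m15_def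
    by (rule st[OF t], rule valueE_val, assumption) (use env in auto)
  define m16 where "m16 = sem w (fill 16 (cellE indexE)) env m15"
  have t: "tab m16 (?J 17)" unfolding m16_def
  proof (rule st[OF t])
    fix m' u v assume uv: "u \<in> {1..n}" "v \<in> {1..n}"
    note i = indexE_val[where env="env(1 := u, 2 := v)", OF E uv]
    show "ev w (cellE indexE) (env(1 := u, 2 := v)) m' = F 16 u v"
      unfolding table_simps by (rule cellE_val[OF i(1)]) (use i(2) env in simp_all)
  qed simp_all
  define m17 where "m17 = sem w (fill 17 (cellE (add (mul (EVar 0) (EVar 0)) indexE))) env m16"
  have t: "tab m17 (?J 18)" unfolding m17_def
  proof (rule st[OF t])
    fix m' u v assume uv: "u \<in> {1..n}" "v \<in> {1..n}"
    note i = indexE_val[where env="env(1 := u, 2 := v)", OF E uv]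
    have "n * n + ((u - 1) * n + (v - 1)) < 2 ^ w" "n * n < 2 ^ w" using i(2) cube(2) by (intro word; linarith)+
    then have val: "ev w (add (mul (EVar 0) (EVar 0)) indexE) (env(1 := u, 2 := v)) m' = n * n + ((u - 1) * n + (v - 1))"
      by (intro add_val mul_val var_val i(1)) (use env in simp_all)
    show "ev w (cellE (add (mul (EVar 0) (EVar 0)) indexE)) (env(1 := u, 2 := v)) m' = F 17 u v"
      unfolding table_simps by (rule cellE_val[OF val]) (use i(2) env in simp_all)
  qed simp_all
  have "sem w encoder_com env m = m17"
    unfolding encoder_com_def sem.simps(2) m17_def m16_def m15_def m14_def m13_def m12_def m11_def m10_def
      m9_def m8_def m7_def m6_def m5_def m0_def ..
  then show ?thesis using t unfolding tab_def by auto
qed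

end

subsection \<open>The encoding program\<close>

lemma word_size_log: "word_size 40 b n w \<Longrightarrow> 40 * (1 + log 2 (real n)) \<le> real w"
  by (simp add: word_size_def)

text \<open>The constant 40 dominates both \<open>30 + 3 * log 2 n\<close>, needed here, and
  \<open>3 * log 2 n + 18\<close>, needed for a label to fit into one word.\<close>

lemma machine_word_size:
  assumes "1 \<le> n" "word_size 40 b n w"
  shows "machine w n"
proof
  show "1 \<le> n" by fact
  let ?x = "2 ^ 30 * (real n * real n * real n)"
  have l0: "0 \<le> log 2 (real n)" using assms(1) by simp
  have "log 2 ?x = log 2 (2 ^ 30) + (log 2 (real n) + log 2 (real n) + log 2 (real n))"
    by (simp only: log_mult) (use assms(1) in simp)
  also have "log 2 (2 ^ 30 :: real) = 30" by (subst log_pow_cancel) auto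
  finally have "log 2 ?x \<le> real w" using word_size_log[OF assms(2)] l0 by simp
  then have "2 powr (log 2 ?x) \<le> 2 powr (real w)" by (intro powr_mono) simp_all
  moreover have "2 powr (log 2 ?x) = ?x" using assms(1) by (intro powr_log_cancel) simp_all
  ultimately have "real (2 ^ 30 * (n * n * n)) \<le> real (2 ^ w)" by (simp add: powr_realpow)
  then show "2 ^ 30 * (n * n * n) \<le> (2::nat) ^ w" by (simp only: of_nat_le_iff)
qed

lemma label_fits:
  assumes "1 \<le> n" "word_size 40 b n w"
  shows "3 * field_width n + 3 \<le> w"
proof -
  have "real (3 * field_width n + 3) \<le> 3 * (log 2 (real n) + 5) + 3"
    using log_field_width[OF assms(1)] by simp
  also have "\<dots> \<le> real w"
  proof -
    have "0 \<le> log 2 (real n)" using assms(1) by simp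
    then show ?thesis using word_size_log[OF assms(2)] by argo
  qed
  finally show ?thesis by (simp only: of_nat_le_iff)
qed

lemma pack_single:
  assumes "0 < length l" "length l \<le> w"
  shows "pack w l = [label_number l]"
proof -
  have "w * Suc 1 = w + w" by simp
  then have "w * 1 \<le> length l + w - 1" "length l + w - 1 < w * Suc 1" using assms by linarith+
  then have "(length l + w - 1) div w = 1" by (rule div_nat_eqI)
  then show ?thesis using assms by (simp add: pack_def label_number_def)
qed

lemma nth_concat_uniform:
  assumes "\<forall>xs\<in>set xss. length xs = n" "i < length xss" "k < n"
  shows "concat xss ! (i * n + k) = xss ! i ! k \<and> i * n + k < length (concat xss)"
  using assms
proof (induction xss arbitrary: i)
  case (Cons xs xss)
  show ?case
  proof (cases i)
    case (Suc i')
    then show ?thesis using Cons.IH[of i'] Cons.prems by (simp add: nth_append)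
  qed (use Cons.prems in \<open>simp add: nth_append\<close>)
qed simp

lemma encoder_input_rep:
  assumes "machine w n"
  shows "rep n (mem (encoder_input w n E)) 0 (edge_color E)" "reg (encoder_input w n E) 0 = n"
proof -
  interpret machine w n by fact
  show "reg (encoder_input w n E) 0 = n" using lin[of n] by (simp add: encoder_input_def init_state_def)
  show "rep n (mem (encoder_input w n E)) 0 (edge_color E)"
    unfolding rep_def
  proof (intro ballI)
    fix u v assume uv: "u \<in> {1..n}" "v \<in> {1..n}"
    define xss where "xss = map (\<lambda>u. map (\<lambda>v. of_bool ((u, v) \<in> E) :: nat) [1..<Suc n]) [1..<Suc n]"
    have "concat xss ! ((u - 1) * n + (v - 1)) = xss ! (u - 1) ! (v - 1) \<and> (u - 1) * n + (v - 1) < length (concat xss)"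
      by (rule nth_concat_uniform) (use uv in \<open>auto simp: xss_def\<close>)
    moreover have "xss ! (u - 1) ! (v - 1) = of_bool ((u, v) \<in> E)"
    proof -
      have "u - 1 < n" "v - 1 < n" "[1..<Suc n] ! (u - 1) = u" "[1..<Suc n] ! (v - 1) = v"
        using uv nth_upt[of 1 "u - 1" "Suc n"] nth_upt[of 1 "v - 1" "Suc n"] by auto
      then show ?thesis unfolding xss_def by (simp del: upt_Suc One_nat_def)
    qed
    moreover have "of_bool b mod 2 ^ w = (of_bool b :: nat)" for b
      using num[of 0] num[of 1] by (cases b) auto
    ultimately show "mem (encoder_input w n E) (adr n 0 u v) = edge_color E u v"
      unfolding encoder_input_def init_state_def adr_def edge_color_def xss_def
      by (simp del: upt_Suc)
  qed
qed

text \<open>The final value of register 0 is the start of region 16, where the output table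
  begins.\<close>

definition encoder_program :: program where
  "encoder_program = Seq (ccom encoder_com)
     (Seq (cexp scratch (mul (mul (ENum 16) (EVar 0)) (EVar 0))) (Op 0 Or scratch scratch))"

lemmas program_defs = encoder_com_def orient_com_def split_com_def fill_def gammaE_def exE_def countE_def xE_def yE_def
  startE_def no_cutE_def level_ofE_def levelE_def hopsE_def hopE_def sizeE_def blockE_def keyE_def rank_partE_def
  beatsE_def valueE_def widthE_def placeE_def cellE_def indexE_def adrE_def

lemma okc_encoder_com: "okc {0} encoder_com"
  by (simp add: program_defs scratch_def)

lemma fitsc_encoder_com: "fitsc 3 encoder_com"
  by (simp add: program_defs)

context encoder_run
begin

text \<open>Regions 16 and 17 are adjacent and form one array. Both are taken because for
  \<open>n = 1\<close> a single region has one word, while the table needs two.\<close>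

lemma cell_content:
  assumes t: "tab m J" "16 \<in> J" "17 \<in> J" and p: "p < 2 * (n * n)"
  shows "m (16 * n * n + p) = cell n p"
proof -
  have *: "m ((j * n * n) + p') = F j (p' div n + 1) (p' mod n + 1)" if j: "j \<in> J" and p': "p' < n * n" for j p'
  proof -
    have "p' div n < n" using p' n by (simp add: less_mult_imp_div_less)
    then have "p' div n + 1 \<in> {1..n}" "p' mod n + 1 \<in> {1..n}" using n by (simp_all add: Suc_leI)
    then have "m (adr n j (p' div n + 1) (p' mod n + 1)) = F j (p' div n + 1) (p' mod n + 1)"
      using t(1) j unfolding tab_def rep_def by blast
    moreover have "adr n j (p' div n + 1) (p' mod n + 1) = j * n * n + p'"
      by (simp add: adr_def add_mult_distrib)
    ultimately show ?thesis by simp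
  qed
  show ?thesis
  proof (cases "p < n * n")
    case True
    then show ?thesis using *[OF t(2) True] by (simp add: table_simps)
  next
    case False
    then obtain q where q: "p = n * n + q" using le_Suc_ex not_less by blast
    then have q': "q < n * n" using p by simp
    have "F 17 (q div n + 1) (q mod n + 1) = cell n p"
      unfolding q by (simp add: table_simps)
    moreover have "17 * n * n + q = 16 * n * n + p" unfolding q by simp
    ultimately show ?thesis using *[OF t(3) q'] by (simp only:)
  qed
qed

lemma encoder_output_table:
  assumes t: "tab (mem s) J" "15 \<in> J" "16 \<in> J" "17 \<in> J" and s: "reg s 0 = 16 * n * n"
    and fits: "3 * field_width n + 3 \<le> w"
  shows "encoder_output w n s (encode n E)"
  unfolding encoder_output_def
proof (intro ballI)
  fix u assume u: "u \<in> {1..n}"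
  let ?p = "2 * (u - 1)" and ?l = "encode n E u"
  have "n \<le> n * n" using n by simp
  moreover have "?p + 1 < 2 * n" using u by auto
  ultimately have p: "?p < 2 * (n * n)" "?p + 1 < 2 * (n * n)" by linarith+
  have len: "length ?l = 3 * field_width n + 3" by (simp add: encode_def)
  have pk: "pack w ?l = [label_number ?l]" by (rule pack_single) (use len fits in simp_all)
  have "mem s (16 * n * n + ?p) = 3 * field_width n + 3" using cell_content[OF t(1,3,4) p(1)] by (simp add: cell_def)
  moreover have "mem s (16 * n * n + ?p + 1) = adr n 15 u 1"
    using cell_content[OF t(1,3,4) p(2)] u by (simp add: cell_def adr_def)
  moreover have "mem s (adr n 15 u 1) = label_number ?l"
  proof -
    have "mem s (adr n 15 u 1) = F 15 u 1" using t(1,2) u n unfolding tab_def rep_def by auto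
    then show ?thesis using label_number_encode[OF perm u] by (simp add: table_simps)
  qed
  ultimately show "let e = reg s 0 + 2 * (u - 1) in mem s e = length ?l \<and>
      (\<forall>i<length (pack w ?l). mem s (mem s (e + 1) + i) = pack w ?l ! i)"
    unfolding Let_def s len pk by simp
qed

end

theorem polynomial_time_encode: "polynomial_time_encoder permutation_graph encode"
proof -
  let ?e = "mul (mul (ENum 16) (EVar 0)) (EVar 0)"
  have "poly_bounded (\<lambda>n. costc n encoder_com + (cost n ?e + 1))"
    by (intro poly_bounded_intros costc_poly_bounded cost_poly_bounded)
  then obtain c k where ck: "\<And>n. 1 \<le> n \<Longrightarrow> costc n encoder_com + (cost n ?e + 1) \<le> c * n ^ k"
    unfolding poly_bounded_def by blast
  have main: "\<exists>t\<le>c * n ^ k. \<exists>s. runs w encoder_program (encoder_input w n E) t s \<and> encoder_output w n s (encode n E)"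
    if n: "1 \<le> n" and g: "permutation_graph n E" and ws: "word_size 40 b n w" for b n E w
  proof -
    interpret machine w n by (rule machine_word_size[OF n ws])
    interpret encoder_run w n E by unfold_locales (rule g)
    let ?s = "encoder_input w n E"
    note inp = encoder_input_rep[OF machine_axioms, where E=E]
    have n3: "3 * n < 2 ^ w" by (rule lin) simp
    obtain t1 s1 where 1: "runs w (ccom encoder_com) ?s t1 s1" "t1 \<le> costc n encoder_com"
      "mem s1 = sem w encoder_com (reg ?s) (mem ?s)" "\<forall>r\<in>{0}. reg s1 r = reg ?s r"
      using ccom_correct[OF okc_encoder_com _ _ fitsc_encoder_com n3, where s="?s"] inp(2) w_pos
      by (auto simp: scratch_def)
    have r1: "reg s1 0 = n" using 1(4) inp(2) by simp
    have tb: "tab (mem s1) {0, 2, 5, 6, 7, 8, 9, 10, 11, 12, 13, 14, 15, 16, 17}"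
      unfolding 1(3) by (rule encoder_com_table[where env="reg ?s" and m="mem ?s", OF inp])
    have "16 * n * n \<le> 1000000 * (n * n * n)" using cube(2) by (simp only: mult.assoc)
    then have b: "16 * n * n < 2 ^ w" by (rule word)
    have "16 * n < 2 ^ w" by (rule lin) simp
    then have v: "ev w ?e (reg s1) (mem s1) = 16 * n * n"
      by (intro mul_val num_ev var_val r1 b; simp)
    have "computes w {0} scratch (cexp scratch ?e) s1 (cost n ?e) (ev w ?e (reg s1) (mem s1))"
      by (rule cexp_correct[where N=3]) (use n3 r1 w_pos in \<open>auto simp: scratch_def\<close>)
    then obtain t2 s2 where 2: "runs w (cexp scratch ?e) s1 t2 s2" "t2 \<le> cost n ?e" "mem s2 = mem s1"
      "reg s2 scratch = 16 * n * n"
      unfolding v by (rule computesE) (rule that)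
    let ?s3 = "s2\<lparr>reg := (reg s2)(0 := binop_val w Or (reg s2 scratch) (reg s2 scratch))\<rparr>"
    have "runs w encoder_program ?s (t1 + (t2 + 1)) ?s3"
      unfolding encoder_program_def by (intro runs.Seq[OF 1(1)] runs.Seq[OF 2(1)] runs.Op)
    moreover have "t1 + (t2 + 1) \<le> c * n ^ k" using 1(2) 2(2) ck[OF n] by linarith
    moreover have "encoder_output w n ?s3 (encode n E)"
      by (rule encoder_output_table[where J="{0, 2, 5, 6, 7, 8, 9, 10, 11, 12, 13, 14, 15, 16, 17}"])
        (use tb 2 label_fits[OF n ws] in simp_all)
    ultimately show ?thesis by blast
  qed
  show ?thesis unfolding polynomial_time_encoder_def
    by (rule exI[of _ encoder_program], rule exI[of _ 40], rule conjI, simp, rule allI, rule exI[of _ c],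
        rule exI[of _ k], intro allI impI, elim conjE, rule main)
qed

section \<open>The decoder on the word RAM\<close>

text \<open>Each label is one word, read at the addresses in registers 1 and 3. Variable 4 is the
  field range; skew, first key, second key and place are in variables 7 to 10 for the first label
  and 11 to 14 for the second.\<close>

definition fieldsE :: "exp \<Rightarrow> exp" where
  "fieldsE body = ELet 4 (EOp Shl (ENum 1) (sub (EOp Div (EVar 0) (ENum 3)) (ENum 1)))
     (ELet 5 (EOp Div (EMem (EVar 1)) (ENum 8)) (ELet 6 (EOp Div (EMem (EVar 3)) (ENum 8))
     (ELet 7 (EOp Mod (EMem (EVar 1)) (ENum 8)) (ELet 8 (EOp Mod (EVar 5) (EVar 4))
     (ELet 9 (EOp Mod (EOp Div (EVar 5) (EVar 4)) (EVar 4)) (ELet 10 (EOp Div (EOp Div (EVar 5) (EVar 4)) (EVar 4))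
     (ELet 11 (EOp Mod (EMem (EVar 3)) (ENum 8)) (ELet 12 (EOp Mod (EVar 6) (EVar 4))
     (ELet 13 (EOp Mod (EOp Div (EVar 6) (EVar 4)) (EVar 4)) (ELet 14 (EOp Div (EOp Div (EVar 6) (EVar 4)) (EVar 4))
     body))))))))))"

definition connectedE :: exp where
  "connectedE = ECond (lessE (EOp And (EVar 8) (EVar 12)) (EOp Xor (EVar 8) (EVar 12))) (ENum 0)
     (ECond (lessE (EVar 8) (EOp Xor (EVar 10) (EVar 14))) (ENum 0) (ENum 1))"

text \<open>Word subtraction wraps around, so the truncation at 0 in \<open>gap\<close> is tested
  explicitly; 10 is the shift 8 plus the correction 2.\<close>

definition gapE :: "nat \<Rightarrow> nat \<Rightarrow> nat \<Rightarrow> nat \<Rightarrow> exp" where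
  "gapE l l' r r' = ELet 19 (add (EVar l') (ECond (lessE (EVar r') (EVar r)) (ENum 8) (ENum 10)))
     (ECond (lessE (EVar 19) (EVar l)) (ENum 0) (sub (EVar 19) (EVar l)))"

definition dominatedE :: "nat \<Rightarrow> nat \<Rightarrow> nat \<Rightarrow> nat \<Rightarrow> nat \<Rightarrow> nat \<Rightarrow> nat \<Rightarrow> nat \<Rightarrow> exp" where
  "dominatedE l\<^sub>x l\<^sub>y r\<^sub>x r\<^sub>y l\<^sub>x' l\<^sub>y' r\<^sub>x' r\<^sub>y' =
     ELet 20 (gapE l\<^sub>x l\<^sub>x' r\<^sub>x r\<^sub>x') (ELet 21 (gapE l\<^sub>x l\<^sub>y' r\<^sub>x r\<^sub>y')
     (ELet 22 (gapE l\<^sub>y l\<^sub>x' r\<^sub>y r\<^sub>x') (ELet 23 (gapE l\<^sub>y l\<^sub>y' r\<^sub>y r\<^sub>y')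
     (ELet 24 (ECond (lessE (EVar 20) (EVar 21)) (EVar 20) (EVar 21))
     (ELet 25 (ECond (lessE (EVar 22) (EVar 23)) (EVar 22) (EVar 23))
     (ELet 26 (ECond (lessE (EVar 24) (EVar 25)) (EVar 24) (EVar 25))
     (ECond (lessE (EVar 26) (ENum 10)) (ENum 2) (sub (EVar 26) (ENum 7)))))))))"

definition beforeE :: "nat \<Rightarrow> nat \<Rightarrow> nat \<Rightarrow> nat \<Rightarrow> exp" where
  "beforeE l r l' r' = orE (lessE (EVar l) (EVar l')) (andE (eqE (EVar l) (EVar l')) (lessE (EVar r) (EVar r')))"

definition distE :: exp where
  "distE = ELet 15 (add (EVar 10) (ENum 3)) (ELet 16 (add (EVar 10) (EVar 7))
     (ELet 17 (add (EVar 14) (ENum 3)) (ELet 18 (add (EVar 14) (EVar 11))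
     (ECond (eqE (beforeE 15 8 17 12) (beforeE 16 9 18 13))
       (ECond (beforeE 15 8 17 12) (dominatedE 15 16 8 9 17 18 12 13) (dominatedE 17 18 12 13 15 16 8 9))
       (ENum 1)))))"

text \<open>Registers 0 and 1 are inputs of both computations, so the answers wait in scratch
  registers until the end.\<close>

definition decoder_program :: program where
  "decoder_program = Seq (cexp scratch (fieldsE connectedE)) (Seq (cexp (Suc scratch) (fieldsE distE))
     (Seq (Op 0 Or scratch scratch) (Op 1 Or (Suc scratch) (Suc scratch))))"

lemmas decoder_defs = fieldsE_def connectedE_def gapE_def dominatedE_def beforeE_def distE_def

lemma ok_decoder: "ok {0, 1, 2, 3} (fieldsE connectedE)" "ok {0, 1, 2, 3} (fieldsE distE)"
  by (simp_all add: decoder_defs scratch_def)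

lemma fits_decoder: "fits 1 (fieldsE connectedE)" "fits 1 (fieldsE distE)"
  by (simp_all add: decoder_defs)

text \<open>The decoder has no loops, so its cost does not depend on register 0, which here contains
  a label length instead of \<open>n\<close>.\<close>

lemma cost_decoder: "cost n (fieldsE connectedE) = cost 0 (fieldsE connectedE)" "cost n (fieldsE distE) = cost 0 (fieldsE distE)"
  by (simp_all add: decoder_defs)

context machine
begin

definition fields_env :: "nat \<Rightarrow> nat \<Rightarrow> nat \<Rightarrow> (nat \<Rightarrow> nat) \<Rightarrow> nat \<Rightarrow> nat" where
  "fields_env R V V' env = env(4 := R, 5 := V div 8, 6 := V' div 8, 7 := V mod 8, 8 := V div 8 mod R,
     9 := V div 8 div R mod R, 10 := V div 8 div R div R, 11 := V' mod 8, 12 := V' div 8 mod R,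
     13 := V' div 8 div R mod R, 14 := V' div 8 div R div R)"

lemma ev_fieldsE:
  assumes env: "env 0 = 3 * f + 3" "m (env 1) = V" "m (env 3) = V'" and R: "2 ^ f < (2::nat) ^ w" and f: "3 * f + 3 < 2 ^ w"
  shows "ev w (fieldsE body) env m = ev w body (fields_env (2 ^ f) V V' env) m"
proof -
  have "ev w (sub (EOp Div (EVar 0) (ENum 3)) (ENum 1)) env m = (3 * f + 3) div 3 - 1"
    by (intro sub_val div_val var_val const_ev env) (use f in simp_all)
  then have 4: "ev w (EOp Shl (ENum 1) (sub (EOp Div (EVar 0) (ENum 3)) (ENum 1))) env m = 2 ^ f"
    by (intro shl_val R) simp
  show ?thesis
    unfolding fieldsE_def ev.simps(7) 4 fields_env_def
    by (simp add: const_ev env del: ev.simps(2) One_nat_def)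
qed

lemma ten_ev: "ev w (ENum 10) env m = 10"
  by (rule num_ev) simp

lemma connectedE_val:
  "ev w connectedE env m = of_bool (connected_fields (env 8) (env 10) (env 12) (env 14))"
  unfolding connectedE_def ev.simps(5) less_ev const_ev by (simp add: connected_fields_def)

lemma gapE_val:
  assumes "env l' + 10 < 2 ^ w" "{l, l', r, r'} \<subseteq> {..<19}"
  shows "ev w (gapE l l' r r') env m = gap (env l) (env l') (env r) (env r')"
proof -
  let ?t = "env l' + (if env r' < env r then 8 else 10)"
  have t: "?t < 2 ^ w" using assms(1) by simp
  have c: "ev w (ECond (lessE (EVar r') (EVar r)) (ENum 8) (ENum 10)) env m = (if env r' < env r then 8 else 10)"
    unfolding ev.simps(5) less_ev const_ev ten_ev by simp
  have a: "ev w (add (EVar l') (ECond (lessE (EVar r') (EVar r)) (ENum 8) (ENum 10))) env m = ?t"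
    by (rule add_val[OF _ c t]) simp
  have l: "l \<noteq> 19" using assms(2) by auto
  have s: "ev w (sub (EVar 19) (EVar l)) (env(19 := ?t)) m = ?t - env l" if "env l \<le> ?t"
    by (rule sub_val[OF _ _ that t]) (use l in simp_all)
  have "ev w (gapE l l' r r') env m = (if ?t < env l then 0 else ?t - env l)"
    unfolding gapE_def ev.simps(7) a unfolding ev.simps(5) less_ev const_ev
    using s l by (simp add: not_less del: ev.simps(3))
  then show ?thesis by (cases "env r' < env r") (auto simp: gap_def add.commute)
qed

lemma dominatedE_val:
  assumes "env l\<^sub>x' + 10 < 2 ^ w" "env l\<^sub>y' + 10 < 2 ^ w" "{l\<^sub>x, l\<^sub>y, r\<^sub>x, r\<^sub>y, l\<^sub>x', l\<^sub>y', r\<^sub>x', r\<^sub>y'} \<subseteq> {..<19}"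
  shows "ev w (dominatedE l\<^sub>x l\<^sub>y r\<^sub>x r\<^sub>y l\<^sub>x' l\<^sub>y' r\<^sub>x' r\<^sub>y') env m =
    dominated_dist (env l\<^sub>x) (env l\<^sub>y) (env r\<^sub>x) (env r\<^sub>y) (env l\<^sub>x') (env l\<^sub>y') (env r\<^sub>x') (env r\<^sub>y')"
proof -
  define g1 where "g1 = gap (env l\<^sub>x) (env l\<^sub>x') (env r\<^sub>x) (env r\<^sub>x')"
  define g2 where "g2 = gap (env l\<^sub>x) (env l\<^sub>y') (env r\<^sub>x) (env r\<^sub>y')"
  define g3 where "g3 = gap (env l\<^sub>y) (env l\<^sub>x') (env r\<^sub>y) (env r\<^sub>x')"
  define g4 where "g4 = gap (env l\<^sub>y) (env l\<^sub>y') (env r\<^sub>y) (env r\<^sub>y')"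
  have lt: "l\<^sub>x < 19" "l\<^sub>y < 19" "r\<^sub>x < 19" "r\<^sub>y < 19" "l\<^sub>x' < 19" "l\<^sub>y' < 19" "r\<^sub>x' < 19" "r\<^sub>y' < 19"
    using assms(3) by auto
  have 1: "ev w (gapE l\<^sub>x l\<^sub>x' r\<^sub>x r\<^sub>x') env m = g1" unfolding g1_def by (rule gapE_val) (use assms in auto)
  have 2: "ev w (gapE l\<^sub>x l\<^sub>y' r\<^sub>x r\<^sub>y') (env(20 := g1)) m = g2"
    using gapE_val[of "env(20 := g1)" l\<^sub>y' l\<^sub>x r\<^sub>x r\<^sub>y' m] assms lt by (simp add: g2_def)
  have 3: "ev w (gapE l\<^sub>y l\<^sub>x' r\<^sub>y r\<^sub>x') (env(20 := g1, 21 := g2)) m = g3"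
    using gapE_val[of "env(20 := g1, 21 := g2)" l\<^sub>x' l\<^sub>y r\<^sub>y r\<^sub>x' m] assms lt by (simp add: g3_def)
  have 4: "ev w (gapE l\<^sub>y l\<^sub>y' r\<^sub>y r\<^sub>y') (env(20 := g1, 21 := g2, 22 := g3)) m = g4"
    using gapE_val[of "env(20 := g1, 21 := g2, 22 := g3)" l\<^sub>y' l\<^sub>y r\<^sub>y r\<^sub>y' m] assms lt by (simp add: g4_def)
  define k where "k = min (min g1 g2) (min g3 g4)"
  have "g1 \<le> env l\<^sub>x' + 10" unfolding g1_def gap_def by (rule order_trans[OF diff_le_self]) simp
  then have "g1 < 2 ^ w" using assms(1) by linarith
  then have kw: "k < 2 ^ w" by (simp add: k_def)
  let ?e = "env(20 := g1, 21 := g2, 22 := g3, 23 := g4)"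
  have m: "ev w (ECond (lessE (EVar i) (EVar j)) (EVar i) (EVar j)) e m = min (e i) (e j)" for i j e by (simp add: min_def)
  have s: "ev w (sub (EVar 26) (ENum 7)) e m = k - 7" if "e 26 = k" "7 \<le> k" for e
    by (intro sub_val var_val const_ev that kw)
  have "ev w (dominatedE l\<^sub>x l\<^sub>y r\<^sub>x r\<^sub>y l\<^sub>x' l\<^sub>y' r\<^sub>x' r\<^sub>y') env m = (if k < 10 then 2 else k - 7)"
    unfolding dominatedE_def ev.simps(7) 1 2 3 4 m unfolding ev.simps(5) less_ev const_ev ten_ev
    using s[of "?e(24 := min g1 g2, 25 := min g3 g4, 26 := k)"]
    by (cases "k < 10") (simp_all add: k_def[symmetric] not_less del: ev.simps(3) min_less_iff_disj)
  then show ?thesis by (simp add: dominated_dist_def k_def g1_def g2_def g3_def g4_def Let_def)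
qed

lemma beforeE_val: "ev w (beforeE l r l' r') env m = of_bool (before (env l) (env r) (env l') (env r'))"
  unfolding beforeE_def ev.simps(5) less_ev eq_ev const_ev by (simp add: before_def)

lemma distE_val:
  assumes "env 10 + 20 < 2 ^ w" "env 14 + 20 < 2 ^ w" "env 7 < 8" "env 11 < 8"
  shows "ev w distE env m = dist_fields (env 10 + 3) (env 10 + env 7) (env 8) (env 9)
     (env 14 + 3) (env 14 + env 11) (env 12) (env 13)"
proof -
  have 15: "ev w (add (EVar 10) (ENum 3)) env m = env 10 + 3"
    by (intro add_val var_val const_ev refl) (use assms in linarith)
  let ?e1 = "env(15 := env 10 + 3)"
  have 16: "ev w (add (EVar 10) (EVar 7)) ?e1 m = env 10 + env 7"
    by (intro add_val var_val) (use assms in simp_all)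
  let ?e2 = "?e1(16 := env 10 + env 7)"
  have 17: "ev w (add (EVar 14) (ENum 3)) ?e2 m = env 14 + 3"
    by (intro add_val var_val const_ev) (use assms in simp_all)
  let ?e3 = "?e2(17 := env 14 + 3)"
  have 18: "ev w (add (EVar 14) (EVar 11)) ?e3 m = env 14 + env 11"
    by (intro add_val var_val) (use assms in simp_all)
  define e where "e = ?e3(18 := env 14 + env 11)"
  have look: "e 15 = env 10 + 3" "e 16 = env 10 + env 7" "e 17 = env 14 + 3" "e 18 = env 14 + env 11"
    "e 8 = env 8" "e 9 = env 9" "e 12 = env 12" "e 13 = env 13"
    by (simp_all add: e_def)
  have "env 14 + 3 + 10 < 2 ^ w" "env 14 + env 11 + 10 < 2 ^ w" "env 10 + 3 + 10 < 2 ^ w" "env 10 + env 7 + 10 < 2 ^ w"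
    using assms by linarith+
  note big = this
  have b: "e 17 + 10 < 2 ^ w" "e 18 + 10 < 2 ^ w" "e 15 + 10 < 2 ^ w" "e 16 + 10 < 2 ^ w"
    unfolding look by (rule big)+
  have d: "ev w (dominatedE 15 16 8 9 17 18 12 13) e m =
      dominated_dist (e 15) (e 16) (e 8) (e 9) (e 17) (e 18) (e 12) (e 13)"
    by (rule dominatedE_val[where env=e, OF b(1,2)]) simp
  have d': "ev w (dominatedE 17 18 12 13 15 16 8 9) e m =
      dominated_dist (e 17) (e 18) (e 12) (e 13) (e 15) (e 16) (e 8) (e 9)"
    by (rule dominatedE_val[where env=e, OF b(3,4)]) simp
  have "ev w distE env m = (if of_bool (of_bool (before (e 15) (e 8) (e 17) (e 12)) = (of_bool (before (e 16) (e 9) (e 18) (e 13)) :: nat)) \<noteq> (0::nat)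
      then if of_bool (before (e 15) (e 8) (e 17) (e 12)) \<noteq> (0::nat)
        then dominated_dist (e 15) (e 16) (e 8) (e 9) (e 17) (e 18) (e 12) (e 13)
        else dominated_dist (e 17) (e 18) (e 12) (e 13) (e 15) (e 16) (e 8) (e 9)
      else 1)"
    unfolding distE_def ev.simps(7) 15 16 17 18 e_def[symmetric] unfolding ev.simps(5) eq_ev beforeE_val d d' const_ev ..
  also have "\<dots> = dist_fields (e 15) (e 16) (e 8) (e 9) (e 17) (e 18) (e 12) (e 13)"
    unfolding dist_fields_def of_bool_eq_iff of_bool_eq_0_iff not_not by (rule refl)
  finally show ?thesis unfolding look .
qed

end

theorem constant_time_decode: "constant_time_decoder permutation_graph encode decode"
proof -
  define T where "T = cost 0 (fieldsE connectedE) + (cost 0 (fieldsE distE) + (1 + 1))"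
  have main: "\<exists>t\<le>T. \<exists>s. runs w decoder_program (decoder_input w (encode n E u) (encode n E v)) t s \<and>
      decoder_output s (decode (encode n E u) (encode n E v))"
    if g: "permutation_graph n E" and ws: "word_size 40 b n w" and uv: "u \<in> {1..n}" "v \<in> {1..n}" for b n E w u v
  proof -
    have n: "1 \<le> n" using uv by simp
    interpret machine w n by (rule machine_word_size[OF n ws])
    obtain x y where "diagram n E x y (seg_code n E)" using seg_code_diagram[OF g] by blast
    then interpret diagram n E x y "seg_code n E" .
    let ?fw = "field_width n" and ?l = "encode n E u" and ?l' = "encode n E v"
    define R :: nat where "R = 2 ^ ?fw"
    define V where "V = label_number ?l"
    define V' where "V' = label_number ?l'"
    have fits: "3 * ?fw + 3 \<le> w" by (rule label_fits[OF n ws])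
    have len: "length ?l = 3 * ?fw + 3" "length ?l' = 3 * ?fw + 3" by (simp_all add: encode_def)
    have pk: "pack w ?l = [V]" "pack w ?l' = [V']" unfolding V_def V'_def by (rule pack_single; use len fits in simp)+
    have "(2::nat) ^ (3 * ?fw + 3) \<le> 2 ^ w" using fits by (rule power_increasing) simp
    then have Vw: "V < 2 ^ w" "V' < 2 ^ w"
      using label_value_less[OF uv(1)] label_value_less[OF uv(2)] label_number_encode[OF g uv(1)] label_number_encode[OF g uv(2)]
      unfolding V_def V'_def by linarith+
    have fw: "3 * ?fw + 3 < 2 ^ w" using field_width_bounds(4)[OF n] n by (intro lin) linarith
    have Rw: "2 ^ ?fw < (2::nat) ^ w" using field_width_bounds(2)[OF n] by (intro lin) linarith
    let ?s = "decoder_input w ?l ?l'"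
    have regs: "reg ?s 0 = 3 * ?fw + 3" "reg ?s 1 = 0" "reg ?s 3 = 1" "mem ?s 0 = V" "mem ?s 1 = V'"
      using fw Vw num[of 1] by (simp_all add: decoder_input_def init_state_def pk len del: One_nat_def)
    define env where "env = fields_env R V V' (reg ?s)"
    have field: "ev w (fieldsE body) (reg ?s) (mem ?s) = ev w body env (mem ?s)" for body
      unfolding env_def R_def by (rule ev_fieldsE[OF _ _ _ Rw fw]) (use regs in simp_all)
    have env: "env 7 = V mod 8" "env 8 = V div 8 mod R" "env 9 = V div 8 div R mod R" "env 10 = V div 8 div R div R"
      "env 11 = V' mod 8" "env 12 = V' div 8 mod R" "env 13 = V' div 8 div R mod R" "env 14 = V' div 8 div R div R"
      by (simp_all add: env_def fields_env_def)
    have small: "X div 8 div R div R + 20 < 2 ^ w" if "X < 2 ^ w" for X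
    proof -
      have "X div 8 div R div R \<le> X div 8" using div_le_dividend order_trans by blast
      moreover have "1000 < (2::nat) ^ w" using n by (intro word) (use cube(3) in linarith)
      ultimately show ?thesis using that by linarith
    qed
    let ?c = "connected_fields (env 8) (env 10) (env 12) (env 14)"
    let ?d = "dist_fields (env 10 + 3) (env 10 + env 7) (env 8) (env 9) (env 14 + 3) (env 14 + env 11) (env 12) (env 13)"
    have c: "ev w (fieldsE connectedE) (reg ?s) (mem ?s) = of_bool ?c"
      unfolding field by (rule connectedE_val)
    have d: "ev w (fieldsE distE) (reg ?s) (mem ?s) = ?d"
      unfolding field by (rule distE_val) (use small Vw in \<open>simp_all add: env\<close>)
    have L: "{0, 1, 2, 3} \<subseteq> {..<scratch}" by (simp add: scratch_def)
    have fw1: "1 * (3 * ?fw + 3) < 2 ^ w" using fw by simp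
    have "computes w {0, 1, 2, 3} scratch (cexp scratch (fieldsE connectedE)) ?s
      (cost (3 * ?fw + 3) (fieldsE connectedE)) (ev w (fieldsE connectedE) (reg ?s) (mem ?s))"
      by (rule cexp_correct[OF ok_decoder(1) _ L _ fits_decoder(1) fw1]) (use regs w_pos in simp_all)
    then obtain t1 s1 where 1: "runs w (cexp scratch (fieldsE connectedE)) ?s t1 s1" "t1 \<le> cost (3 * ?fw + 3) (fieldsE connectedE)"
      "mem s1 = mem ?s" "reg s1 scratch = of_bool ?c" "\<And>r. r \<in> {0, 1, 2, 3} \<Longrightarrow> reg s1 r = reg ?s r"
      "\<And>r. scratch \<le> r \<Longrightarrow> r < scratch \<Longrightarrow> reg s1 r = reg ?s r"
      unfolding c by (rule computesE) (rule that)
    have r0: "reg s1 0 = 3 * ?fw + 3" using 1(5)[of 0] regs(1) by simp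
    have "ev w (fieldsE distE) (reg s1) (mem s1) = ev w (fieldsE distE) (reg ?s) (mem ?s)"
      unfolding 1(3) by (rule ev_cong[OF ok_decoder(2)]) (use 1(5) in simp_all)
    then have d1: "ev w (fieldsE distE) (reg s1) (mem s1) = ?d" using d by simp
    have "computes w {0, 1, 2, 3} (Suc scratch) (cexp (Suc scratch) (fieldsE distE)) s1
      (cost (3 * ?fw + 3) (fieldsE distE)) (ev w (fieldsE distE) (reg s1) (mem s1))"
      by (rule cexp_correct[OF ok_decoder(2) _ L _ fits_decoder(2) fw1]) (use r0 w_pos in simp_all)
    then obtain t2 s2 where 2: "runs w (cexp (Suc scratch) (fieldsE distE)) s1 t2 s2" "t2 \<le> cost (3 * ?fw + 3) (fieldsE distE)"
      "mem s2 = mem s1" "reg s2 (Suc scratch) = ?d" "\<And>r. r \<in> {0, 1, 2, 3} \<Longrightarrow> reg s2 r = reg s1 r"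
      "\<And>r. scratch \<le> r \<Longrightarrow> r < Suc scratch \<Longrightarrow> reg s2 r = reg s1 r"
      unfolding d1 by (rule computesE) (rule that)
    have s2: "reg s2 scratch = of_bool ?c" using 2(6)[of scratch] 1(4) by simp
    define s3 where "s3 = s2\<lparr>reg := (reg s2)(0 := binop_val w Or (reg s2 scratch) (reg s2 scratch))\<rparr>"
    define s4 where "s4 = s3\<lparr>reg := (reg s3)(1 := binop_val w Or (reg s3 (Suc scratch)) (reg s3 (Suc scratch)))\<rparr>"
    have "runs w decoder_program ?s (t1 + (t2 + (1 + 1))) s4"
      unfolding decoder_program_def s4_def s3_def
      by (intro runs.Seq[OF 1(1)] runs.Seq[OF 2(1)] runs.Seq[OF runs.Op] runs.Op)
    moreover have "t1 + (t2 + (1 + 1)) \<le> T"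
      using 1(2) 2(2) unfolding T_def cost_decoder[of "3 * ?fw + 3"] by linarith
    moreover have "reg s4 0 = of_bool ?c" "reg s4 1 = ?d"
      using s2 2(4) by (simp_all add: s4_def s3_def scratch_def)
    moreover have "decode ?l ?l' = (if ?c then enat ?d else \<infinity>)"
    proof -
      have "length ?l div 3 - 1 = ?fw" by (simp add: len)
      then show ?thesis
        unfolding decode_def decode_value_def Let_def V_def[symmetric] V'_def[symmetric] env by (simp add: R_def)
    qed
    ultimately show ?thesis by (intro exI[of _ "t1 + (t2 + (1 + 1))"] conjI exI[of _ s4]) (simp_all add: decoder_output_def)
  qed
  show ?thesis unfolding constant_time_decoder_def
    by (rule exI[of _ decoder_program], rule exI[of _ 40], rule conjI, simp, rule allI, rule exI[of _ T],
        intro allI impI ballI, elim conjE, rule main)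
qed

theorem theorem1:
  shows "\<exists>(enc :: encoder) (dec :: decoder).
    distance_labeling_scheme permutation_graph enc dec \<and>
    (\<exists>f :: nat \<Rightarrow> real. f \<in> O(\<lambda>n. log 2 (log 2 (real n))) \<and>
      (\<forall>n\<ge>1. real (scheme_size permutation_graph enc n) \<le> 3 * log 2 (real n) + f n)) \<and>
    constant_time_decoder permutation_graph enc dec \<and>
    polynomial_time_encoder permutation_graph enc"
proof -
  have "real (scheme_size permutation_graph encode n) \<le> 3 * log 2 (real n) + 18" if "1 \<le> n" for n
    unfolding scheme_size_encode[OF that] using log_field_width[OF that] by simp
  then show ?thesis
    using encode_decode constant_time_decode polynomial_time_encode const_bigo_log_log by blast
qed

end
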